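(* Let $A$ be a self-adjoint operator, semi-bounded from below, on a Hilbert space $\mathcal{H}$, with spectral measure $E$ and quadratic form $\mathfrak{a}$. Let $a<b$ be real numbers in $\rho(A)$, $\Delta=[a,b]$, and suppose $\sigma(A)\cap\Delta=\{\lambda_1,\dots,\lambda_d\}\subset\sigma_{\mathrm{dis}}(A)$ with $d<\infty$. Fix $\lambda\in\{\lambda_1,\dots,\lambda_d\}$, put $\kappa=\dim\mathcal{L}(\{\lambda\})$, and fix $0<r<1/2$ such that \[ \mathbb{D}(\lambda+i,2r)\cap(\sigma(A)+i)=\{\lambda+i\}\quad\text{and}\quad\mathbb{D}(\lambda+i,2r)\cap\Gamma_{a,b}^{0,1}=\varnothing . \] Let $(P_n)_{n\in\mathbb{N}}$ be a sequence of finite-rank orthogonal projections on $\mathcal{H}$ with ranges $\mathcal{L}_n\subset\mathrm{Dom}(\mathfrak{a})$ such that for every $u\in\mathrm{Dom}(\mathfrak{a})$ there exist $u_n\in\mathcal{L}_n$ with $\|u-u_n\|_{\mathfrak{a}}\to0$. Let $\mathcal{M}_n(\{\lambda+i\})$ be the spectral subspace of $A+iP_n$ corresponding to $\sigma(A+iP_n)\cap\mathbb{D}(\lambda+i,r)$, and fix $N\in\mathbb{N}$ such that for all $n\ge N$ the circle $|z-\lambda-i|=r$ lies in $\rho(A+iP_n)$ and $\dim\mathcal{M}_n(\{\lambda+i\})=\kappa$. For $n\ge N$ and all sufficiently large $k$, let $\mu_{n,k,1},\dots,\mu_{n,k,\kappa}$ be the repeated eigenvalues of $A_k+iP_kP_n:\mathcal{L}_k\to\mathcal{L}_k$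 enclosed by the circle $|z-\lambda-i|=r$. Put $\varepsilon_n=\delta(\mathcal{L}(\Delta),\mathcal{L}_n)$ and $\epsilon_k=\delta_{\mathfrak{a}}(\mathcal{L}(\Delta),\mathcal{L}_k)$. Then there exists a constant $c_5>0$, independent of $n\ge N$, such that for each $n\ge N$, \[ \max_{1\le j\le\kappa}|\mu_{n,k,j}-\lambda-i|\le c_5(\varepsilon_n+\epsilon_k)^2 \] for all sufficiently large $k$ (how large may depend on $n$).
   Context: $\mathbb{D}(x,y)$ is the closed disc in $\mathbb{C}$ with centre $x$ and radius $y$. For a Borel set $S\subset\mathbb{R}$, $\mathcal{L}(S)$ is the range of $E(S)$. $\sigma_{\mathrm{dis}}(A)$ is the discrete spectrum (isolated eigenvalues of finite multiplicity). Spectral subspaces of non-self-adjoint operators are ranges of Riesz projections. For each $k$, $A_k:\mathcal{L}_k\to\mathcal{L}_k$ is the self-adjoint operator defined by $\langle A_ku,v\rangle=\mathfrak{a}(u,v)$ for all $u,v\in\mathcal{L}_k$. For fixed $n\ge N$ and all sufficiently large $k$, the operator $A_k+iP_kP_n$ has exactly $\kappa$ eigenvalues (repeated according to algebraic multiplicity) enclosed by the circle $|z-\lambda-i|=r$. Let $m=\min\sigma(A)$. $\mathcal{H}_{\mathfrak{a}}$ is the Hilbert space $\mathrm{Dom}(\mathfrak{a})$ with inner product $\langle u,v\rangle_{\mathfrak{a}}=\mathfrak{a}(u,v)-(m-1)\langle u,v\rangle$ and norm $\|u\|_{\mathfrak{a}}=\|(A-m+1)^{1/2}u\|$. For subspaces,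 $\delta(\mathcal{M},\mathcal{N})=\sup_{u\in\mathcal{M},\|u\|=1}\mathrm{dist}(u,\mathcal{N})$; $\delta_{\mathfrak{a}}$ denotes the same quantity with norm and distance taken with respect to $\|\cdot\|_{\mathfrak{a}}$. The curve $\Gamma_{a,b}^{0,1}$: if $b-a\le1$, then $\Gamma_{a,b}^{0,1}=\{x+ih_\pm(x):x\in[a,b]\}$ (both signs) with $h_\pm(x)=\frac12\pm\sqrt{\frac14+(x-a)(x-b)}$; if $b-a>1$, then $\Gamma_{a,b}^{0,1}=\{k_\pm(y)+iy:y\in[0,1]\}$ (both signs) with $k_\pm(y)=\frac{a+b}{2}\pm\sqrt{(\frac{b-a}{2})^2+y(y-1)}$. *)

theory Defs
  imports "HOL-Analysis.Analysis"
begin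

section \<open>Complex Hilbert spaces\<close>

text \<open>
  The inner product is linear in its first argument.  Positive definiteness is not listed as an
  axiom: it follows from the last axiom, because the left-hand side is a norm.
\<close>

class complex_hilbert = banach +
  fixes scaleC :: "complex \<Rightarrow> 'a \<Rightarrow> 'a" (infixr "*\<^sub>C" 75)
    and cinner :: "'a \<Rightarrow> 'a \<Rightarrow> complex"
  assumes scaleC_add_right: "c *\<^sub>C (x + y) = c *\<^sub>C x + c *\<^sub>C y"
    and scaleC_add_left: "(c + d) *\<^sub>C x = c *\<^sub>C x + d *\<^sub>C x"
    and scaleC_scaleC: "c *\<^sub>C d *\<^sub>C x = (c * d) *\<^sub>C x"
    and scaleR_scaleC: "t *\<^sub>R x = complex_of_real t *\<^sub>C x"
    and cinner_commute: "cinner x y = cnj (cinner y x)"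
    and cinner_add_left: "cinner (x + y) z = cinner x z + cinner y z"
    and cinner_scaleC_left: "cinner (c *\<^sub>C x) y = c * cinner x y"
    and norm_eq_sqrt_cinner: "norm x = sqrt (Re (cinner x x))"

global_interpretation complex_vector:
  vector_space "scaleC :: complex \<Rightarrow> 'a \<Rightarrow> 'a::complex_hilbert"
proof
  fix x :: 'a
  have "1 *\<^sub>C x = 1 *\<^sub>R x"
    by (simp only: scaleR_scaleC of_real_1)
  then show "1 *\<^sub>C x = x"
    by simp
qed (simp_all add: scaleC_add_right scaleC_add_left scaleC_scaleC)

definition finite_dim :: "'a::complex_hilbert set \<Rightarrow> bool" where
  "finite_dim V \<longleftrightarrow> (\<exists>B. finite B \<and> V \<subseteq> complex_vector.span B)"

section \<open>Operators and spectra\<close>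

text \<open>
  A possibly unbounded operator is given by its domain \<open>D\<close> and a function \<open>T\<close> whose values
  outside \<open>D\<close> are irrelevant.
\<close>

definition linear_op :: "'a::complex_hilbert set \<Rightarrow> ('a \<Rightarrow> 'a) \<Rightarrow> bool" where
  "linear_op D T \<longleftrightarrow> complex_vector.subspace D \<and>
     (\<forall>u\<in>D. \<forall>v\<in>D. T (u + v) = T u + T v) \<and> (\<forall>c. \<forall>u\<in>D. T (c *\<^sub>C u) = c *\<^sub>C T u)"

text \<open>
  The right-hand side of the last equivalence says that \<open>v\<close> is in the domain of the adjoint
  and is mapped to \<open>w\<close> by it.
\<close>

definition self_adjoint_op :: "'a::complex_hilbert set \<Rightarrow> ('a \<Rightarrow> 'a) \<Rightarrow> bool" where
  "self_adjoint_op D T \<longleftrightarrow> linear_op D T \<and> closure D = UNIV \<and>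
     (\<forall>v w. v \<in> D \<and> T v = w \<longleftrightarrow> (\<forall>u\<in>D. cinner (T u) v = cinner u w))"

definition semibounded_below :: "'a::complex_hilbert set \<Rightarrow> ('a \<Rightarrow> 'a) \<Rightarrow> bool" where
  "semibounded_below D T \<longleftrightarrow> (\<exists>c. \<forall>u\<in>D. c * (norm u)\<^sup>2 \<le> Re (cinner (T u) u))"

definition orth_proj :: "('a::complex_hilbert \<Rightarrow> 'a) \<Rightarrow> bool" where
  "orth_proj P \<longleftrightarrow> linear_op UNIV P \<and> (\<forall>u. P (P u) = P u) \<and>
     (\<forall>u v. cinner (P u) v = cinner u (P v))"

definition resolvent_set :: "'a::complex_hilbert set \<Rightarrow> ('a \<Rightarrow> 'a) \<Rightarrow> complex set" where
  "resolvent_set D T = {z. bij_betw (\<lambda>u. z *\<^sub>C u - T u) D UNIV \<and>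
     (\<exists>C. \<forall>u\<in>D. norm u \<le> C * norm (z *\<^sub>C u - T u))}"

definition spectrum :: "'a::complex_hilbert set \<Rightarrow> ('a \<Rightarrow> 'a) \<Rightarrow> complex set" where
  "spectrum D T = - resolvent_set D T"

definition resolvent :: "'a::complex_hilbert set \<Rightarrow> ('a \<Rightarrow> 'a) \<Rightarrow> complex \<Rightarrow> 'a \<Rightarrow> 'a" where
  "resolvent D T z = inv_into D (\<lambda>u. z *\<^sub>C u - T u)"

text \<open>
  Used for self-adjoint operators only, for which the multiplicity of an eigenvalue is the dimension
  of the eigenspace.
\<close>

definition discrete_spectrum :: "'a::complex_hilbert set \<Rightarrow> ('a \<Rightarrow> 'a) \<Rightarrow> complex set" where
  "discrete_spectrum D T = {z. z isolated_in spectrum D T \<and>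
     (\<exists>u\<in>D. u \<noteq> 0 \<and> T u = z *\<^sub>C u) \<and> finite_dim {u\<in>D. T u = z *\<^sub>C u}}"

text \<open>
  The Riesz projection \<open>1/(2\<pi>\<i>) \<ointegral> (z - T)\<^sup>-\<^sup>1 u dz\<close> over the
  circle \<open>z = c + r exp(\<i>t)\<close>, \<open>0 \<le> t \<le> 2\<pi>\<close>, which has to lie in the
  resolvent set.
\<close>

definition riesz_proj ::
  "'a::complex_hilbert set \<Rightarrow> ('a \<Rightarrow> 'a) \<Rightarrow> complex \<Rightarrow> real \<Rightarrow> 'a \<Rightarrow> 'a" where
  "riesz_proj D T c r u = (1 / (2 * of_real pi * \<i>)) *\<^sub>C
     integral {0..2 * pi} (\<lambda>t. (\<i> * of_real r * cis t) *\<^sub>C resolvent D T (c + of_real r * cis t) u)"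

definition alg_mult :: "'a::complex_hilbert set \<Rightarrow> ('a \<Rightarrow> 'a) \<Rightarrow> complex \<Rightarrow> nat" where
  "alg_mult X T z = complex_vector.dim {u\<in>X. \<exists>p. ((\<lambda>v. T v - z *\<^sub>C v) ^^ p) u = 0}"

text \<open>
  \<open>\<mu> 1, \<dots>, \<mu> \<kappa>\<close> are the eigenvalues in \<open>S\<close> of the operator \<open>T\<close> on the finite-dimensional
  space \<open>X\<close>, each listed according to its algebraic multiplicity (which is \<open>0\<close> for a number
  that is not an eigenvalue).
\<close>

definition repeated_eigenvalues ::
  "'a::complex_hilbert set \<Rightarrow> ('a \<Rightarrow> 'a) \<Rightarrow> complex set \<Rightarrow> nat \<Rightarrow> (nat \<Rightarrow> complex) \<Rightarrow> bool" where
  "repeated_eigenvalues X T S \<kappa> \<mu> \<longleftrightarrow>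
     (\<forall>z. card {j\<in>{1..\<kappa>}. \<mu> j = z} = (if z \<in> S then alg_mult X T z else 0))"

section \<open>Spectral measures and quadratic forms\<close>

definition projection_valued_measure :: "(real set \<Rightarrow> 'a::complex_hilbert \<Rightarrow> 'a) \<Rightarrow> bool" where
  "projection_valued_measure E \<longleftrightarrow> (\<forall>S\<in>sets borel. orth_proj (E S)) \<and> E UNIV = id \<and>
     (\<forall>S. range S \<subseteq> sets borel \<longrightarrow> disjoint_family S \<longrightarrow>
       (\<forall>u. (\<lambda>n. E (S n) u) sums E (\<Union>n. S n) u))"

definition scalar_measure ::
  "(real set \<Rightarrow> 'a::complex_hilbert \<Rightarrow> 'a) \<Rightarrow> 'a \<Rightarrow> real measure" where
  "scalar_measure E u = measure_of UNIV (sets borel) (\<lambda>S. ennreal (Re (cinner (E S u) u)))"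

text \<open>
  \<open>T = \<integral> x dE(x)\<close>.  By polarization it suffices to prescribe the values
  \<open>\<langle>T u, u\<rangle>\<close>.
\<close>

definition spectral_measure_of ::
  "(real set \<Rightarrow> 'a::complex_hilbert \<Rightarrow> 'a) \<Rightarrow> 'a set \<Rightarrow> ('a \<Rightarrow> 'a) \<Rightarrow> bool" where
  "spectral_measure_of E D T \<longleftrightarrow> projection_valued_measure E \<and>
     D = {u. integrable (scalar_measure E u) (\<lambda>x. x\<^sup>2)} \<and>
     (\<forall>u\<in>D. cinner (T u) u = of_real (\<integral>x. x \<partial>scalar_measure E u))"

text \<open>
  The form of the operator with spectral measure \<open>E\<close>: its domain is the domain of the square root
  of the absolute value of the operator, and its value at \<open>(u, v)\<close> is the integral of \<open>x\<close> with
  respect to the complex measure \<open>\<langle>E(\<cdot>)u, v\<rangle>\<close>, which is written in terms of the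
  positive measures \<open>\<langle>E(\<cdot>)w, w\<rangle>\<close> by polarization.
\<close>

definition form_dom :: "(real set \<Rightarrow> 'a::complex_hilbert \<Rightarrow> 'a) \<Rightarrow> 'a set" where
  "form_dom E = {u. integrable (scalar_measure E u) (\<lambda>x. \<bar>x\<bar>)}"

definition form :: "(real set \<Rightarrow> 'a::complex_hilbert \<Rightarrow> 'a) \<Rightarrow> 'a \<Rightarrow> 'a \<Rightarrow> complex" where
  "form E u v =
     (\<Sum>p<4. \<i> ^ p * of_real (\<integral>x. x \<partial>scalar_measure E (u + (\<i> ^ p) *\<^sub>C v))) / 4"

definition spectrum_min :: "'a::complex_hilbert set \<Rightarrow> ('a \<Rightarrow> 'a) \<Rightarrow> real" where
  "spectrum_min D T = (LEAST x. complex_of_real x \<in> spectrum D T)"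

definition form_inner ::
  "'a::complex_hilbert set \<Rightarrow> ('a \<Rightarrow> 'a) \<Rightarrow> (real set \<Rightarrow> 'a \<Rightarrow> 'a) \<Rightarrow> 'a \<Rightarrow> 'a \<Rightarrow> complex" where
  "form_inner D T E u v = form E u v - of_real (spectrum_min D T - 1) * cinner u v"

definition form_norm ::
  "'a::complex_hilbert set \<Rightarrow> ('a \<Rightarrow> 'a) \<Rightarrow> (real set \<Rightarrow> 'a \<Rightarrow> 'a) \<Rightarrow> 'a \<Rightarrow> real" where
  "form_norm D T E u = sqrt (Re (form_inner D T E u u))"

section \<open>Gaps between subspaces and the curve enclosing the perturbed spectrum\<close>

text \<open>The norm is a parameter, so that the gap can be measured in the form norm as well.\<close>

definition gap :: "('a::complex_hilbert \<Rightarrow> real) \<Rightarrow> 'a set \<Rightarrow> 'a set \<Rightarrow> real" where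
  "gap nrm M L = (SUP u\<in>{u\<in>M. nrm u = 1}. INF v\<in>L. nrm (u - v))"

definition Gamma01 :: "real \<Rightarrow> real \<Rightarrow> complex set" where
  "Gamma01 a b =
     (if b - a \<le> 1
      then {Complex x (1/2 + s * sqrt (1/4 + (x - a) * (x - b))) | x s. x \<in> {a..b} \<and> s \<in> {1, -1}}
      else {Complex ((a + b) / 2 + s * sqrt (((b - a) / 2)\<^sup>2 + y * (y - 1))) y | y s.
              y \<in> {0..1} \<and> s \<in> {1, -1}})"

end

theory Submission
  imports Defs
begin

text \<open>
  Let \<open>Q = E[a,b]\<close>, let \<open>u\<close> be a unit eigenvector of \<open>A\<^sub>k + \<i>P\<^sub>kP\<^sub>n\<close> for an eigenvalue
  \<open>z\<close> in the disc, and let \<open>q = Qu\<close>, \<open>f = u - q\<close>.  Then \<open>u\<close> is the Galerkin approximation of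
  \<open>g = -\<i>(A - z)\<^sup>-\<^sup>1P\<^sub>nu\<close> for the form \<open>\<aa> - z\<close>, which is coercive because \<open>Im z \<ge> 1/2\<close>.
  Splitting \<open>P\<^sub>nu = P\<^sub>nf + q - (q - P\<^sub>nq)\<close>, Cea's lemma bounds \<open>u - g\<close> in the form norm by a multiple
  of \<open>\<eta>\<parallel>f\<parallel> + \<epsilon>\<^sub>n + \<epsilon>\<^sub>k\<close>; here \<open>\<eta>\<close> is as small as desired for large \<open>k\<close>, since \<open>P\<^sub>n\<close> has
  finite rank.  The condition on \<open>\<Gamma>\<close> bounds the inverse of the compression of \<open>A + \<i>P\<^sub>n - z\<close> to
  \<open>ker Q\<close> uniformly in \<open>n\<close> and \<open>z\<close>.  As \<open>(A + \<i>P\<^sub>n - z)g = \<i>P\<^sub>n(g - u)\<close>, this gives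
  \<open>\<parallel>f\<parallel> = O(\<epsilon>\<^sub>n + \<epsilon>\<^sub>k)\<close> once the \<open>\<eta>\<close>-term is absorbed.  Finally, for \<open>w\<close> in the range of \<open>Q\<close> and
  every \<open>v\<close> in the Galerkin space,
  \<open>\<langle>(A + \<i> - z)q, w\<rangle> = (\<aa> - z)(u - g, w - v) + \<i>\<langle>(1 - P\<^sub>n)u, (1 - P\<^sub>n)w\<rangle>\<close>,
  where both terms are products of two small factors, and \<open>\<parallel>(A + \<i> - z)q\<parallel>\<close> is at least
  \<open>\<bar>\<lambda> + \<i> - z\<bar>\<parallel>q\<parallel>\<close>.
\<close>

section \<open>Complex Hilbert spaces and sesquilinear forms\<close>

text \<open>The Galerkin vector \<open>u\<close> lies only in the form domain, so \<open>A\<close>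
  cannot be applied to it; the auxiliary \<open>g\<close> lies in the domain of \<open>A\<close>,
  which is what makes operator estimates available. For \<open>z\<close> close to
  \<open>lam + \<i>\<close> no bound on an inverse of the perturbed operator can be uniform on the
  range of \<open>Q\<close>. Hence inversion is used for the component in the kernel of
  \<open>Q\<close> only, and the component \<open>q\<close> is handled by testing its residual. The
  delicate term is the projection of \<open>f\<close>: it carries no small factor besides
  \<open>norm f\<close> itself, and the constant in front of it need not be below 1. Finite rank
  supplies the missing factor \<open>\<eta>\<close>, at a rate in \<open>k\<close> that depends on
  \<open>n\<close>. The required size of \<open>\<eta>\<close>, and with it every constant, depends
  only on \<open>a\<close>, \<open>b\<close>, \<open>lam\<close>, \<open>r\<close> and
  \<open>m\<close>; so \<open>n\<close> influences how large \<open>k\<close> must be but not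
  \<open>c5\<close>. When the gaps are not small, the radius of the disc already gives a bound of
  the claimed form, so one constant serves all \<open>n\<close>.\<close>

lemma cinner_add_right: "cinner x (y + z) = cinner x y + cinner x (z::'h::complex_hilbert)"
  by (metis cinner_commute cinner_add_left complex_cnj_add)

lemma cinner_scaleC_right: "cinner x (c *\<^sub>C y) = cnj c * cinner x (y::'h::complex_hilbert)"
  by (metis cinner_commute cinner_scaleC_left complex_cnj_mult)

lemma cinner_zero_left [simp]: "cinner 0 (y::'h::complex_hilbert) = 0"
  using cinner_add_left[of 0 0 y] by simp

lemma cinner_zero_right [simp]: "cinner (y::'h::complex_hilbert) 0 = 0"
  using cinner_add_right[of y 0 0] by simp

lemma cinner_minus_left: "cinner (- x) (y::'h::complex_hilbert) = - cinner x y"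
  using cinner_add_left[of x "-x" y] by (simp add: eq_neg_iff_add_eq_0 add.commute)

lemma cinner_minus_right: "cinner x (- y) = - cinner x (y::'h::complex_hilbert)"
  using cinner_add_right[of x y "-y"] by (simp add: eq_neg_iff_add_eq_0 add.commute)

lemma cinner_diff_left: "cinner (x - y) z = cinner x z - cinner y (z::'h::complex_hilbert)"
  using cinner_add_left[of x "-y" z] by (simp add: cinner_minus_left)

lemma cinner_diff_right: "cinner x (y - z) = cinner x y - cinner x (z::'h::complex_hilbert)"
  using cinner_add_right[of x y "-z"] by (simp add: cinner_minus_right)

lemma cinner_sum_left: "cinner (\<Sum>i\<in>I. f i) z = (\<Sum>i\<in>I. cinner (f i) (z::'h::complex_hilbert))"
  by (induction I rule: infinite_finite_induct) (simp_all add: cinner_add_left)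

lemma power2_norm_eq_cinner: "(norm x)\<^sup>2 = Re (cinner x (x::'h::complex_hilbert))"
proof -
  have "0 \<le> Re (cinner x x)"
    using norm_ge_zero[of x] by (simp add: norm_eq_sqrt_cinner)
  then show ?thesis by (simp add: norm_eq_sqrt_cinner)
qed

lemma cinner_self: "cinner x (x::'h::complex_hilbert) = of_real ((norm x)\<^sup>2)"
proof -
  have "cinner x x = cnj (cinner x x)" by (rule cinner_commute)
  then have "Im (cinner x x) = 0" by (metis add.inverse_inverse cnj.sel(2) equal_neg_zero)
  then show ?thesis by (simp add: complex_eq_iff power2_norm_eq_cinner)
qed

lemma norm_scaleC: "norm (c *\<^sub>C x) = cmod c * norm (x::'h::complex_hilbert)"
proof -
  have "cinner (c *\<^sub>C x) (c *\<^sub>C x) = of_real ((cmod c)\<^sup>2) * cinner x x"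
    by (simp add: cinner_scaleC_left cinner_scaleC_right complex_norm_square del: of_real_power)
  then have "(norm (c *\<^sub>C x))\<^sup>2 = (cmod c * norm x)\<^sup>2"
    by (simp add: power2_norm_eq_cinner power_mult_distrib)
  then show ?thesis by (simp add: power2_eq_iff_nonneg)
qed

lemma bounded_linear_scaleC: "bounded_linear (\<lambda>x. c *\<^sub>C (x::'h::complex_hilbert))"
proof (rule bounded_linear_intro[where K = "cmod c"])
  show "c *\<^sub>C t *\<^sub>R x = t *\<^sub>R c *\<^sub>C x" for t and x :: 'h
    by (simp add: scaleR_scaleC complex_vector.scale_left_commute)
qed (simp_all add: complex_vector.scale_right_distrib norm_scaleC mult.commute)

lemma scaleC_minus_one: "(-1) *\<^sub>C x = - (x::'h::complex_hilbert)"
  by (metis complex_vector.scale_minus_left complex_vector.scale_one)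

lemma norm_add_sq: "(norm (x + y))\<^sup>2 = (norm x)\<^sup>2 + (norm y)\<^sup>2 + 2 * Re (cinner x (y::'h::complex_hilbert))"
proof -
  have "Re (cinner y x) = Re (cinner x y)"
    by (subst cinner_commute) simp
  then show ?thesis
    by (simp add: power2_norm_eq_cinner cinner_add_left cinner_add_right)
qed

lemma norm_diff_sq: "(norm (x - y))\<^sup>2 = (norm x)\<^sup>2 + (norm y)\<^sup>2 - 2 * Re (cinner x (y::'h::complex_hilbert))"
  using norm_add_sq[of x "-y"] by (simp add: cinner_minus_right)

lemma norm_add_orthogonal:
  "cinner x y = 0 \<Longrightarrow> (norm (x + y))\<^sup>2 = (norm x)\<^sup>2 + (norm (y::'h::complex_hilbert))\<^sup>2"
  by (simp add: norm_add_sq)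

text \<open>One proof of the Cauchy-Schwarz and triangle inequalities serves both the inner product
  and the form inner product. The carrier \<open>V\<close> is explicit because the latter is handled
  as a sesquilinear form on the form domain only.\<close>

locale psd_form =
  fixes V :: "'h::complex_hilbert set" and B :: "'h \<Rightarrow> 'h \<Rightarrow> complex"
  assumes subspace: "complex_vector.subspace V"
    and add_left: "u \<in> V \<Longrightarrow> v \<in> V \<Longrightarrow> w \<in> V \<Longrightarrow> B (u + v) w = B u w + B v w"
    and scale_left: "u \<in> V \<Longrightarrow> w \<in> V \<Longrightarrow> B (c *\<^sub>C u) w = c * B u w"
    and sym: "u \<in> V \<Longrightarrow> v \<in> V \<Longrightarrow> B u v = cnj (B v u)"
    and nonneg: "u \<in> V \<Longrightarrow> 0 \<le> Re (B u u)"
begin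

definition nrm :: "'h \<Rightarrow> real" where "nrm u = sqrt (Re (B u u))"

lemma V_scale: "u \<in> V \<Longrightarrow> c *\<^sub>C u \<in> V"
  using subspace complex_vector.subspace_scale by blast

lemma V_add: "u \<in> V \<Longrightarrow> v \<in> V \<Longrightarrow> u + v \<in> V"
  using subspace complex_vector.subspace_add by blast

lemma V_zero: "0 \<in> V"
  using subspace complex_vector.subspace_0 by blast

lemma V_minus: "u \<in> V \<Longrightarrow> - u \<in> V"
  using V_scale[of u "-1"] by (simp add: scaleC_minus_one)

lemma V_diff: "u \<in> V \<Longrightarrow> v \<in> V \<Longrightarrow> u - v \<in> V"
  using V_add[of u "-v"] V_minus[of v] by simp

lemma minus_left: "u \<in> V \<Longrightarrow> w \<in> V \<Longrightarrow> B (- u) w = - B u w"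
  using scale_left[of u w "-1"] by (simp add: scaleC_minus_one)

lemma diff_left: "u \<in> V \<Longrightarrow> v \<in> V \<Longrightarrow> w \<in> V \<Longrightarrow> B (u - v) w = B u w - B v w"
  using add_left[of u "-v" w] by (simp add: minus_left V_minus)

lemma add_right: "u \<in> V \<Longrightarrow> v \<in> V \<Longrightarrow> w \<in> V \<Longrightarrow> B u (v + w) = B u v + B u w"
  using sym[of u "v + w"] sym[of u v] sym[of u w] by (simp add: add_left V_add)

lemma scale_right: "u \<in> V \<Longrightarrow> w \<in> V \<Longrightarrow> B u (c *\<^sub>C w) = cnj c * B u w"
  using sym[of u "c *\<^sub>C w"] sym[of u w] by (simp add: scale_left V_scale)

lemma diff_right: "u \<in> V \<Longrightarrow> v \<in> V \<Longrightarrow> w \<in> V \<Longrightarrow> B u (v - w) = B u v - B u w"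
  using sym[of u "v - w"] sym[of u v] sym[of u w] by (simp add: diff_left V_diff)

lemma nrm_nonneg: "u \<in> V \<Longrightarrow> 0 \<le> nrm u"
  by (simp add: nrm_def nonneg)

lemma nrm_sq: "u \<in> V \<Longrightarrow> (nrm u)\<^sup>2 = Re (B u u)"
  by (simp add: nrm_def nonneg)

lemma nrm_scale: "u \<in> V \<Longrightarrow> nrm (c *\<^sub>C u) = cmod c * nrm u"
proof -
  assume u: "u \<in> V"
  have "B (c *\<^sub>C u) (c *\<^sub>C u) = of_real ((cmod c)\<^sup>2) * B u u"
    using u by (simp add: scale_left scale_right V_scale complex_norm_square del: of_real_power)
  then have "Re (B (c *\<^sub>C u) (c *\<^sub>C u)) = (cmod c)\<^sup>2 * Re (B u u)" by simp
  then show ?thesis by (simp add: nrm_def real_sqrt_mult)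
qed

lemma cauchy_schwarz:
  assumes "u \<in> V" "v \<in> V"
  shows "cmod (B u v) \<le> nrm u * nrm v"
proof -
  define \<beta> where "\<beta> = B u v"
  define p where "p = Re (B u u)"
  define s where "s = Re (B v v)"
  \<comment> \<open>Putting \<open>\<beta>\<close> into the coefficient of \<open>v\<close> makes
    both cross terms real, so a real parameter suffices. Later \<open>t\<close> is the minimiser
    \<open>1 / s\<close>, or, if \<open>s = 0\<close>, so large that the right-hand side becomes
    -1.\<close>
  have key: "0 \<le> p - 2 * t * (cmod \<beta>)\<^sup>2 + t\<^sup>2 * (cmod \<beta>)\<^sup>2 * s" for t :: real
  proof -
    define c where "c = of_real t * \<beta>"
    have cv: "c *\<^sub>C v \<in> V" using assms V_scale by blast
    have vu: "B v u = cnj \<beta>" using sym assms \<beta>_def by blast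
    have "B (u - c *\<^sub>C v) (u - c *\<^sub>C v)
        = B u u - cnj c * \<beta> - (c * cnj \<beta> - c * cnj c * B v v)"
      using assms cv V_diff
      by (simp add: diff_left diff_right scale_left scale_right vu \<beta>_def[symmetric] algebra_simps)
    moreover have "Re (cnj c * \<beta>) = t * (cmod \<beta>)\<^sup>2" "Re (c * cnj \<beta>) = t * (cmod \<beta>)\<^sup>2"
      unfolding c_def cmod_power2 by (simp_all add: power2_eq_square algebra_simps)
    moreover have "c * cnj c = of_real (t\<^sup>2 * (cmod \<beta>)\<^sup>2)"
      unfolding complex_norm_square[symmetric] c_def by (simp add: norm_mult power_mult_distrib)
    ultimately have "Re (B (u - c *\<^sub>C v) (u - c *\<^sub>C v))
        = p - 2 * t * (cmod \<beta>)\<^sup>2 + t\<^sup>2 * (cmod \<beta>)\<^sup>2 * s"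
      by (simp add: p_def s_def)
    then show ?thesis using nonneg[of "u - c *\<^sub>C v"] assms cv V_diff by simp
  qed
  have s0: "0 \<le> s" "0 \<le> p" using nonneg assms by (auto simp: s_def p_def)
  have "(cmod \<beta>)\<^sup>2 \<le> p * s"
  proof (cases "s = 0")
    case True
    have "\<beta> = 0"
    proof (rule ccontr)
      assume "\<beta> \<noteq> 0"
      then have "0 \<le> p - (p + 1)"
        using key[of "(p + 1) / (2 * (cmod \<beta>)\<^sup>2)"] True by simp
      then show False by simp
    qed
    then show ?thesis using s0 by simp
  next
    case False
    have "2 * (1 / s) * (cmod \<beta>)\<^sup>2 - (1 / s)\<^sup>2 * (cmod \<beta>)\<^sup>2 * s = (cmod \<beta>)\<^sup>2 / s"
      using False by (simp add: power2_eq_square)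
    then have "(cmod \<beta>)\<^sup>2 / s \<le> p" using key[of "1 / s"] by linarith
    then show ?thesis using False s0 by (simp add: divide_le_eq)
  qed
  then have "cmod \<beta> \<le> sqrt (p * s)" by (rule real_le_rsqrt)
  then show ?thesis by (simp add: nrm_def p_def s_def \<beta>_def real_sqrt_mult)
qed

lemma triangle: "u \<in> V \<Longrightarrow> v \<in> V \<Longrightarrow> nrm (u + v) \<le> nrm u + nrm v"
proof -
  assume uv: "u \<in> V" "v \<in> V"
  have "Re (B v u) = Re (B u v)" using sym[of u v] uv by simp
  then have "(nrm (u + v))\<^sup>2 = (nrm u)\<^sup>2 + (nrm v)\<^sup>2 + 2 * Re (B u v)"
    using uv V_add by (simp add: nrm_sq add_left add_right)
  also have "\<dots> \<le> (nrm u)\<^sup>2 + (nrm v)\<^sup>2 + 2 * (nrm u * nrm v)"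
    using cauchy_schwarz[OF uv] complex_Re_le_cmod[of "B u v"] by linarith
  also have "\<dots> = (nrm u + nrm v)\<^sup>2" by (simp add: power2_sum)
  finally show ?thesis
    by (rule power2_le_imp_le) (simp add: nrm_nonneg uv)
qed

lemma triangle_sum:
  assumes "finite I" "\<And>i. i \<in> I \<Longrightarrow> f i \<in> V"
  shows "(\<Sum>i\<in>I. f i) \<in> V \<and> nrm (\<Sum>i\<in>I. f i) \<le> (\<Sum>i\<in>I. nrm (f i))"
  using assms
proof (induction I rule: finite_induct)
  case empty
  have "nrm 0 = 0" using nrm_scale[OF V_zero, of 0] by simp
  then show ?case by (simp add: V_zero)
next
  case (insert i I)
  have fi: "f i \<in> V" using insert.prems by simp
  have IH: "(\<Sum>i\<in>I. f i) \<in> V" "nrm (\<Sum>i\<in>I. f i) \<le> (\<Sum>i\<in>I. nrm (f i))"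
    using insert.IH insert.prems by simp_all
  have "nrm (f i + (\<Sum>i\<in>I. f i)) \<le> nrm (f i) + (\<Sum>i\<in>I. nrm (f i))"
    using triangle[OF fi IH(1)] IH(2) by linarith
  then show ?case using insert.hyps V_add[OF fi IH(1)] by simp
qed

end

interpretation cinner_form: psd_form UNIV "cinner :: 'h::complex_hilbert \<Rightarrow> _"
proof
  show "cinner u v = cnj (cinner v u)" for u v :: 'h by (rule cinner_commute)
  show "0 \<le> Re (cinner u u)" for u :: 'h by (simp flip: power2_norm_eq_cinner)
qed (simp_all add: cinner_add_left cinner_scaleC_left)

lemma cinner_cauchy_schwarz: "cmod (cinner x y) \<le> norm x * norm (y::'h::complex_hilbert)"
  using cinner_form.cauchy_schwarz[of x y] by (simp add: cinner_form.nrm_def norm_eq_sqrt_cinner)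

lemma bounded_linear_cinner_left: "bounded_linear (\<lambda>x. cinner x (y::'h::complex_hilbert))"
proof (rule bounded_linear_intro[where K = "norm y"])
  show "cinner (t *\<^sub>R x) y = t *\<^sub>R cinner x y" for t x
    by (simp add: scaleR_scaleC cinner_scaleC_left scaleR_conv_of_real)
qed (auto simp: cinner_add_left intro: cinner_cauchy_schwarz)

lemmas tendsto_cinner_left = bounded_linear.tendsto[OF bounded_linear_cinner_left]

lemma tendsto_cinner_right:
  "(f \<longlongrightarrow> l) F \<Longrightarrow> ((\<lambda>i. cinner x (f i)) \<longlongrightarrow> cinner x (l::'h::complex_hilbert)) F"
  using tendsto_cnj[OF tendsto_cinner_left[of f l F x]] by (simp add: cinner_commute[of x])

lemma cinner_eq_zeroI: "(\<And>y. cinner x y = 0) \<Longrightarrow> x = (0::'h::complex_hilbert)"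
  by (metis cinner_self norm_eq_zero of_real_eq_0_iff power_eq_0_iff)

lemma cinner_dense_zero:
  assumes "closure D = UNIV" "\<And>u. u \<in> D \<Longrightarrow> cinner x u = 0"
  shows "x = (0::'h::complex_hilbert)"
proof (rule cinner_eq_zeroI)
  fix y
  obtain f where f: "\<And>n. f n \<in> D" "f \<longlonglongrightarrow> y"
    using assms(1) closure_sequential[of y D] by auto
  have "(\<lambda>n. cinner x (f n)) \<longlonglongrightarrow> cinner x y" using f tendsto_cinner_right by blast
  then show "cinner x y = 0" using f assms(2) by (simp add: LIMSEQ_const_iff)
qed

section \<open>Orthogonal complements\<close>

lemma parallelogram:
  "(norm (x + y))\<^sup>2 + (norm (x - y))\<^sup>2 = 2 * (norm x)\<^sup>2 + 2 * (norm (y::'h::complex_hilbert))\<^sup>2"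
  by (simp add: norm_add_sq norm_diff_sq)

text \<open>A minimising sequence is Cauchy: the midpoint of two members stays in \<open>V\<close>,
  so its distance from \<open>x\<close> is at least \<open>d\<close>, and the parallelogram law
  turns this into a bound for their difference.\<close>

lemma closed_subspace_nearest:
  fixes V :: "'h::complex_hilbert set"
  assumes V: "complex_vector.subspace V" and "closed V"
  shows "\<exists>v\<in>V. \<forall>w\<in>V. norm (x - v) \<le> norm (x - w)"
proof -
  define d where "d = infdist x V"
  have V0: "0 \<in> V" using V complex_vector.subspace_0 by blast
  then have ne: "V \<noteq> {}" by auto
  have dle: "d \<le> norm (x - w)" if "w \<in> V" for w
    using infdist_le[OF that, of x] by (simp add: d_def dist_norm)
  have d0: "0 \<le> d" by (simp add: d_def infdist_nonneg)
  have "\<exists>v\<in>V. norm (x - v) < d + inverse (real (Suc n))" for n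
  proof -
    have "(INF a\<in>V. dist x a) < d + inverse (real (Suc n))"
      using ne by (simp add: d_def infdist_notempty)
    then show ?thesis
      using ne by (subst (asm) cINF_less_iff) (auto simp: dist_norm intro!: bdd_belowI2[where m=0])
  qed
  then obtain v where v: "\<And>n. v n \<in> V" "\<And>n. norm (x - v n) < d + inverse (real (Suc n))"
    by metis
  have lim: "(\<lambda>n. norm (x - v n)) \<longlonglongrightarrow> d"
  proof (rule tendsto_sandwich)
    show "(\<lambda>n. d) \<longlonglongrightarrow> d" by simp
    show "(\<lambda>n. d + inverse (real (Suc n))) \<longlonglongrightarrow> d"
      using tendsto_add[OF tendsto_const LIMSEQ_inverse_real_of_nat, of d] by simp
    show "\<forall>\<^sub>F n in sequentially. d \<le> norm (x - v n)"
      by (intro always_eventually allI dle v(1))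
    show "\<forall>\<^sub>F n in sequentially. norm (x - v n) \<le> d + inverse (real (Suc n))"
      by (intro always_eventually allI less_imp_le v(2))
  qed
  have cau: "(norm (v m - v n))\<^sup>2 \<le> 2 * (norm (x - v m))\<^sup>2 + 2 * (norm (x - v n))\<^sup>2 - 4 * d\<^sup>2" for m n
  proof -
    define w where "w = (1/2) *\<^sub>C (v m + v n)"
    have "w \<in> V" unfolding w_def
      using V v complex_vector.subspace_scale complex_vector.subspace_add by blast
    then have "d\<^sup>2 \<le> (norm (x - w))\<^sup>2" using dle d0 by (simp add: power_mono)
    moreover have "(x - v m) + (x - v n) = 2 *\<^sub>C (x - w)"
    proof -
      have "2 *\<^sub>C w = v m + v n" by (simp add: w_def)
      moreover have "2 *\<^sub>C x = x + x" using complex_vector.scale_left_distrib[of 1 1 x] by simp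
      ultimately show ?thesis by (simp add: complex_vector.scale_right_diff_distrib)
    qed
    then have "(norm ((x - v m) + (x - v n)))\<^sup>2 = 4 * (norm (x - w))\<^sup>2"
      by (simp add: norm_scaleC power_mult_distrib)
    moreover have "norm ((x - v m) - (x - v n)) = norm (v m - v n)"
      by (simp add: norm_minus_commute)
    ultimately show ?thesis using parallelogram[of "x - v m" "x - v n"] by simp
  qed
  have "Cauchy v"
  proof (rule metric_CauchyI)
    fix e :: real assume "0 < e"
    have "(\<lambda>n. 2 * (norm (x - v n))\<^sup>2) \<longlonglongrightarrow> 2 * d\<^sup>2"
      by (intro tendsto_intros lim)
    then have "\<forall>\<^sub>F n in sequentially. 2 * (norm (x - v n))\<^sup>2 < 2 * d\<^sup>2 + e\<^sup>2 / 2"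
      by (rule order_tendstoD) (use \<open>0 < e\<close> in simp)
    then obtain M where M: "\<And>n. n \<ge> M \<Longrightarrow> 2 * (norm (x - v n))\<^sup>2 < 2 * d\<^sup>2 + e\<^sup>2 / 2"
      by (auto simp: eventually_sequentially)
    have "dist (v m) (v n) < e" if "m \<ge> M" "n \<ge> M" for m n
    proof -
      have "(norm (v m - v n))\<^sup>2 < e\<^sup>2" using M[OF that(1)] M[OF that(2)] cau[of m n] by simp
      then show ?thesis using \<open>0 < e\<close> by (simp add: dist_norm power2_less_imp_less)
    qed
    then show "\<exists>M. \<forall>m\<ge>M. \<forall>n\<ge>M. dist (v m) (v n) < e" by blast
  qed
  then obtain y where y: "v \<longlonglongrightarrow> y" using Cauchy_convergent convergent_def by blast
  have "y \<in> V" using \<open>closed V\<close> v y closed_sequentially by blast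
  moreover have "(\<lambda>n. norm (x - v n)) \<longlonglongrightarrow> norm (x - y)" by (intro tendsto_intros y)
  then have "norm (x - y) = d" using lim LIMSEQ_unique by blast
  ultimately show ?thesis using dle by auto
qed

text \<open>Otherwise moving \<open>v\<close> by the component of \<open>x - v\<close> along
  \<open>w\<close> would lower the squared distance by
  \<open>(cmod \<beta>)\<^sup>2 / (norm w)\<^sup>2\<close>.\<close>

lemma nearest_orthogonal:
  fixes V :: "'h::complex_hilbert set"
  assumes V: "complex_vector.subspace V" and "v \<in> V" "w \<in> V"
    and le: "\<And>w. w \<in> V \<Longrightarrow> norm (x - v) \<le> norm (x - w)"
  shows "cinner (x - v) w = 0"
proof (cases "w = 0")
  case False
  define \<beta> where "\<beta> = cinner (x - v) w"
  define c where "c = \<beta> / of_real ((norm w)\<^sup>2)"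
  have "v + c *\<^sub>C w \<in> V"
    using assms complex_vector.subspace_scale complex_vector.subspace_add by blast
  then have "(norm (x - v))\<^sup>2 \<le> (norm ((x - v) - c *\<^sub>C w))\<^sup>2"
    using le[of "v + c *\<^sub>C w"] by (simp add: diff_diff_eq power_mono)
  also have "\<dots> = (norm (x - v))\<^sup>2 + (norm (c *\<^sub>C w))\<^sup>2 - 2 * Re (cnj c * \<beta>)"
    by (simp add: norm_diff_sq cinner_scaleC_right \<beta>_def)
  also have "(norm (c *\<^sub>C w))\<^sup>2 = (cmod \<beta>)\<^sup>2 / (norm w)\<^sup>2"
    using False by (simp add: norm_scaleC c_def norm_divide norm_mult norm_power power2_eq_square)
  also have "cnj c * \<beta> = of_real ((cmod \<beta>)\<^sup>2 / (norm w)\<^sup>2)"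
    by (simp add: c_def complex_norm_square mult.commute del: of_real_power)
  finally have "(cmod \<beta>)\<^sup>2 / (norm w)\<^sup>2 \<le> 0" by simp
  then have "cmod \<beta> = 0" using False by (simp add: divide_le_0_iff)
  then show ?thesis by (simp add: \<beta>_def)
qed simp

lemma closed_subspace_eq_UNIV:
  fixes V :: "'h::complex_hilbert set"
  assumes V: "complex_vector.subspace V" and "closed V"
    and perp: "\<And>v. (\<And>w. w \<in> V \<Longrightarrow> cinner w v = 0) \<Longrightarrow> v = 0"
  shows "V = UNIV"
proof -
  have "x \<in> V" for x
  proof -
    obtain v where v: "v \<in> V" "\<forall>w\<in>V. norm (x - v) \<le> norm (x - w)"
      using closed_subspace_nearest[OF assms(1,2)] by blast
    have "cinner w (x - v) = 0" if "w \<in> V" for w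
      using nearest_orthogonal[OF V v(1) that, of x] v(2) cinner_commute[of w "x - v"] by simp
    then have "x - v = 0" by (rule perp)
    then show ?thesis using v by simp
  qed
  then show ?thesis by auto
qed

section \<open>Self-adjoint operators\<close>

text \<open>The bound at \<open>z\<close> gives injectivity and, as a self-adjoint operator is
  closed, a closed range. A vector orthogonal to the range satisfies the eigenvalue equation for
  \<open>cnj z\<close>, so the bound there makes it vanish and the range is everything.\<close>

lemma resolvent_set_self_adjointI:
  fixes D :: "'h::complex_hilbert set"
  assumes sa: "self_adjoint_op D T" and "0 < c"
    and bnd: "\<And>u. u \<in> D \<Longrightarrow> c * norm u \<le> norm (z *\<^sub>C u - T u)"
    and bnd': "\<And>u. u \<in> D \<Longrightarrow> c * norm u \<le> norm (cnj z *\<^sub>C u - T u)"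
  shows "z \<in> resolvent_set D T"
proof -
  define R where "R = (\<lambda>u. z *\<^sub>C u - T u)"
  have lin: "complex_vector.subspace D"
    "\<And>u v. u \<in> D \<Longrightarrow> v \<in> D \<Longrightarrow> T (u + v) = T u + T v"
    "\<And>c u. u \<in> D \<Longrightarrow> T (c *\<^sub>C u) = c *\<^sub>C T u"
    using sa by (auto simp: self_adjoint_op_def linear_op_def)
  have adj: "\<forall>v w. v \<in> D \<and> T v = w \<longleftrightarrow> (\<forall>u\<in>D. cinner (T u) v = cinner u w)"
    using sa unfolding self_adjoint_op_def by (elim conjE)
  have adjD: "cinner (T u) v = cinner u (T v)" if "u \<in> D" "v \<in> D" for u v
    using adj[rule_format, of v "T v"] that by simp
  have adjI: "v \<in> D" "T v = w" if "\<And>u. u \<in> D \<Longrightarrow> cinner (T u) v = cinner u w" for v w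
    using adj[rule_format, of v w] that by blast+
  have Radd: "R (u + v) = R u + R v" if "u \<in> D" "v \<in> D" for u v
    using that lin by (simp add: R_def complex_vector.scale_right_distrib)
  have Rsc: "R (s *\<^sub>C u) = s *\<^sub>C R u" if "u \<in> D" for s u
    using that lin
    by (simp add: R_def complex_vector.scale_right_diff_distrib complex_vector.scale_left_commute)
  have Dd: "u - v \<in> D" if "u \<in> D" "v \<in> D" for u v
    using that lin(1) complex_vector.subspace_diff by blast
  have Rd: "R (u - v) = R u - R v" if "u \<in> D" "v \<in> D" for u v
    using Radd[of "u - v" v] that Dd by simp
  have Rb: "c * norm u \<le> norm (R u)" if "u \<in> D" for u using bnd[OF that] by (simp add: R_def)
  have inj: "inj_on R D"
  proof (rule inj_onI)
    fix u v assume uv: "u \<in> D" "v \<in> D" "R u = R v"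
    then have "c * norm (u - v) \<le> 0" using Rb[of "u - v"] Rd Dd by simp
    then show "u = v" using \<open>0 < c\<close> by (simp add: mult_le_0_iff)
  qed
  have sub: "complex_vector.subspace (R ` D)"
  proof (rule complex_vector.subspaceI)
    show "0 \<in> R ` D"
    proof
      show "0 \<in> D" using lin(1) by (rule complex_vector.subspace_0)
      then show "0 = R 0" using Rsc[of 0 0] by simp
    qed
  next
    fix x y assume "x \<in> R ` D" "y \<in> R ` D"
    then obtain u v where "u \<in> D" "v \<in> D" "x = R u" "y = R v" by blast
    then show "x + y \<in> R ` D"
      using Radd[of u v] complex_vector.subspace_add[OF lin(1), of u v] by (metis imageI)
  next
    fix s x assume "x \<in> R ` D"
    then obtain u where "u \<in> D" "x = R u" by blast
    then show "s *\<^sub>C x \<in> R ` D"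
      using Rsc[of u s] complex_vector.subspace_scale[OF lin(1), of u s] by (metis imageI)
  qed
  have "closed (R ` D)"
    unfolding closed_sequential_limits
  proof (intro allI impI, elim conjE)
    fix x l assume x: "\<forall>n. x n \<in> R ` D" and l: "x \<longlonglongrightarrow> l"
    have "\<forall>n. \<exists>w. w \<in> D \<and> x n = R w" using x by blast
    then obtain u where u: "\<And>n. u n \<in> D" "\<And>n. x n = R (u n)" by metis
    have "Cauchy u"
    proof (rule metric_CauchyI)
      fix e :: real assume "0 < e"
      have "Cauchy x" using l LIMSEQ_imp_Cauchy by blast
      then obtain M where M: "\<And>m n. m \<ge> M \<Longrightarrow> n \<ge> M \<Longrightarrow> dist (x m) (x n) < c * e"
        using metric_CauchyD[of x "c * e"] \<open>0 < c\<close> \<open>0 < e\<close> by auto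
      have "dist (u m) (u n) < e" if "m \<ge> M" "n \<ge> M" for m n
      proof -
        have "c * norm (u m - u n) \<le> norm (R (u m) - R (u n))"
          using Rb[of "u m - u n"] Rd u Dd by simp
        also have "\<dots> < c * e" using M[OF that] by (simp add: u dist_norm)
        finally show ?thesis using \<open>0 < c\<close> by (simp add: dist_norm)
      qed
      then show "\<exists>M. \<forall>m\<ge>M. \<forall>n\<ge>M. dist (u m) (u n) < e" by blast
    qed
    then obtain y where y: "u \<longlonglongrightarrow> y" using Cauchy_convergent convergent_def by blast
    have Tu: "T (u n) = z *\<^sub>C u n - x n" for n using u by (simp add: R_def)
    \<comment> \<open>Closedness of \<open>T\<close>: the description of the adjoint puts the limit
      \<open>y\<close> into \<open>D\<close> and yields its image.\<close>
    have "cinner (T d) y = cinner d (z *\<^sub>C y - l)" if d: "d \<in> D" for d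
    proof (rule LIMSEQ_unique)
      show "(\<lambda>n. cinner (T d) (u n)) \<longlonglongrightarrow> cinner (T d) y" using y tendsto_cinner_right by blast
      have "cinner (T d) (u n) = cinner d (z *\<^sub>C u n - x n)" for n
        using adjD[OF d u(1), of n] Tu by simp
      moreover have "(\<lambda>n. z *\<^sub>C u n) \<longlonglongrightarrow> z *\<^sub>C y"
        by (rule bounded_linear.tendsto[OF bounded_linear_scaleC y])
      ultimately show "(\<lambda>n. cinner (T d) (u n)) \<longlonglongrightarrow> cinner d (z *\<^sub>C y - l)"
        using tendsto_cinner_right[OF tendsto_diff[OF _ l], of "\<lambda>n. z *\<^sub>C u n" "z *\<^sub>C y" d] by simp
    qed
    then have "y \<in> D" "T y = z *\<^sub>C y - l" using adjI[of y] by blast+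
    then show "l \<in> R ` D" by (intro image_eqI[of _ _ y]) (simp_all add: R_def)
  qed
  moreover have "v = 0" if v: "\<And>w. w \<in> R ` D \<Longrightarrow> cinner w v = 0" for v
  proof -
    have "cinner (T u) v = cinner u (cnj z *\<^sub>C v)" if "u \<in> D" for u
      using v[of "R u"] that by (simp add: R_def cinner_diff_left cinner_scaleC_left cinner_scaleC_right)
    then have "v \<in> D" "T v = cnj z *\<^sub>C v" using adjI[of v] by blast+
    then have "c * norm v \<le> 0" using bnd'[of v] by simp
    then show ?thesis using \<open>0 < c\<close> by (simp add: mult_le_0_iff)
  qed
  ultimately have "R ` D = UNIV" by (rule closed_subspace_eq_UNIV[OF sub])
  moreover have "norm u \<le> (1 / c) * norm (z *\<^sub>C u - T u)" if "u \<in> D" for u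
    using bnd[OF that] \<open>0 < c\<close> by (simp add: field_simps)
  ultimately show ?thesis
    using inj unfolding resolvent_set_def R_def bij_betw_def mem_Collect_eq by (intro conjI exI ballI)
qed

section \<open>Orthogonal projections\<close>

lemma
  assumes "orth_proj P"
  shows orth_proj_add: "P (u + v) = P u + P v"
    and orth_proj_scale: "P (c *\<^sub>C u) = c *\<^sub>C P u"
    and orth_proj_idem: "P (P u) = P u"
    and orth_proj_sym: "cinner (P u) v = cinner u (P v)"
  using assms by (auto simp: orth_proj_def linear_op_def)

lemma orth_proj_zero: "orth_proj P \<Longrightarrow> P 0 = 0"
  using orth_proj_scale[of P 0 0] by simp

lemma orth_proj_minus: "orth_proj P \<Longrightarrow> P (- u) = - P u"
  using orth_proj_scale[of P "-1" u] by (simp add: scaleC_minus_one)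

lemma orth_proj_diff: "orth_proj P \<Longrightarrow> P (u - v) = P u - P v"
  using orth_proj_add[of P u "-v"] by (simp add: orth_proj_minus)

lemma orth_proj_range_iff: "orth_proj P \<Longrightarrow> u \<in> range P \<longleftrightarrow> P u = u"
  by (metis orth_proj_idem rangeE rangeI)

lemma orth_proj_subspace: "orth_proj P \<Longrightarrow> complex_vector.subspace (range P)"
  by (rule complex_vector.subspaceI)
    (simp_all add: orth_proj_range_iff orth_proj_zero orth_proj_add orth_proj_scale)

lemma orth_proj_cinner_self: "orth_proj P \<Longrightarrow> cinner (P u) u = of_real ((norm (P u))\<^sup>2)"
  by (metis cinner_self orth_proj_idem orth_proj_sym)

text \<open>Since \<open>1 - P\<close> is again an orthogonal projection, one defect can be traded
  for a product of two; this yields a second small factor in the eigenvalue estimate.\<close>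

lemma orth_proj_cinner_compl: "orth_proj P \<Longrightarrow> cinner (u - P u) (v - P v) = cinner (u - P u) v"
  by (simp add: cinner_diff_left cinner_diff_right orth_proj_sym orth_proj_idem)

lemma orth_proj_orthogonal: "orth_proj P \<Longrightarrow> cinner (P u) (v - P v) = 0"
  by (simp add: cinner_diff_right orth_proj_sym orth_proj_idem)

lemma orth_proj_pythagoras: "orth_proj P \<Longrightarrow> (norm u)\<^sup>2 = (norm (P u))\<^sup>2 + (norm (u - P u))\<^sup>2"
  using norm_add_orthogonal[OF orth_proj_orthogonal[of P u u]] by simp

lemma orth_proj_norm_le: "orth_proj P \<Longrightarrow> norm (P u) \<le> norm u"
  by (rule power2_le_imp_le) (simp_all add: orth_proj_pythagoras[of P u])

lemma orth_proj_compl_norm_le: "orth_proj P \<Longrightarrow> norm (u - P u) \<le> norm u"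
  by (rule power2_le_imp_le) (simp_all add: orth_proj_pythagoras[of P u])

lemma orth_proj_nearest:
  assumes P: "orth_proj P" and "v \<in> range P"
  shows "norm (u - P u) \<le> norm (u - v)"
proof (rule power2_le_imp_le)
  have "P (u - v) = P u - v" using assms by (simp add: orth_proj_diff orth_proj_range_iff)
  then have eq: "u - v - P (u - v) = u - P u" by simp
  show "(norm (u - P u))\<^sup>2 \<le> (norm (u - v))\<^sup>2"
    using orth_proj_pythagoras[OF P, of "u - v"] unfolding eq by simp
qed simp

section \<open>Projection-valued measures\<close>

locale pvm =
  fixes E :: "real set \<Rightarrow> 'h::complex_hilbert \<Rightarrow> 'h"
  assumes pvm: "projection_valued_measure E"
begin

lemma E_proj: "S \<in> sets borel \<Longrightarrow> orth_proj (E S)"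
  using pvm by (simp add: projection_valued_measure_def)

lemmas E_add = orth_proj_add[OF E_proj]
lemmas E_scale = orth_proj_scale[OF E_proj]
lemmas E_idem = orth_proj_idem[OF E_proj]
lemmas E_sym = orth_proj_sym[OF E_proj]
lemmas E_zero = orth_proj_zero[OF E_proj]
lemmas E_diff = orth_proj_diff[OF E_proj]

lemma E_UNIV: "E UNIV u = u"
  using pvm by (simp add: projection_valued_measure_def)

lemma E_sums:
  "(\<And>n. S n \<in> sets borel) \<Longrightarrow> disjoint_family S \<Longrightarrow> (\<lambda>n. E (S n) u) sums E (\<Union>n. S n) u"
  using pvm by (auto simp: projection_valued_measure_def)

lemma E_empty: "E {} u = 0"
proof -
  have "(\<lambda>n::nat. E {} u) sums E (\<Union>n::nat. {}) u"
    by (rule E_sums) (auto simp: disjoint_family_on_def)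
  then have "(\<lambda>n::nat. E {} u) \<longlonglongrightarrow> 0"
    using sums_summable summable_LIMSEQ_zero by blast
  then show ?thesis by (simp add: LIMSEQ_const_iff)
qed

lemma E_Un:
  assumes "S \<in> sets borel" "T \<in> sets borel" "S \<inter> T = {}"
  shows "E (S \<union> T) u = E S u + E T u"
proof -
  have "(\<lambda>n. E (binaryset S T n) u) sums E (\<Union>n. binaryset S T n) u"
    using assms by (intro E_sums) (auto simp: binaryset_def disjoint_family_on_def)
  moreover have "(\<lambda>n. E (binaryset S T n) u) sums (E S u + E T u)"
    by (rule binaryset_sums[where f = "\<lambda>S. E S u"]) (rule E_empty)
  ultimately show ?thesis by (simp add: UN_binaryset_eq sums_iff)
qed

text \<open>Multiplicativity is not an axiom of the measure. For \<open>p\<close> in the range of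
  \<open>E T\<close>, additivity gives \<open>E (S \<union> T) p = E S p + p\<close>; pairing with
  \<open>p\<close> and the contractivity of \<open>E (S \<union> T)\<close> leave no room for a
  nonzero \<open>E S p\<close>.\<close>

lemma E_disjoint:
  assumes "S \<in> sets borel" "T \<in> sets borel" "S \<inter> T = {}"
  shows "E S (E T u) = 0"
proof -
  define p where "p = E T u"
  have "E (S \<union> T) p = E S p + p"
    using assms by (simp add: E_Un p_def E_idem)
  then have "cinner (E S p) p + cinner p p = of_real ((norm (E (S \<union> T) p))\<^sup>2)"
    using orth_proj_cinner_self[OF E_proj, of "S \<union> T" p] assms by (simp add: cinner_add_left)
  then have "complex_of_real ((norm (E S p))\<^sup>2 + (norm p)\<^sup>2) = of_real ((norm (E (S \<union> T) p))\<^sup>2)"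
    using assms by (simp add: orth_proj_cinner_self[OF E_proj] cinner_self)
  then have "(norm (E S p))\<^sup>2 + (norm p)\<^sup>2 = (norm (E (S \<union> T) p))\<^sup>2"
    by (simp only: of_real_eq_iff)
  moreover have "(norm (E (S \<union> T) p))\<^sup>2 \<le> (norm p)\<^sup>2"
    using assms by (intro power_mono orth_proj_norm_le E_proj) auto
  ultimately have "(norm (E S p))\<^sup>2 \<le> 0" by linarith
  then show ?thesis by (simp add: p_def)
qed

lemma E_Int:
  assumes S: "S \<in> sets borel" and T: "T \<in> sets borel"
  shows "E S (E T u) = E (S \<inter> T) u"
proof -
  have "E T u = E (S \<inter> T) u + E (T - S) u"
    using E_Un[of "S \<inter> T" "T - S" u] S T by (simp add: Int_Diff_Un Int_commute Diff_disjoint inf_commute)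
      (metis Int_Diff_Un inf_commute Diff_disjoint inf_assoc inf_bot_right)
  moreover have "E S (E (S \<inter> T) u) = E (S \<inter> T) u"
  proof -
    have "S = (S \<inter> T) \<union> (S - T)" by blast
    then have "E S w = E (S \<inter> T) w + E (S - T) w" for w
      using E_Un[of "S \<inter> T" "S - T" w] S T by (metis sets.Int sets.Diff Diff_Int_distrib2 Diff_cancel
          Int_Diff inf_sup_absorb Diff_disjoint Int_assoc Int_commute)
    then show ?thesis
      using S T E_disjoint[of "S - T" "S \<inter> T" u] by (simp add: E_idem Int_Diff) blast
  qed
  moreover have "E S (E (T - S) u) = 0" using S T by (intro E_disjoint) auto
  ultimately show ?thesis using S by (simp add: E_add)
qed

lemma E_compl: "S \<in> sets borel \<Longrightarrow> E (- S) u = u - E S u"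
  using E_Un[of S "- S" u] by (simp add: E_UNIV algebra_simps)

lemma E_mono_zero: "S \<in> sets borel \<Longrightarrow> T \<in> sets borel \<Longrightarrow> S \<subseteq> T \<Longrightarrow> E T u = 0 \<Longrightarrow> E S u = 0"
  using E_Int[of S T u] by (simp add: Int_absorb2 E_zero)

abbreviation \<mu> :: "'h \<Rightarrow> real measure" where "\<mu> u \<equiv> scalar_measure E u"

lemma sets_scalar [simp, measurable_cong]: "sets (\<mu> u) = sets borel"
  by (metis sets.sets_measure_of_eq space_borel scalar_measure_def)

lemma space_scalar [simp]: "space (\<mu> u) = UNIV"
  by (simp add: scalar_measure_def space_measure_of_conv)

text \<open>\<open>measure_of\<close> takes the prescribed values only for a genuine measure, so
  countable additivity has to be derived from the summability of the projections.\<close>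

lemma emeasure_scalar:
  assumes "S \<in> sets borel"
  shows "emeasure (\<mu> u) S = ennreal ((norm (E S u))\<^sup>2)"
proof -
  have "emeasure (\<mu> u) S = ennreal (Re (cinner (E S u) u))"
  proof (rule emeasure_measure_of[OF scalar_measure_def])
    show "positive (sets (\<mu> u)) (\<lambda>S. ennreal (Re (cinner (E S u) u)))"
      by (simp add: positive_def E_empty)
    show "countably_additive (sets (\<mu> u)) (\<lambda>S. ennreal (Re (cinner (E S u) u)))"
    proof (rule countably_additiveI)
      fix F :: "nat \<Rightarrow> real set"
      assume F: "range F \<subseteq> sets (\<mu> u)" "disjoint_family F"
      then have "(\<lambda>n. E (F n) u) sums E (\<Union>n. F n) u"
        by (intro E_sums) auto
      then have "(\<lambda>n. Re (cinner (E (F n) u) u)) sums Re (cinner (E (\<Union>n. F n) u) u)"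
        by (intro bounded_linear.sums[OF bounded_linear_Re]
            bounded_linear.sums[OF bounded_linear_cinner_left])
      moreover have "0 \<le> Re (cinner (E (F n) u) u)" for n
      proof -
        have "F n \<in> sets borel" using F(1) by auto
        then show ?thesis by (simp add: orth_proj_cinner_self[OF E_proj])
      qed
      ultimately show "(\<Sum>i. ennreal (Re (cinner (E (F i) u) u))) = ennreal (Re (cinner (E (\<Union> (range F)) u) u))"
        by (intro suminf_ennreal_eq) auto
    qed
  qed (use assms in auto)
  then show ?thesis using assms by (simp add: orth_proj_cinner_self[OF E_proj])
qed

lemma measure_scalar: "S \<in> sets borel \<Longrightarrow> measure (\<mu> u) S = (norm (E S u))\<^sup>2"
  by (simp add: measure_def emeasure_scalar)

lemma finite_measure_scalar: "finite_measure (\<mu> u)"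
  by (rule finite_measureI) (simp add: emeasure_scalar)

lemma scalar_measure_E:
  assumes "S \<in> sets borel"
  shows "\<mu> (E S u) = density (\<mu> u) (\<lambda>x. ennreal (indicator S x))"
proof (rule measure_eqI)
  fix T assume "T \<in> sets (\<mu> (E S u))"
  then have T: "T \<in> sets borel" by simp
  have "emeasure (density (\<mu> u) (\<lambda>x. ennreal (indicator S x))) T
      = (\<integral>\<^sup>+ x. ennreal (indicator S x) * indicator T x \<partial>\<mu> u)"
    using assms T by (intro emeasure_density) simp_all
  also have "\<dots> = (\<integral>\<^sup>+ x. indicator (S \<inter> T) x \<partial>\<mu> u)"
    by (intro nn_integral_cong) (simp add: indicator_def)
  also have "\<dots> = emeasure (\<mu> (E S u)) T"
    using assms T by (simp add: emeasure_scalar E_Int Int_commute)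
  finally show "emeasure (\<mu> (E S u)) T = emeasure (density (\<mu> u) (\<lambda>x. ennreal (indicator S x))) T" ..
qed simp

lemma AE_scalar:
  assumes "S \<in> sets borel" "E S u = 0"
  shows "AE x in \<mu> u. x \<notin> S"
  using assms by (intro AE_not_in) (simp add: null_sets_def emeasure_scalar)

lemma integrable_E_iff:
  assumes "S \<in> sets borel" "f \<in> borel_measurable borel"
  shows "integrable (\<mu> (E S u)) f \<longleftrightarrow> integrable (\<mu> u) (\<lambda>x. indicator S x * (f x :: real))"
  using assms by (simp add: scalar_measure_E integrable_density)

lemma integral_E:
  assumes "S \<in> sets borel" "f \<in> borel_measurable borel"
  shows "(\<integral>x. f x \<partial>\<mu> (E S u)) = (\<integral>x. indicator S x * (f x :: real) \<partial>\<mu> u)"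
  using assms by (simp add: scalar_measure_E integral_density)

lemma E_Union_zero:
  assumes "countable I" "\<And>i. i \<in> I \<Longrightarrow> F i \<in> sets borel" "\<And>i. i \<in> I \<Longrightarrow> E (F i) u = 0"
  shows "E (\<Union>i\<in>I. F i) u = 0"
proof -
  have "(\<Union>i\<in>I. F i) \<in> null_sets (\<mu> u)"
    using assms by (intro null_sets_UN') (auto simp: null_sets_def emeasure_scalar)
  moreover have "(\<Union>i\<in>I. F i) \<in> sets borel" using assms by (intro sets.countable_UN') auto
  ultimately show ?thesis by (simp add: null_sets_def emeasure_scalar)
qed

end

section \<open>Spectral calculus\<close>

locale spectral_op = pvm E for E :: "real set \<Rightarrow> 'h::complex_hilbert \<Rightarrow> 'h" +
  fixes D :: "'h set" and A :: "'h \<Rightarrow> 'h"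
  assumes sa: "self_adjoint_op D A" and sm: "spectral_measure_of E D A"
begin

lemma D_subspace: "complex_vector.subspace D"
  using sa by (simp add: self_adjoint_op_def linear_op_def)

lemmas D_add = complex_vector.subspace_add[OF D_subspace]
lemmas D_scale = complex_vector.subspace_scale[OF D_subspace]
lemmas D_diff = complex_vector.subspace_diff[OF D_subspace]
lemmas D_zero = complex_vector.subspace_0[OF D_subspace]

lemma A_add: "u \<in> D \<Longrightarrow> v \<in> D \<Longrightarrow> A (u + v) = A u + A v"
  using sa by (simp add: self_adjoint_op_def linear_op_def)

lemma A_scale: "u \<in> D \<Longrightarrow> A (c *\<^sub>C u) = c *\<^sub>C A u"
  using sa by (simp add: self_adjoint_op_def linear_op_def)

lemma A_diff: "u \<in> D \<Longrightarrow> v \<in> D \<Longrightarrow> A (u - v) = A u - A v"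
  using A_add[of "u - v" v] D_diff by simp

lemma D_dense: "closure D = UNIV"
  using sa by (simp add: self_adjoint_op_def)

lemma A_sym:
  assumes "u \<in> D" "v \<in> D"
  shows "cinner (A u) v = cinner u (A v)"
proof -
  have "v \<in> D \<and> A v = A v \<longleftrightarrow> (\<forall>u\<in>D. cinner (A u) v = cinner u (A v))"
    using sa unfolding self_adjoint_op_def by blast
  then show ?thesis using assms by simp
qed

lemma D_iff: "u \<in> D \<longleftrightarrow> integrable (\<mu> u) (\<lambda>x. x\<^sup>2)"
  using sm by (auto simp: spectral_measure_of_def)

lemma cinner_A_self: "u \<in> D \<Longrightarrow> cinner (A u) u = of_real (\<integral>x. x \<partial>\<mu> u)"
  using sm by (auto simp: spectral_measure_of_def)

lemma integrable_of_D:
  assumes "u \<in> D"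
  shows "integrable (\<mu> u) (\<lambda>x. x)"
proof (rule Bochner_Integration.integrable_bound)
  interpret finite_measure "\<mu> u" by (rule finite_measure_scalar)
  show "integrable (\<mu> u) (\<lambda>x. 1 + x\<^sup>2)" using assms by (simp add: D_iff)
  have "\<bar>x\<bar> \<le> 1 + x\<^sup>2" for x :: real
    using zero_le_power2[of "\<bar>x\<bar> - 1/2"] by (simp add: power2_eq_square algebra_simps)
  then show "AE x in \<mu> u. norm x \<le> norm (1 + x\<^sup>2)" by (intro AE_I2) simp
qed simp

lemma E_in_D:
  assumes "S \<in> sets borel" "u \<in> D"
  shows "E S u \<in> D"
proof -
  have "integrable (\<mu> u) (\<lambda>x. x\<^sup>2 * indicator S x)"
    using assms by (intro integrable_real_mult_indicator) (simp_all add: D_iff)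
  then show ?thesis using assms by (simp add: D_iff integrable_E_iff mult.commute)
qed

lemma E_bounded_in_D:
  assumes S: "S \<in> sets borel" "S \<subseteq> {-c..c}"
  shows "E S u \<in> D"
proof -
  interpret finite_measure "\<mu> u" by (rule finite_measure_scalar)
  have "norm (indicator S x * x\<^sup>2) \<le> c\<^sup>2" for x :: real
    using S by (cases "x \<in> S") (auto simp: abs_le_square_iff[symmetric] abs_if dest!: subsetD)
  then have "integrable (\<mu> u) (\<lambda>x. indicator S x * x\<^sup>2)"
    using S by (intro integrable_const_bound[where B = "c\<^sup>2"]) auto
  then show ?thesis using S by (simp add: D_iff integrable_E_iff)
qed

lemma cinner_A_split:
  assumes S: "S \<in> sets borel" and u: "u \<in> D"
  shows "cinner (A u) u = cinner (A (E S u)) (E S u) + cinner (A (E (- S) u)) (E (- S) u)"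
proof -
  have i: "integrable (\<mu> u) (\<lambda>x. indicator S x * x)" "integrable (\<mu> u) (\<lambda>x. indicator (- S) x * x)"
    using integrable_of_D[OF E_in_D[OF _ u]] integrable_E_iff[of _ "\<lambda>x. x" u] S by auto
  have "(\<integral>x. x \<partial>\<mu> u) = (\<integral>x. indicator S x * x + indicator (- S) x * x \<partial>\<mu> u)"
    by (intro Bochner_Integration.integral_cong) (auto simp: indicator_def)
  also have "\<dots> = (\<integral>x. x \<partial>\<mu> (E S u)) + (\<integral>x. x \<partial>\<mu> (E (- S) u))"
    using i S by (simp add: integral_E)
  finally show ?thesis using u S by (simp add: cinner_A_self E_in_D)
qed

text \<open>The spectral measure prescribes \<open>cinner (A u) u\<close> on the diagonal only.
  Comparing the diagonal values for \<open>p + c *\<^sub>C s\<close> with their splitting isolates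
  \<open>Re (cnj c * cinner (A p) s)\<close>; \<open>c = 1\<close> and \<open>c = \<i>\<close> give
  its real and imaginary part.\<close>

lemma cinner_A_orthogonal:
  assumes S: "S \<in> sets borel" and u: "u \<in> D" and v: "v \<in> D"
  shows "cinner (A (E S u)) (E (- S) v) = 0"
proof -
  define p where "p = E S u"
  define s where "s = E (- S) v"
  have ps: "p \<in> D" "s \<in> D" using S u v by (auto simp: p_def s_def E_in_D)
  have Ep: "E S p = p" "E (- S) p = 0" "E S s = 0" "E (- S) s = s"
    using S by (simp_all add: p_def s_def E_idem E_disjoint)
  have *: "Re (cnj c * cinner (A p) s) = 0" for c
  proof -
    have cs: "c *\<^sub>C s \<in> D" using ps D_scale by blast
    have Ew: "E S (p + c *\<^sub>C s) = p" "E (- S) (p + c *\<^sub>C s) = c *\<^sub>C s"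
      using S Ep by (simp_all add: E_add E_scale)
    have "cinner (A (p + c *\<^sub>C s)) (p + c *\<^sub>C s) = cinner (A p) p + cinner (A (c *\<^sub>C s)) (c *\<^sub>C s)"
      using cinner_A_split[OF S, of "p + c *\<^sub>C s"] ps cs by (simp add: Ew D_add)
    then have "cinner (A p) (c *\<^sub>C s) + cinner (A (c *\<^sub>C s)) p = 0"
      using ps cs by (simp add: A_add cinner_add_left cinner_add_right add.commute)
    moreover have "cinner (A (c *\<^sub>C s)) p = cnj (cinner (A p) (c *\<^sub>C s))"
      using A_sym[OF cs ps(1)] cinner_commute[of "c *\<^sub>C s" "A p"] by simp
    ultimately have "Re (cinner (A p) (c *\<^sub>C s) + cnj (cinner (A p) (c *\<^sub>C s))) = 0" by simp
    then show ?thesis by (simp add: cinner_scaleC_right)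
  qed
  have "cinner (A p) s = 0"
    using *[of 1] *[of \<i>] by (simp add: complex_eq_iff)
  then show ?thesis by (simp add: p_def s_def)
qed

text \<open>The component in the complementary spectral subspace pairs to zero with the dense set
  \<open>D\<close>.\<close>

lemma A_E_range:
  assumes S: "S \<in> sets borel" and u: "u \<in> D"
  shows "E S (A (E S u)) = A (E S u)"
proof -
  have "E (- S) (A (E S u)) = 0"
  proof (rule cinner_dense_zero[OF D_dense])
    fix v assume "v \<in> D"
    then show "cinner (E (- S) (A (E S u))) v = 0"
      using cinner_A_orthogonal[OF S u] S by (simp add: E_sym)
  qed
  then show ?thesis using S by (simp add: E_compl)
qed

lemma A_E_commute:
  assumes S: "S \<in> sets borel" and u: "u \<in> D"
  shows "A (E S u) = E S (A u)"
proof -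
  have "A u = A (E S u) + A (E (- S) u)"
    using A_add[of "E S u" "E (- S) u"] S u by (simp add: E_in_D E_compl D_diff)
  moreover have "E S (A (E (- S) u)) = 0"
    using A_E_range[of "- S" u] E_disjoint[of S "- S" "A (E (- S) u)"] S u by simp
  ultimately show ?thesis using S u by (simp add: E_add A_E_range)
qed

lemma measure_scalar_UNIV: "measure (\<mu> u) UNIV = (norm u)\<^sup>2"
  by (simp add: measure_scalar E_UNIV)

lemma integral_ge:
  assumes "integrable (\<mu> u) (\<lambda>x. x)" "E {..<c} u = 0"
  shows "c * (norm u)\<^sup>2 \<le> (\<integral>x. x \<partial>\<mu> u)"
proof -
  interpret finite_measure "\<mu> u" by (rule finite_measure_scalar)
  have "AE x in \<mu> u. 0 \<le> x - c" using AE_scalar[OF _ assms(2)] by (auto simp: not_less)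
  then have "0 \<le> (\<integral>x. x - c \<partial>\<mu> u)" by (rule integral_nonneg_AE)
  then show ?thesis using assms(1) by (simp add: measure_scalar_UNIV mult.commute)
qed

lemma integral_le:
  assumes "integrable (\<mu> u) (\<lambda>x. x)" "E {c<..} u = 0"
  shows "(\<integral>x. x \<partial>\<mu> u) \<le> c * (norm u)\<^sup>2"
proof -
  interpret finite_measure "\<mu> u" by (rule finite_measure_scalar)
  have "AE x in \<mu> u. 0 \<le> c - x" using AE_scalar[OF _ assms(2)] by (auto simp: not_less)
  then have "0 \<le> (\<integral>x. c - x \<partial>\<mu> u)" by (rule integral_nonneg_AE)
  then show ?thesis using assms(1) by (simp add: measure_scalar_UNIV mult.commute)
qed

text \<open>Split \<open>u\<close> into its spectral parts above and below the gap. On each part the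
  quadratic form of \<open>A - c\<close> has one sign and modulus at least \<open>\<rho>\<close>
  times the squared norm, so Cauchy-Schwarz applies; the images of the two parts are orthogonal, so
  the squares add up.\<close>

lemma norm_A_lower:
  assumes u: "u \<in> D" and "0 < \<rho>" and E0: "E {c - \<rho><..<c + \<rho>} u = 0"
  shows "\<rho> * norm u \<le> norm (A u - of_real c *\<^sub>C u)"
proof -
  define p where "p = E {c + \<rho>..} u"
  define s where "s = E {..c - \<rho>} u"
  have ps: "p \<in> D" "s \<in> D" using u by (auto simp: p_def s_def E_in_D)
  have "u = E (- {c - \<rho><..<c + \<rho>}) u" using E0 by (simp add: E_compl)
  also have "- {c - \<rho><..<c + \<rho>} = {c + \<rho>..} \<union> {..c - \<rho>}" by auto
  finally have u_eq: "u = p + s" using \<open>0 < \<rho>\<close> by (subst (asm) E_Un) (auto simp: p_def s_def)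
  have bound: "\<rho> * norm w \<le> norm (A w - of_real c *\<^sub>C w)"
    if "w \<in> D" "\<rho> * (norm w)\<^sup>2 \<le> \<bar>Re (cinner (A w - of_real c *\<^sub>C w) w)\<bar>" for w
  proof (cases "w = 0")
    case False
    have "\<rho> * (norm w)\<^sup>2 \<le> norm (A w - of_real c *\<^sub>C w) * norm w"
      by (rule order_trans[OF that(2) order_trans[OF abs_Re_le_cmod cinner_cauchy_schwarz]])
    then have "\<rho> * norm w * norm w \<le> norm (A w - of_real c *\<^sub>C w) * norm w"
      by (simp add: power2_eq_square mult.assoc)
    then show ?thesis using False by simp
  qed (simp add: A_scale)
  have val: "Re (cinner (A w - of_real c *\<^sub>C w) w) = (\<integral>x. x \<partial>\<mu> w) - c * (norm w)\<^sup>2" if "w \<in> D" for w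
    using that by (simp add: cinner_diff_left cinner_A_self cinner_scaleC_left cinner_self)
  have "E {..<c + \<rho>} p = 0" unfolding p_def by (rule E_disjoint) auto
  then have "(c + \<rho>) * (norm p)\<^sup>2 \<le> (\<integral>x. x \<partial>\<mu> p)" using ps by (intro integral_ge integrable_of_D)
  then have bp: "\<rho> * norm p \<le> norm (A p - of_real c *\<^sub>C p)"
    using ps by (intro bound) (auto simp: val algebra_simps)
  have "E {c - \<rho><..} s = 0" unfolding s_def by (rule E_disjoint) auto
  then have "(\<integral>x. x \<partial>\<mu> s) \<le> (c - \<rho>) * (norm s)\<^sup>2" using ps by (intro integral_le integrable_of_D)
  then have bs: "\<rho> * norm s \<le> norm (A s - of_real c *\<^sub>C s)"
    using ps by (intro bound) (auto simp: val algebra_simps)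
  define p' where "p' = A p - of_real c *\<^sub>C p"
  define s' where "s' = A s - of_real c *\<^sub>C s"
  have p': "E {c + \<rho>..} p' = p'" and s': "E {..c - \<rho>} s' = s'"
    using u by (simp_all add: p'_def s'_def p_def s_def E_diff E_scale A_E_range E_idem)
  have disj: "{..c - \<rho>} \<inter> {c + \<rho>..} = {}" using \<open>0 < \<rho>\<close> by auto
  have o: "cinner x y = 0" if "E {c + \<rho>..} x = x" "E {..c - \<rho>} y = y" for x y
  proof -
    have "cinner x y = cinner x (E {c + \<rho>..} (E {..c - \<rho>} y))"
      using that by (metis E_sym atLeast_borel)
    then show ?thesis using E_disjoint[of "{c + \<rho>..}" "{..c - \<rho>}" y] disj by (simp add: Int_commute)
  qed
  have "A u - of_real c *\<^sub>C u = p' + s'"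
    unfolding u_eq p'_def s'_def using ps by (simp add: A_add complex_vector.scale_right_distrib)
  then have "(norm (A u - of_real c *\<^sub>C u))\<^sup>2 = (norm p')\<^sup>2 + (norm s')\<^sup>2"
    using norm_add_orthogonal[OF o[OF p' s']] by simp
  moreover have "(norm u)\<^sup>2 = (norm p)\<^sup>2 + (norm s)\<^sup>2"
    unfolding u_eq by (intro norm_add_orthogonal o) (auto simp: p_def s_def E_idem)
  moreover have "(\<rho> * norm p)\<^sup>2 \<le> (norm p')\<^sup>2" "(\<rho> * norm s)\<^sup>2 \<le> (norm s')\<^sup>2"
    using bp bs \<open>0 < \<rho>\<close> unfolding p'_def s'_def by (simp_all add: power_mono)
  ultimately have "(\<rho> * norm u)\<^sup>2 \<le> (norm (A u - of_real c *\<^sub>C u))\<^sup>2"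
    by (simp add: power_mult_distrib distrib_left)
  then show ?thesis by (rule power2_le_imp_le) simp
qed

text \<open>The bound for the diagonal values of the symmetric operator \<open>A - c\<close> on the
  range of \<open>E S\<close> is turned into an operator bound by polarization, without a functional
  calculus.\<close>

lemma norm_A_upper:
  assumes S: "S \<in> sets borel" "S \<subseteq> {c - \<delta>..c + \<delta>}" and "0 \<le> \<delta>" and u: "E S u = u"
  shows "norm (A u - of_real c *\<^sub>C u) \<le> \<delta> * norm u"
proof -
  define T where "T w = A w - of_real c *\<^sub>C w" for w
  have sub: "S \<subseteq> {- (\<bar>c\<bar> + \<delta>)..\<bar>c\<bar> + \<delta>}" using S(2) by (auto dest!: subsetD)
  have inD: "w \<in> D" if "E S w = w" for w using E_bounded_in_D[OF S(1) sub, of w] that by simp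
  have q: "\<bar>Re (cinner (T w) w)\<bar> \<le> \<delta> * (norm w)\<^sup>2" if w: "E S w = w" for w
  proof -
    have "E {..<c - \<delta>} (E S w) = 0" "E {c + \<delta><..} (E S w) = 0"
      using S by (auto intro!: E_disjoint)
    then have "(c - \<delta>) * (norm w)\<^sup>2 \<le> (\<integral>x. x \<partial>\<mu> w)" "(\<integral>x. x \<partial>\<mu> w) \<le> (c + \<delta>) * (norm w)\<^sup>2"
      using w inD by (auto intro!: integral_ge integral_le integrable_of_D)
    moreover have "Re (cinner (T w) w) = (\<integral>x. x \<partial>\<mu> w) - c * (norm w)\<^sup>2"
      using inD[OF w] by (simp add: T_def cinner_diff_left cinner_A_self cinner_scaleC_left cinner_self)
    ultimately show ?thesis by (simp add: abs_le_iff algebra_simps)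
  qed
  show ?thesis
  proof (cases "u = 0 \<or> T u = 0")
    case True
    then show ?thesis using \<open>0 \<le> \<delta>\<close> A_scale[OF D_zero, of 0] by (auto simp: T_def)
  next
    case False
    \<comment> \<open>Rescaling \<open>T u\<close> to the length of \<open>u\<close> makes the
      parallelogram law return exactly \<open>4 * (norm u)\<^sup>2\<close>, so no constant is lost
      in the polarization.\<close>
    define t where "t = norm u / norm (T u)"
    define v where "v = of_real t *\<^sub>C T u"
    have t: "0 < t" using False by (simp add: t_def)
    have ETu: "E S (T u) = T u"
      using A_E_range[OF S(1) inD[OF u]] S u by (simp add: T_def E_diff E_scale)
    then have Ev: "E S v = v" using S by (simp add: v_def E_scale)
    have uD: "u \<in> D" "v \<in> D" using inD u Ev by auto
    have nv: "norm v = norm u" using False by (simp add: v_def norm_scaleC t_def norm_divide)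
    have T_sym: "cinner (T v) u = cnj (cinner (T u) v)"
      using A_sym[OF uD(2) uD(1)] cinner_commute[of v "A u"] cinner_commute[of v u]
      by (simp add: T_def cinner_diff_left cinner_scaleC_left)
    have T_add: "T (u + v) = T u + T v" "T (u - v) = T u - T v"
      using uD by (simp_all add: T_def A_add A_diff complex_vector.scale_right_distrib
          complex_vector.scale_right_diff_distrib)
    have "4 * Re (cinner (T u) v) = Re (cinner (T (u + v)) (u + v)) - Re (cinner (T (u - v)) (u - v))"
      by (simp add: T_add cinner_add_left cinner_add_right cinner_diff_left cinner_diff_right T_sym)
    also have "\<dots> \<le> \<delta> * (norm (u + v))\<^sup>2 + \<delta> * (norm (u - v))\<^sup>2"
      using q[of "u + v"] q[of "u - v"] S(1) u Ev by (simp add: E_add E_diff abs_le_iff)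
    also have "\<dots> = \<delta> * (4 * (norm u)\<^sup>2)"
      using parallelogram[of u v] nv by (simp flip: distrib_left)
    also have "Re (cinner (T u) v) = t * (norm (T u))\<^sup>2"
      by (simp add: v_def cinner_scaleC_right cinner_self)
    also have "t * (norm (T u))\<^sup>2 = norm u * norm (T u)"
      using False by (simp add: t_def power2_eq_square)
    finally have "norm u * norm (T u) \<le> norm u * (\<delta> * norm u)" by (simp add: power2_eq_square mult.left_commute)
    then show ?thesis using False by (simp add: T_def)
  qed
qed

lemma A_eigen:
  assumes "E {c} u = u"
  shows "u \<in> D" "A u = of_real c *\<^sub>C u"
proof -
  show "A u = of_real c *\<^sub>C u"
    using norm_A_upper[of "{c}" c 0 u] assms by simp
  have "{c} \<subseteq> {- \<bar>c\<bar>..\<bar>c\<bar>}" by auto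
  then show "u \<in> D" using E_bounded_in_D[of "{c}" "\<bar>c\<bar>" u] assms by simp
qed

text \<open>Near a point of the resolvent set, a nonzero vector of a short spectral subspace would
  be an approximate eigenvector and violate the resolvent bound. The local statement is then patched
  together countably.\<close>

lemma E_spectrum_zero:
  assumes S: "S \<in> sets borel" and disj: "of_real ` S \<inter> spectrum D A = {}"
  shows "E S u = 0"
proof -
  have loc: "\<exists>\<delta>>0. \<forall>u. E (ball x \<delta>) u = 0" if x: "x \<in> S" for x
  proof -
    have "complex_of_real x \<in> resolvent_set D A" using disj x by (auto simp: spectrum_def)
    then obtain C where C: "\<And>u. u \<in> D \<Longrightarrow> norm u \<le> C * norm (of_real x *\<^sub>C u - A u)"
      by (auto simp: resolvent_set_def)
    \<comment> \<open>Chosen so that \<open>\<bar>C\<bar> * \<delta> \<le> 1 / 2\<close>: the two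
      estimates for \<open>w\<close> then give \<open>norm w \<le> norm w / 2\<close>.\<close>
    define \<delta> where "\<delta> = 1 / (2 * (\<bar>C\<bar> + 1))"
    have \<delta>: "0 < \<delta>" "\<bar>C\<bar> * \<delta> \<le> 1 / 2" by (auto simp: \<delta>_def field_simps)
    have "E (ball x \<delta>) u = 0" for u
    proof -
      define w where "w = E (ball x \<delta>) u"
      have wE: "E (ball x \<delta>) w = w" by (simp add: w_def E_idem)
      have wD: "w \<in> D" unfolding w_def
        by (rule E_bounded_in_D[where c = "\<bar>x\<bar> + \<delta>"]) (auto simp: dist_real_def)
      have "norm (A w - of_real x *\<^sub>C w) \<le> \<delta> * norm w"
        by (rule norm_A_upper[OF _ _ _ wE]) (use \<delta> in \<open>auto simp: dist_real_def\<close>)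
      then have "\<bar>C\<bar> * norm (of_real x *\<^sub>C w - A w) \<le> \<bar>C\<bar> * (\<delta> * norm w)"
        by (intro mult_left_mono) (simp_all add: norm_minus_commute)
      moreover have "C * norm (of_real x *\<^sub>C w - A w) \<le> \<bar>C\<bar> * norm (of_real x *\<^sub>C w - A w)"
        by (intro mult_right_mono) simp_all
      ultimately have "norm w \<le> \<bar>C\<bar> * (\<delta> * norm w)" using C[OF wD] by linarith
      also have "\<dots> \<le> (1 / 2) * norm w" using mult_right_mono[OF \<delta>(2), of "norm w"] by (simp add: mult.assoc)
      finally show ?thesis by (simp add: w_def)
    qed
    then show ?thesis using \<delta> by blast
  qed
  \<comment> \<open>Null sets are stable under countable unions only, hence the passage through the
    Lindelof property.\<close>
  define F where "F = {U. open U \<and> (\<forall>u. E U u = 0)}"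
  obtain F' where F': "F' \<subseteq> F" "countable F'" "\<Union>F' = \<Union>F"
    using Lindelof[of F] by (auto simp: F_def)
  have "E (\<Union>U\<in>F'. U) u = 0"
    using F' by (intro E_Union_zero) (auto simp: F_def)
  moreover have "S \<subseteq> \<Union>F'"
  proof
    fix x assume "x \<in> S"
    then obtain \<delta> where "0 < \<delta>" "\<forall>u. E (ball x \<delta>) u = 0" using loc by blast
    then have "ball x \<delta> \<in> F" by (simp add: F_def)
    then show "x \<in> \<Union>F'" using \<open>0 < \<delta>\<close> F'(3) by (metis UnionI centre_in_ball)
  qed
  moreover have "(\<Union>F') \<in> sets borel" using F' by (auto simp: F_def intro!: borel_open)
  ultimately show ?thesis using S E_mono_zero[of S "\<Union>F'" u] by simp
qed

end

section \<open>The quadratic form\<close>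

text \<open>Transfers a setwise comparison of measures to integrals. It is needed because the scalar
  measures of \<open>u + v\<close>, \<open>u\<close> and \<open>v\<close> can be compared set by
  set, whereas membership in the form domain is an integrability condition.\<close>

lemma nn_integral_le_linear_combination:
  fixes M N\<^sub>1 N\<^sub>2 :: "'b measure"
  assumes sets: "sets M = sets N\<^sub>1" "sets N\<^sub>2 = sets N\<^sub>1"
    and le: "\<And>S. S \<in> sets N\<^sub>1 \<Longrightarrow> emeasure M S \<le> c * emeasure N\<^sub>1 S + d * emeasure N\<^sub>2 S"
    and f: "f \<in> borel_measurable N\<^sub>1"
  shows "(\<integral>\<^sup>+x. f x \<partial>M) \<le> c * (\<integral>\<^sup>+x. f x \<partial>N\<^sub>1) + d * (\<integral>\<^sup>+x. f x \<partial>N\<^sub>2)"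
  using f
proof (induction rule: borel_measurable_induct)
  case (cong f g)
  have "space M = space N\<^sub>1" "space N\<^sub>2 = space N\<^sub>1" using sets sets_eq_imp_space_eq by blast+
  then have "(\<integral>\<^sup>+x. f x \<partial>K) = (\<integral>\<^sup>+x. g x \<partial>K)" if "K \<in> {M, N\<^sub>1, N\<^sub>2}" for K
    using cong(3) that by (intro nn_integral_cong) auto
  then show ?case using cong by simp
next
  case (set S)
  then show ?case using le[OF set] sets by simp
next
  case (mult u k)
  have m: "u \<in> borel_measurable M" "u \<in> borel_measurable N\<^sub>2"
    using mult(2) sets by (auto cong: measurable_cong_sets)
  have "k * (\<integral>\<^sup>+x. u x \<partial>M) \<le> k * (c * (\<integral>\<^sup>+x. u x \<partial>N\<^sub>1) + d * (\<integral>\<^sup>+x. u x \<partial>N\<^sub>2))"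
    using mult by (intro mult_left_mono) auto
  then show ?case using mult m by (simp add: nn_integral_cmult distrib_left mult_ac)
next
  case (add u v)
  have m: "u \<in> borel_measurable M" "u \<in> borel_measurable N\<^sub>2" "v \<in> borel_measurable M" "v \<in> borel_measurable N\<^sub>2"
    using add.hyps sets by (auto cong: measurable_cong_sets)
  have "(\<integral>\<^sup>+x. v x \<partial>M) + (\<integral>\<^sup>+x. u x \<partial>M)
      \<le> (c * (\<integral>\<^sup>+x. v x \<partial>N\<^sub>1) + d * (\<integral>\<^sup>+x. v x \<partial>N\<^sub>2)) + (c * (\<integral>\<^sup>+x. u x \<partial>N\<^sub>1) + d * (\<integral>\<^sup>+x. u x \<partial>N\<^sub>2))"
    using add by (intro add_mono) auto
  then show ?case using add m by (simp add: nn_integral_add distrib_left add_ac)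
next
  case (seq U)
  have m: "U i \<in> borel_measurable M" "U i \<in> borel_measurable N\<^sub>2" for i
    using seq(1) sets by (auto cong: measurable_cong_sets)
  have "(\<integral>\<^sup>+x. (SUP i. U i x) \<partial>M) = (SUP i. \<integral>\<^sup>+x. U i x \<partial>M)"
    using seq m by (intro nn_integral_monotone_convergence_SUP) auto
  also have "\<dots> \<le> c * (\<integral>\<^sup>+x. (SUP i. U i x) \<partial>N\<^sub>1) + d * (\<integral>\<^sup>+x. (SUP i. U i x) \<partial>N\<^sub>2)"
  proof (rule SUP_least)
    fix i
    have "c * (\<integral>\<^sup>+x. U i x \<partial>N\<^sub>1) + d * (\<integral>\<^sup>+x. U i x \<partial>N\<^sub>2)
        \<le> c * (\<integral>\<^sup>+x. (SUP i. U i x) \<partial>N\<^sub>1) + d * (\<integral>\<^sup>+x. (SUP i. U i x) \<partial>N\<^sub>2)"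
      by (intro add_mono mult_left_mono nn_integral_mono SUP_upper) auto
    then show "(\<integral>\<^sup>+x. U i x \<partial>M) \<le> c * (\<integral>\<^sup>+x. (SUP i. U i x) \<partial>N\<^sub>1) + d * (\<integral>\<^sup>+x. (SUP i. U i x) \<partial>N\<^sub>2)"
      using seq.IH[of i] by (rule order_trans[rotated])
  qed
  finally show ?case by (simp add: image_comp)
qed

section \<open>The form domain and the spectral cut-offs\<close>

context pvm
begin

lemma form_dom_iff: "u \<in> form_dom E \<longleftrightarrow> (\<integral>\<^sup>+x. ennreal \<bar>x\<bar> \<partial>\<mu> u) < \<infinity>"
  by (simp add: form_dom_def integrable_iff_bounded)

lemma form_dom_integrable: "u \<in> form_dom E \<Longrightarrow> integrable (\<mu> u) (\<lambda>x. x)"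
  by (simp add: form_dom_iff integrable_iff_bounded)

lemma form_dom_add:
  assumes "u \<in> form_dom E" "v \<in> form_dom E"
  shows "u + v \<in> form_dom E"
proof -
  have "(\<integral>\<^sup>+x. ennreal \<bar>x\<bar> \<partial>\<mu> (u + v)) \<le> 2 * (\<integral>\<^sup>+x. ennreal \<bar>x\<bar> \<partial>\<mu> u) + 2 * (\<integral>\<^sup>+x. ennreal \<bar>x\<bar> \<partial>\<mu> v)"
  proof (rule nn_integral_le_linear_combination)
    fix S assume "S \<in> sets (\<mu> u)"
    then have S: "S \<in> sets borel" by simp
    have "(norm (E S (u + v)))\<^sup>2 \<le> 2 * (norm (E S u))\<^sup>2 + 2 * (norm (E S v))\<^sup>2"
      using parallelogram[of "E S u" "E S v"] zero_le_power2[of "norm (E S u - E S v)"]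
      unfolding E_add[OF S] by linarith
    then have "ennreal ((norm (E S (u + v)))\<^sup>2) \<le> ennreal (2 * (norm (E S u))\<^sup>2 + 2 * (norm (E S v))\<^sup>2)"
      by (rule ennreal_leI)
    then show "emeasure (\<mu> (u + v)) S \<le> 2 * emeasure (\<mu> u) S + 2 * emeasure (\<mu> v) S"
      using S by (simp add: emeasure_scalar ennreal_plus ennreal_mult)
  qed simp_all
  also have "\<dots> < \<infinity>" using assms by (simp add: form_dom_iff ennreal_mult_less_top)
  finally show ?thesis by (simp add: form_dom_iff)
qed

lemma form_dom_scale:
  assumes "u \<in> form_dom E"
  shows "c *\<^sub>C u \<in> form_dom E"
proof -
  have "(\<integral>\<^sup>+x. ennreal \<bar>x\<bar> \<partial>\<mu> (c *\<^sub>C u))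
      \<le> ennreal ((cmod c)\<^sup>2) * (\<integral>\<^sup>+x. ennreal \<bar>x\<bar> \<partial>\<mu> u) + 0 * (\<integral>\<^sup>+x. ennreal \<bar>x\<bar> \<partial>\<mu> u)"
  proof (rule nn_integral_le_linear_combination)
    fix S assume "S \<in> sets (\<mu> u)"
    then show "emeasure (\<mu> (c *\<^sub>C u)) S \<le> ennreal ((cmod c)\<^sup>2) * emeasure (\<mu> u) S + 0 * emeasure (\<mu> u) S"
      by (simp add: emeasure_scalar E_scale norm_scaleC power_mult_distrib ennreal_mult)
  qed simp_all
  also have "\<dots> < \<infinity>" using assms by (simp add: form_dom_iff ennreal_mult_less_top)
  finally show ?thesis by (simp add: form_dom_iff)
qed

lemma form_dom_zero: "0 \<in> form_dom E"
  using emeasure_scalar[of UNIV 0] nn_integral_le_linear_combination[of "\<mu> 0" "\<mu> 0" "\<mu> 0" 0 0]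
  by (simp add: form_dom_iff emeasure_scalar E_zero)

lemma form_dom_subspace: "complex_vector.subspace (form_dom E)"
  by (rule complex_vector.subspaceI) (auto intro: form_dom_zero form_dom_add form_dom_scale)

text \<open>
  The form is the limit of the bounded forms given by the cut-off operators
  \<open>A E[-n, n]\<close>, from which it inherits sesquilinearity.
\<close>

definition cutoff :: "nat \<Rightarrow> 'h \<Rightarrow> 'h" where "cutoff n = E {- real n..real n}"

lemma cutoff_proj: "orth_proj (cutoff n)"
  by (simp add: cutoff_def E_proj)

text \<open>Continuity from below of the finite measure \<open>\<mu> u\<close> gives convergence of
  the norms, and Pythagoras converts it into convergence of the vectors.\<close>

lemma cutoff_LIMSEQ: "(\<lambda>n. cutoff n u) \<longlonglongrightarrow> u"
proof -
  interpret finite_measure "\<mu> u" by (rule finite_measure_scalar)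
  have "(\<lambda>n. measure (\<mu> u) {- real n..real n}) \<longlonglongrightarrow> measure (\<mu> u) (\<Union>n. {- real n..real n})"
    by (intro finite_Lim_measure_incseq) (auto simp: incseq_def)
  moreover have "(\<Union>n. {- real n..real n}) = UNIV"
  proof -
    have "x \<in> {- real (nat \<lceil>\<bar>x\<bar>\<rceil>)..real (nat \<lceil>\<bar>x\<bar>\<rceil>)}" for x :: real
      by (simp add: abs_le_iff[symmetric] minus_le_iff) linarith
    then show ?thesis by blast
  qed
  ultimately have "(\<lambda>n. (norm (cutoff n u))\<^sup>2) \<longlonglongrightarrow> (norm u)\<^sup>2"
    by (simp add: measure_scalar cutoff_def E_UNIV)
  then have "(\<lambda>n. (norm u)\<^sup>2 - (norm (cutoff n u))\<^sup>2) \<longlonglongrightarrow> (norm u)\<^sup>2 - (norm u)\<^sup>2"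
    by (intro tendsto_diff tendsto_const)
  moreover have "(norm u)\<^sup>2 - (norm (cutoff n u))\<^sup>2 = (norm (cutoff n u - u))\<^sup>2" for n
    using orth_proj_pythagoras[OF cutoff_proj, of u n] by (simp add: norm_minus_commute)
  ultimately have "(\<lambda>n. (norm (cutoff n u - u))\<^sup>2) \<longlonglongrightarrow> 0" by simp
  then have "(\<lambda>n. norm (cutoff n u - u)) \<longlonglongrightarrow> 0"
    using tendsto_real_sqrt[of "\<lambda>n. (norm (cutoff n u - u))\<^sup>2" 0] by simp
  then show ?thesis by (simp add: tendsto_norm_zero_iff LIM_zero_iff)
qed

end

section \<open>From the cut-off forms to the form itself\<close>

context spectral_op
begin

lemma cutoff_in_D: "cutoff n u \<in> D"
  unfolding cutoff_def by (rule E_bounded_in_D[where c = "real n"]) auto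

lemma cutoff_add: "A (cutoff n (u + v)) = A (cutoff n u) + A (cutoff n v)"
  by (simp add: orth_proj_add[OF cutoff_proj] A_add cutoff_in_D)

lemma cutoff_scale: "A (cutoff n (c *\<^sub>C u)) = c *\<^sub>C A (cutoff n u)"
  by (simp add: orth_proj_scale[OF cutoff_proj] A_scale cutoff_in_D)

lemma cutoff_A_range: "cutoff n (A (cutoff n u)) = A (cutoff n u)"
  using A_E_range[of "{- real n..real n}" "cutoff n u"] cutoff_in_D
  by (simp add: cutoff_def E_idem)

lemma cutoff_sym: "cinner (A (cutoff n u)) v = cinner u (A (cutoff n v))"
proof -
  have "cinner (A (cutoff n u)) v = cinner (A (cutoff n u)) (cutoff n v)"
    by (metis cutoff_A_range cutoff_proj orth_proj_sym)
  also have "\<dots> = cinner (cutoff n u) (A (cutoff n v))" by (intro A_sym cutoff_in_D)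
  also have "\<dots> = cinner u (A (cutoff n v))" by (metis cutoff_A_range cutoff_proj orth_proj_sym)
  finally show ?thesis .
qed

lemma D_form_dom: "u \<in> D \<Longrightarrow> u \<in> form_dom E"
  unfolding form_dom_def using integrable_abs[OF integrable_of_D] by simp

lemma cutoff_integral_LIMSEQ:
  assumes u: "u \<in> form_dom E"
  shows "(\<lambda>n. cinner (A (cutoff n u)) u) \<longlonglongrightarrow> of_real (\<integral>x. x \<partial>\<mu> u)"
proof -
  let ?S = "\<lambda>n::nat. {- real n..real n}"
  have "cinner (A (cutoff n u)) u = cinner (A (cutoff n u)) (cutoff n u)" for n
    by (metis cutoff_A_range cutoff_proj orth_proj_sym)
  then have "cinner (A (cutoff n u)) u = of_real (\<integral>x. indicator (?S n) x * x \<partial>\<mu> u)" for n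
    using integral_E[of "?S n" "\<lambda>x. x" u] cinner_A_self[OF cutoff_in_D, of n u] by (simp add: cutoff_def)
  moreover have "(\<lambda>n. \<integral>x. indicator (?S n) x * x \<partial>\<mu> u) \<longlonglongrightarrow> (\<integral>x. x \<partial>\<mu> u)"
  proof (rule integral_dominated_convergence)
    show "integrable (\<mu> u) (\<lambda>x. \<bar>x\<bar>)" using u by (simp add: form_dom_def)
    show "AE x in \<mu> u. (\<lambda>n. indicator (?S n) x * x) \<longlonglongrightarrow> x"
    proof (rule AE_I2)
      fix x :: real
      have "indicator (?S n) x * x = x" if "n \<ge> nat \<lceil>\<bar>x\<bar>\<rceil>" for n
      proof -
        have "\<bar>x\<bar> \<le> real n" using that by linarith
        then show ?thesis by (simp add: abs_le_iff indicator_def minus_le_iff)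
      qed
      then show "(\<lambda>n. indicator (?S n) x * x) \<longlonglongrightarrow> x"
        by (intro tendsto_eventually eventually_sequentiallyI)
    qed
    show "AE x in \<mu> u. norm (indicator (?S n) x * x) \<le> \<bar>x\<bar>" for n
      by (intro AE_I2) (simp add: indicator_def)
  qed simp_all
  ultimately show ?thesis by (simp add: tendsto_of_real)
qed

text \<open>For each cut-off operator polarization is an algebraic identity, and \<open>form\<close>
  is built by the same identity from the limits of the diagonal values.\<close>

lemma form_LIMSEQ:
  assumes u: "u \<in> form_dom E" and v: "v \<in> form_dom E"
  shows "(\<lambda>n. cinner (A (cutoff n u)) v) \<longlonglongrightarrow> form E u v"
proof -
  let ?w = "\<lambda>p::nat. u + (\<i> ^ p) *\<^sub>C v"
  have "(\<lambda>n. (\<Sum>p<4. \<i> ^ p * cinner (A (cutoff n (?w p))) (?w p)) / 4) \<longlonglongrightarrow> form E u v"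
    unfolding form_def using u v
    by (intro tendsto_divide tendsto_sum tendsto_mult tendsto_const cutoff_integral_LIMSEQ
        form_dom_add form_dom_scale) auto
  moreover have "(\<Sum>p<4. \<i> ^ p * cinner (A (cutoff n (?w p))) (?w p)) / 4 = cinner (A (cutoff n u)) v" for n
  proof -
    have "(\<Sum>p<4. \<i> ^ p * cinner (A (cutoff n (?w p))) (?w p)) = 4 * cinner (A (cutoff n u)) v"
      by (simp add: eval_nat_numeral cutoff_add cutoff_scale cinner_add_left cinner_add_right
          cinner_scaleC_left cinner_scaleC_right algebra_simps)
    then show ?thesis by simp
  qed
  ultimately show ?thesis by simp
qed

lemma form_add_left:
  assumes "u \<in> form_dom E" "v \<in> form_dom E" "w \<in> form_dom E"
  shows "form E (u + v) w = form E u w + form E v w"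
proof (rule LIMSEQ_unique)
  show "(\<lambda>n. cinner (A (cutoff n (u + v))) w) \<longlonglongrightarrow> form E (u + v) w"
    using assms by (intro form_LIMSEQ form_dom_add)
  show "(\<lambda>n. cinner (A (cutoff n (u + v))) w) \<longlonglongrightarrow> form E u w + form E v w"
    unfolding cutoff_add cinner_add_left using assms by (intro tendsto_add form_LIMSEQ)
qed

lemma form_scale_left:
  assumes "u \<in> form_dom E" "w \<in> form_dom E"
  shows "form E (c *\<^sub>C u) w = c * form E u w"
proof (rule LIMSEQ_unique)
  show "(\<lambda>n. cinner (A (cutoff n (c *\<^sub>C u))) w) \<longlonglongrightarrow> form E (c *\<^sub>C u) w"
    using assms by (intro form_LIMSEQ form_dom_scale)
  show "(\<lambda>n. cinner (A (cutoff n (c *\<^sub>C u))) w) \<longlonglongrightarrow> c * form E u w"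
    unfolding cutoff_scale cinner_scaleC_left using assms by (intro tendsto_mult_left form_LIMSEQ)
qed

lemma form_sym:
  assumes "u \<in> form_dom E" "v \<in> form_dom E"
  shows "form E u v = cnj (form E v u)"
proof (rule LIMSEQ_unique)
  show "(\<lambda>n. cinner (A (cutoff n u)) v) \<longlonglongrightarrow> form E u v" using assms by (intro form_LIMSEQ)
  have "cinner (A (cutoff n u)) v = cnj (cinner (A (cutoff n v)) u)" for n
    by (subst cutoff_sym) (rule cinner_commute)
  then show "(\<lambda>n. cinner (A (cutoff n u)) v) \<longlonglongrightarrow> cnj (form E v u)"
    using tendsto_cnj[OF form_LIMSEQ[OF assms(2,1)]] by simp
qed

lemma form_self:
  assumes "u \<in> form_dom E"
  shows "form E u u = of_real (\<integral>x. x \<partial>\<mu> u)"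
  using form_LIMSEQ[OF assms assms] cutoff_integral_LIMSEQ[OF assms] by (rule LIMSEQ_unique)

text \<open>\<open>A\<close> commutes with the cut-offs, so they can be moved in front of
  \<open>A u\<close>, where they converge strongly.\<close>

lemma form_eq_cinner:
  assumes u: "u \<in> D" and v: "v \<in> form_dom E"
  shows "form E u v = cinner (A u) v"
proof (rule LIMSEQ_unique)
  show "(\<lambda>n. cinner (A (cutoff n u)) v) \<longlonglongrightarrow> form E u v" by (rule form_LIMSEQ[OF D_form_dom[OF u] v])
  have "A (cutoff n u) = cutoff n (A u)" for n
    using u by (simp add: cutoff_def A_E_commute)
  then show "(\<lambda>n. cinner (A (cutoff n u)) v) \<longlonglongrightarrow> cinner (A u) v"
    by (simp add: tendsto_cinner_left[OF cutoff_LIMSEQ])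
qed

lemma form_eq_cinner_right:
  assumes u: "u \<in> form_dom E" and v: "v \<in> D"
  shows "form E u v = cinner u (A v)"
  using form_sym[OF u D_form_dom[OF v]] form_eq_cinner[OF v u] cinner_commute[of u "A v"] by simp

section \<open>The resolvent off the real axis\<close>

lemma abs_Im_times_norm_le:
  assumes "u \<in> D"
  shows "\<bar>Im z\<bar> * norm u \<le> norm (z *\<^sub>C u - A u)"
proof (cases "u = 0")
  case False
  have "Im (cinner (z *\<^sub>C u - A u) u) = Im z * (norm u)\<^sup>2"
    using assms by (simp add: cinner_diff_left cinner_scaleC_left cinner_self cinner_A_self)
  then have "\<bar>Im z\<bar> * (norm u)\<^sup>2 \<le> cmod (cinner (z *\<^sub>C u - A u) u)"
    using abs_Im_le_cmod[of "cinner (z *\<^sub>C u - A u) u"] by (simp add: abs_mult)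
  also have "\<dots> \<le> norm (z *\<^sub>C u - A u) * norm u" by (rule cinner_cauchy_schwarz)
  finally have "\<bar>Im z\<bar> * norm u * norm u \<le> norm (z *\<^sub>C u - A u) * norm u"
    by (simp add: power2_eq_square mult.assoc)
  then show ?thesis using False by simp
qed simp

text \<open>
  This is \<open>(A - z)\<^sup>-\<^sup>1\<close>, the negative of the \<open>resolvent\<close> of the definitions; it is used for
  nonreal \<open>z\<close> only.
\<close>

definition R :: "complex \<Rightarrow> 'h \<Rightarrow> 'h" where
  "R z h = (THE g. g \<in> D \<and> A g - z *\<^sub>C g = h)"

lemma R_unique:
  assumes z: "Im z \<noteq> 0" and g: "g \<in> D" "A g - z *\<^sub>C g = h"
  shows "R z h = g"
  unfolding R_def
proof (rule the_equality)
  fix g' assume g': "g' \<in> D \<and> A g' - z *\<^sub>C g' = h"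
  then have "g' \<in> D" by simp
  then have "A (g' - g) - z *\<^sub>C (g' - g) = (A g' - z *\<^sub>C g') - (A g - z *\<^sub>C g)"
    by (simp add: A_diff[OF _ g(1)] complex_vector.scale_right_diff_distrib)
  also have "\<dots> = h - h" using g g' by (simp only:)
  finally have "A (g' - g) - z *\<^sub>C (g' - g) = 0" by simp
  then have "\<bar>Im z\<bar> * norm (g' - g) \<le> 0"
    using abs_Im_times_norm_le[of "g' - g" z] g g' by (simp add: D_diff norm_minus_commute)
  then show "g' = g" using z by (simp add: mult_le_0_iff)
qed (use g in simp)

lemma
  assumes z: "Im z \<noteq> 0"
  shows R_in_D: "R z h \<in> D" and R_eq: "A (R z h) - z *\<^sub>C R z h = h"
proof -
  have "z \<in> resolvent_set D A"
    using abs_Im_times_norm_le[of _ z] abs_Im_times_norm_le[of _ "cnj z"] z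
    by (intro resolvent_set_self_adjointI[OF sa, of "\<bar>Im z\<bar>"]) auto
  then have "- h \<in> (\<lambda>u. z *\<^sub>C u - A u) ` D" by (auto simp: resolvent_set_def bij_betw_def)
  then obtain g where "g \<in> D" "- h = z *\<^sub>C g - A g" by blast
  then have g: "g \<in> D" "A g - z *\<^sub>C g = h" by (metis, metis minus_diff_eq minus_minus)
  then show "R z h \<in> D" "A (R z h) - z *\<^sub>C R z h = h" using R_unique[OF z g] by simp_all
qed

lemma R_add: "Im z \<noteq> 0 \<Longrightarrow> R z (g + h) = R z g + R z h"
  by (rule R_unique) (simp_all add: D_add R_in_D A_add complex_vector.scale_right_distrib
      add_diff_add R_eq)

lemma R_scale:
  assumes z: "Im z \<noteq> 0"
  shows "R z (c *\<^sub>C h) = c *\<^sub>C R z h"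
proof (rule R_unique[OF z])
  have "A (c *\<^sub>C R z h) - z *\<^sub>C c *\<^sub>C R z h = c *\<^sub>C (A (R z h) - z *\<^sub>C R z h)"
    unfolding A_scale[OF R_in_D[OF z]] complex_vector.scale_right_diff_distrib
    by (subst complex_vector.scale_left_commute) (rule refl)
  then show "A (c *\<^sub>C R z h) - z *\<^sub>C c *\<^sub>C R z h = c *\<^sub>C h" by (simp only: R_eq[OF z])
qed (intro D_scale R_in_D z)

lemma R_diff: "Im z \<noteq> 0 \<Longrightarrow> R z (g - h) = R z g - R z h"
  using R_add[of z "g - h" h] by simp

lemma R_sum: "Im z \<noteq> 0 \<Longrightarrow> R z (\<Sum>i\<in>I. f i) = (\<Sum>i\<in>I. R z (f i))"
  using R_scale[of z 0 0]
  by (induction I rule: infinite_finite_induct) (simp_all add: R_add)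

lemma R_norm: "Im z \<noteq> 0 \<Longrightarrow> \<bar>Im z\<bar> * norm (R z h) \<le> norm h"
  using abs_Im_times_norm_le[OF R_in_D, of z z h] R_eq[of z h] by (metis norm_minus_commute)

lemma R_E: "Im z \<noteq> 0 \<Longrightarrow> S \<in> sets borel \<Longrightarrow> E S (R z h) = R z (E S h)"
  by (rule R_unique[symmetric])
    (simp_all add: E_in_D R_in_D A_E_commute R_eq flip: E_scale E_diff)

end

section \<open>The bottom of the spectrum and the form norm\<close>

locale semibounded_op = spectral_op E D A
  for E :: "real set \<Rightarrow> 'h::complex_hilbert \<Rightarrow> 'h" and D A +
  assumes sb: "semibounded_below D A"
    and spectrum_real: "\<exists>x. complex_of_real x \<in> spectrum D A"
begin

definition m :: real where "m = spectrum_min D A"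

text \<open>\<open>LEAST\<close> on the reals is meaningful only if a minimum exists. The real
  points of the spectrum form a set that is bounded below by semiboundedness and closed because
  resolvent points are stable; its infimum is therefore attained.\<close>

lemma spectrum_min_le:
  assumes "complex_of_real x \<in> spectrum D A"
  shows "m \<le> x"
proof -
  define M where "M = {x. complex_of_real x \<in> spectrum D A}"
  obtain c where c: "\<And>u. u \<in> D \<Longrightarrow> c * (norm u)\<^sup>2 \<le> Re (cinner (A u) u)"
    using sb by (auto simp: semibounded_below_def)
  have "c \<le> y" if "y \<in> M" for y
  proof (rule ccontr)
    assume "\<not> c \<le> y"
    have "(c - y) * norm u \<le> norm (of_real y *\<^sub>C u - A u)" if "u \<in> D" for u
    proof (cases "u = 0")
      case False
      have "(c - y) * (norm u)\<^sup>2 \<le> Re (cinner (A u - of_real y *\<^sub>C u) u)"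
        using c[OF that] by (simp add: cinner_diff_left cinner_scaleC_left cinner_self algebra_simps)
      also have "\<dots> \<le> norm (A u - of_real y *\<^sub>C u) * norm u"
        using complex_Re_le_cmod cinner_cauchy_schwarz by (rule order_trans)
      finally have "(c - y) * norm u * norm u \<le> norm (of_real y *\<^sub>C u - A u) * norm u"
        by (simp add: power2_eq_square mult.assoc norm_minus_commute)
      then show ?thesis using False by simp
    qed simp
    then have "complex_of_real y \<in> resolvent_set D A"
      using \<open>\<not> c \<le> y\<close> by (intro resolvent_set_self_adjointI[OF sa, of "c - y"]) auto
    then show False using that by (simp add: M_def spectrum_def)
  qed
  then have bdd: "bdd_below M" by (rule bdd_belowI)
  have "open (- M)"
    unfolding open_dist
  proof
    fix y assume "y \<in> - M"
    then have "complex_of_real y \<in> resolvent_set D A" by (simp add: M_def spectrum_def)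
    then obtain C where C: "\<And>u. u \<in> D \<Longrightarrow> norm u \<le> C * norm (of_real y *\<^sub>C u - A u)"
      by (auto simp: resolvent_set_def)
    define K where "K = \<bar>C\<bar> + 1"
    have K: "0 < K" by (simp add: K_def)
    have C': "norm u \<le> K * norm (of_real y *\<^sub>C u - A u)" if "u \<in> D" for u
    proof -
      have "C * norm (of_real y *\<^sub>C u - A u) \<le> K * norm (of_real y *\<^sub>C u - A u)"
        by (intro mult_right_mono) (auto simp: K_def)
      then show ?thesis using C[OF that] by linarith
    qed
    have "x \<in> - M" if x: "dist x y < 1 / K" for x
    proof -
      \<comment> \<open>Moving the spectral parameter from \<open>y\<close> to \<open>x\<close>
        costs at most \<open>\<bar>x - y\<bar> * norm u\<close> in the lower bound, so the bound
        survives within distance \<open>1 / K\<close>.\<close>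
      have "(1 / K - \<bar>x - y\<bar>) * norm u \<le> norm (of_real x *\<^sub>C u - A u)" if "u \<in> D" for u
      proof -
        have "norm u / K \<le> norm (of_real y *\<^sub>C u - A u)"
          using C'[OF that] K by (simp add: divide_le_eq mult.commute)
        also have "of_real y *\<^sub>C u - A u = (of_real x *\<^sub>C u - A u) + of_real (y - x) *\<^sub>C u"
          by (simp add: complex_vector.scale_left_diff_distrib)
        also have "norm \<dots> \<le> norm (of_real x *\<^sub>C u - A u) + \<bar>x - y\<bar> * norm u"
          using norm_triangle_ineq norm_scaleC[of "of_real (y - x)" u]
          by (metis abs_minus_commute norm_of_real)
        finally show ?thesis by (simp add: algebra_simps)
      qed
      then have "complex_of_real x \<in> resolvent_set D A"
        using x by (intro resolvent_set_self_adjointI[OF sa, of "1 / K - \<bar>x - y\<bar>"]) (auto simp: dist_real_def)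
      then show ?thesis by (simp add: M_def spectrum_def)
    qed
    then show "\<exists>e>0. \<forall>x. dist x y < e \<longrightarrow> x \<in> - M" using K by (intro exI[of _ "1 / K"]) auto
  qed
  then have "closed M" by (simp add: closed_def)
  moreover have "M \<noteq> {}" using assms by (auto simp: M_def)
  ultimately have "Inf M \<in> M" using bdd closed_contains_Inf by blast
  then have "m = Inf M"
    unfolding m_def spectrum_min_def
    by (intro Least_equality) (auto simp: M_def intro!: cInf_lower bdd[unfolded M_def])
  then show ?thesis using assms bdd by (simp add: M_def cInf_lower)
qed

lemma E_below_zero: "E {..<m} u = 0"
proof (rule E_spectrum_zero)
  show "complex_of_real ` {..<m} \<inter> spectrum D A = {}" using spectrum_min_le by force
qed simp

lemma integral_ge_m: "u \<in> form_dom E \<Longrightarrow> m * (norm u)\<^sup>2 \<le> (\<integral>x. x \<partial>\<mu> u)"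
  by (intro integral_ge form_dom_integrable E_below_zero)

lemma form_inner_self: "u \<in> form_dom E \<Longrightarrow> form_inner D A E u u = of_real ((\<integral>x. x \<partial>\<mu> u) - (m - 1) * (norm u)\<^sup>2)"
  by (simp add: form_inner_def form_self cinner_self m_def)

text \<open>Shifting by \<open>m - 1\<close> instead of \<open>m\<close> leaves one full copy of the
  squared norm, so that the form norm dominates the norm.\<close>

lemma form_inner_ge: "u \<in> form_dom E \<Longrightarrow> (norm u)\<^sup>2 \<le> Re (form_inner D A E u u)"
  using integral_ge_m[of u] by (simp add: form_inner_self algebra_simps)

sublocale fi: psd_form "form_dom E" "form_inner D A E"
proof
  show "complex_vector.subspace (form_dom E)" by (rule form_dom_subspace)
  show "form_inner D A E (u + v) w = form_inner D A E u w + form_inner D A E v w"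
    if "u \<in> form_dom E" "v \<in> form_dom E" "w \<in> form_dom E" for u v w
    using that by (simp add: form_inner_def form_add_left cinner_add_left algebra_simps)
  show "form_inner D A E (c *\<^sub>C u) w = c * form_inner D A E u w"
    if "u \<in> form_dom E" "w \<in> form_dom E" for c u w
    using that by (simp add: form_inner_def form_scale_left cinner_scaleC_left algebra_simps)
  show "form_inner D A E u v = cnj (form_inner D A E v u)"
    if "u \<in> form_dom E" "v \<in> form_dom E" for u v
    using form_sym[OF that] cinner_commute[of u v] by (simp add: form_inner_def)
  show "0 \<le> Re (form_inner D A E u u)" if "u \<in> form_dom E" for u
    using form_inner_ge[OF that] zero_le_power2[of "norm u"] by linarith
qed

abbreviation na :: "'h \<Rightarrow> real" where "na \<equiv> form_norm D A E"

lemma nrm_eq_form_norm: "fi.nrm = na"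
  by (simp add: fun_eq_iff fi.nrm_def form_norm_def)

lemmas na_triangle = fi.triangle[unfolded nrm_eq_form_norm]
lemmas na_scale = fi.nrm_scale[unfolded nrm_eq_form_norm]
lemmas na_nonneg = fi.nrm_nonneg[unfolded nrm_eq_form_norm]
lemmas na_cauchy_schwarz = fi.cauchy_schwarz[unfolded nrm_eq_form_norm]
lemmas na_triangle_sum = fi.triangle_sum[unfolded nrm_eq_form_norm]
lemmas na_sq = fi.nrm_sq[unfolded nrm_eq_form_norm]

lemma norm_le_na: "u \<in> form_dom E \<Longrightarrow> norm u \<le> na u"
  using form_inner_ge[of u] by (simp add: form_norm_def real_le_rsqrt)

lemma na_minus: "u \<in> form_dom E \<Longrightarrow> na (- u) = na u"
  using na_scale[of u "-1"] by (simp add: scaleC_minus_one)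

lemma na_diff_le: "u \<in> form_dom E \<Longrightarrow> v \<in> form_dom E \<Longrightarrow> na (u - v) \<le> na u + na v"
  using na_triangle[of u "-v"] fi.V_minus[of v] by (simp add: na_minus)

text \<open>Substituting \<open>A g = h + z *\<^sub>C g\<close> into the form leaves only inner
  products of \<open>h\<close> and \<open>g\<close>, which the bound
  \<open>1 / \<bar>Im z\<bar>\<close> for the resolvent controls.\<close>

lemma na_R:
  assumes z: "Im z \<noteq> 0"
  shows "(na (R z h))\<^sup>2 \<le> (1 / \<bar>Im z\<bar> + cmod (z - of_real (m - 1)) / (Im z)\<^sup>2) * (norm h)\<^sup>2"
proof -
  define g where "g = R z h"
  have g: "g \<in> D" "A g = h + z *\<^sub>C g" using R_in_D[OF z, of h] R_eq[OF z, of h]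
    by (simp_all add: g_def diff_eq_eq)
  have ng: "norm g \<le> norm h / \<bar>Im z\<bar>"
    using R_norm[OF z, of h] z by (simp add: g_def le_divide_eq mult.commute)
  have eq: "form_inner D A E g g = cinner h g + (z - of_real (m - 1)) * of_real ((norm g)\<^sup>2)"
    using g by (simp add: form_inner_def form_eq_cinner D_form_dom cinner_add_left cinner_scaleC_left
        cinner_self m_def algebra_simps)
  have "(na g)\<^sup>2 \<le> cmod (cinner h g + (z - of_real (m - 1)) * of_real ((norm g)\<^sup>2))"
    unfolding na_sq[OF D_form_dom[OF g(1)]] eq by (rule complex_Re_le_cmod)
  also have "\<dots> \<le> norm h * norm g + cmod (z - of_real (m - 1)) * (norm g)\<^sup>2"
    by (intro norm_triangle_mono cinner_cauchy_schwarz) (simp add: norm_mult norm_power)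
  also have "\<dots> \<le> norm h * (norm h / \<bar>Im z\<bar>) + cmod (z - of_real (m - 1)) * (norm h / \<bar>Im z\<bar>)\<^sup>2"
    by (intro add_mono mult_left_mono power_mono ng) auto
  also have "\<dots> = (1 / \<bar>Im z\<bar> + cmod (z - of_real (m - 1)) / (Im z)\<^sup>2) * (norm h)\<^sup>2"
    by (simp add: power2_eq_square divide_simps distrib_right)
  finally show ?thesis by (simp add: g_def)
qed

end

section \<open>Stability on the complement of a spectral subspace\<close>

context spectral_op
begin

lemma E_Icc_in_D: "E {a..b} u \<in> D"
  by (rule E_bounded_in_D[where c = "\<bar>a\<bar> + \<bar>b\<bar>"]) auto

text \<open>
  Pairing \<open>g\<close> with \<open>f\<close> shows that \<open>\<parallel>Pf\<parallel>\<^sup>2\<close> is close to \<open>Im z \<parallel>f\<parallel>\<^sup>2\<close>.  Inserting this into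
  \<open>\<parallel>(A - c)f\<parallel> \<ge> \<parallel>f\<parallel> (b - a)/2\<close> with \<open>c = (a + b)/2\<close> produces the polynomial whose
  zero set is the curve \<open>\<Gamma>\<close>.
\<close>

lemma compression_lower_bound:
  assumes "a < b" and P: "orth_proj P" and f: "f \<in> D" and Qf: "E {a..b} f = 0"
    and y: "1 / 2 \<le> Im z" "Im z \<le> 3 / 2"
    and c1: "c1 \<le> (Re z - a) * (b - Re z) - Im z * (1 - Im z)" "c1 \<le> ((b - a) / 2)\<^sup>2"
    and g_def: "g = E (- {a..b}) (A f - z *\<^sub>C f + \<i> *\<^sub>C P f)"
  shows "c1 * norm f \<le> (b - a + 2) * norm g"
proof -
  define c where "c = (a + b) / 2"
  define \<rho> where "\<rho> = (b - a) / 2"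
  define n where "n = norm f"
  define y0 where "y0 = (norm (P f))\<^sup>2"
  define k where "k = E (- {a..b}) (P f)"
  have \<rho>: "0 < \<rho>" using \<open>a < b\<close> by (simp add: \<rho>_def)
  have n0: "0 \<le> n" by (simp add: n_def)
  have Q': "E (- {a..b}) f = f" using Qf by (simp add: E_compl)
  have g: "g = A f - z *\<^sub>C f + \<i> *\<^sub>C k"
    using f A_E_commute[of "- {a..b}" f] by (simp add: g_def k_def E_add E_diff E_scale Q')
  have kf: "cinner k f = of_real y0"
    by (simp add: k_def E_sym Q' orth_proj_cinner_self[OF P] y0_def)
  have "norm k \<le> norm (P f)" unfolding k_def by (intro orth_proj_norm_le E_proj) auto
  \<comment> \<open>With this inequality the unknown projection enters the estimate through the
    single number \<open>y0\<close>.\<close>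
  then have kk: "(norm k)\<^sup>2 \<le> y0" by (simp add: y0_def power_mono)
  have gf: "\<bar>y0 - Im z * n\<^sup>2\<bar> \<le> norm g * n"
  proof -
    have "Im (cinner g f) = y0 - Im z * n\<^sup>2"
      using f by (simp add: g cinner_add_left cinner_diff_left cinner_scaleC_left kf cinner_self
          cinner_A_self n_def)
    then show ?thesis
      using abs_Im_le_cmod[of "cinner g f"] cinner_cauchy_schwarz[of g f] by (simp add: n_def)
  qed
  have "E {c - \<rho><..<c + \<rho>} f = 0"
    by (rule E_mono_zero[OF _ _ _ Qf]) (auto simp: c_def \<rho>_def field_simps)
  then have low: "\<rho> * n \<le> norm (A f - of_real c *\<^sub>C f)"
    using norm_A_lower[OF f \<rho>] by (simp add: n_def)
  define h where "h = (z - of_real c) *\<^sub>C f - \<i> *\<^sub>C k"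
  have "A f - of_real c *\<^sub>C f = h + g"
    by (simp add: h_def g complex_vector.scale_left_diff_distrib)
  then have low': "\<rho> * n \<le> norm h + norm g"
    using low norm_triangle_ineq[of h g] by simp
  have "cinner f k = of_real y0" using kf cinner_commute[of f k] by simp
  then have "Re (cinner ((z - of_real c) *\<^sub>C f) (\<i> *\<^sub>C k)) = y0 * Im z"
    by (simp add: cinner_scaleC_left cinner_scaleC_right)
  then have "(norm h)\<^sup>2 = (cmod (z - of_real c))\<^sup>2 * n\<^sup>2 + (norm k)\<^sup>2 - 2 * (y0 * Im z)"
    by (simp add: h_def norm_diff_sq norm_scaleC n_def power_mult_distrib)
  then have "(norm h)\<^sup>2 \<le> (cmod (z - of_real c))\<^sup>2 * n\<^sup>2 + y0 * (1 - 2 * Im z)"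
    using kk by (simp add: algebra_simps)
  also have "(cmod (z - of_real c))\<^sup>2 = (Re z - c)\<^sup>2 + (Im z)\<^sup>2" by (simp add: cmod_power2)
  \<comment> \<open>As \<open>\<bar>1 - 2 * Im z\<bar> \<le> 2\<close>, replacing \<open>y0\<close>
    by \<open>Im z * n\<^sup>2\<close> costs at most \<open>2 * (norm g * n)\<close>. The powers of
    \<open>Im z\<close> then combine to \<open>Im z * (1 - Im z)\<close>.\<close>
  also have "y0 * (1 - 2 * Im z) \<le> Im z * n\<^sup>2 * (1 - 2 * Im z) + 2 * (norm g * n)"
  proof -
    have "(y0 - Im z * n\<^sup>2) * (1 - 2 * Im z) \<le> \<bar>y0 - Im z * n\<^sup>2\<bar> * \<bar>1 - 2 * Im z\<bar>"
      by (metis abs_ge_self abs_mult)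
    also have "\<dots> \<le> (norm g * n) * 2" using gf y by (intro mult_mono) auto
    finally show ?thesis by (simp add: algebra_simps)
  qed
  finally have up: "(norm h)\<^sup>2 \<le> ((Re z - c)\<^sup>2 + Im z * (1 - Im z)) * n\<^sup>2 + 2 * (norm g * n)"
    by (simp add: algebra_simps power2_eq_square)
  have G: "\<rho>\<^sup>2 - (Re z - c)\<^sup>2 = (Re z - a) * (b - Re z)"
    by (simp add: \<rho>_def c_def power2_eq_square field_simps)
  \<comment> \<open>The inequality \<open>\<rho> * n - norm g \<le> norm h\<close> can be squared
    only if its left side is nonnegative. In the other case \<open>norm g\<close> is already large
    compared with \<open>n\<close>, and \<open>c1 \<le> \<rho>\<^sup>2\<close> suffices.\<close>
  have "c1 * n * n \<le> (2 * \<rho> + 2) * norm g * n"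
  proof (cases "norm g \<le> \<rho> * n")
    case True
    then have "(\<rho> * n - norm g)\<^sup>2 \<le> (norm h)\<^sup>2" using low' by (intro power_mono) auto
    moreover have "(\<rho> * n - norm g)\<^sup>2 = \<rho>\<^sup>2 * n\<^sup>2 - 2 * \<rho> * (norm g * n) + (norm g)\<^sup>2"
      by (simp add: power2_diff power_mult_distrib algebra_simps)
    ultimately have "\<rho>\<^sup>2 * n\<^sup>2 - 2 * \<rho> * (norm g * n)
        \<le> ((Re z - c)\<^sup>2 + Im z * (1 - Im z)) * n\<^sup>2 + 2 * (norm g * n)"
      using up zero_le_power2[of "norm g"] by linarith
    then have "(\<rho>\<^sup>2 - (Re z - c)\<^sup>2 - Im z * (1 - Im z)) * n\<^sup>2 \<le> (2 * \<rho> + 2) * (norm g * n)"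
      by (simp add: algebra_simps)
    moreover have "c1 * n\<^sup>2 \<le> (\<rho>\<^sup>2 - (Re z - c)\<^sup>2 - Im z * (1 - Im z)) * n\<^sup>2"
      using c1(1) G by (intro mult_right_mono) auto
    ultimately show ?thesis by (simp add: power2_eq_square mult.assoc)
  next
    case False
    have "c1 * n \<le> \<rho> * (\<rho> * n)"
      using mult_right_mono[OF c1(2) n0] by (simp add: \<rho>_def power2_eq_square)
    also have "\<dots> \<le> \<rho> * norm g" using False \<rho> by simp
    also have "\<dots> \<le> (2 * \<rho> + 2) * norm g" using \<rho> by (intro mult_right_mono) auto
    finally show ?thesis using n0 by (rule mult_right_mono)
  qed
  moreover have "2 * \<rho> + 2 = b - a + 2" by (simp add: \<rho>_def)
  ultimately show ?thesis
    using \<open>a < b\<close> n0 by (cases "n = 0") (auto simp: mult_le_cancel_right simp flip: n_def)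
qed

text \<open>On the eigenspace \<open>A - w\<close> acts as the scalar \<open>lam - w\<close>. On its
  complement the gap of half-width \<open>2 * r\<close> leaves at least
  \<open>2 * r - k \<ge> k\<close> with \<open>k = cmod (of_real lam - w) \<le> r\<close>; this is
  where the two radii \<open>r\<close> and \<open>2 * r\<close> interact. The two images are
  orthogonal.\<close>

lemma isolated_lower_bound:
  assumes u: "u \<in> D" and "0 < r" and E0: "E ({lam - 2 * r<..<lam + 2 * r} - {lam}) u = 0"
    and w: "cmod (of_real lam - w) \<le> r"
  shows "cmod (of_real lam - w) * norm u \<le> norm (A u - w *\<^sub>C u)"
proof -
  define k where "k = cmod (of_real lam - w)"
  define p where "p = E {lam} u"
  define s where "s = u - p"
  have pD: "p \<in> D" "A p = of_real lam *\<^sub>C p" using A_eigen[of lam p] by (auto simp: p_def E_idem)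
  have Ep: "E {lam} p = p" by (simp add: p_def E_idem)
  have sE: "s = E (- {lam}) u" by (simp add: s_def p_def E_compl)
  have sD: "s \<in> D" using u pD by (simp add: s_def D_diff)
  have "E {lam - 2 * r<..<lam + 2 * r} s = 0"
    using E0 by (simp add: sE E_Int Diff_eq)
  then have low: "2 * r * norm s \<le> norm (A s - of_real lam *\<^sub>C s)"
    using norm_A_lower[OF sD, of "2 * r" lam] \<open>0 < r\<close> by simp
  have eq: "A s - of_real lam *\<^sub>C s = (A s - w *\<^sub>C s) - (of_real lam - w) *\<^sub>C s"
    by (simp add: complex_vector.scale_left_diff_distrib)
  have "norm (A s - of_real lam *\<^sub>C s) \<le> norm (A s - w *\<^sub>C s) + k * norm s"
    using norm_triangle_ineq4[of "A s - w *\<^sub>C s" "(of_real lam - w) *\<^sub>C s"]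
    unfolding eq norm_scaleC k_def .
  moreover have "k * norm s \<le> r * norm s" using w by (intro mult_right_mono) (auto simp: k_def)
  ultimately have ls: "k * norm s \<le> norm (A s - w *\<^sub>C s)" using low by linarith
  have lp: "norm (A p - w *\<^sub>C p) = k * norm p"
    by (simp add: pD norm_scaleC k_def flip: complex_vector.scale_left_diff_distrib)
  have "E {lam} (A p - w *\<^sub>C p) = A p - w *\<^sub>C p" by (simp add: pD(2) E_diff E_scale Ep)
  moreover have "E {lam} (A s - w *\<^sub>C s) = 0"
    using A_E_commute[of "{lam}" s] sD E_disjoint[of "{lam}" "- {lam}" u] A_scale[OF D_zero, of 0]
    by (simp add: E_diff E_scale sE[symmetric])
  ultimately have "cinner (A p - w *\<^sub>C p) (A s - w *\<^sub>C s) = 0"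
    by (metis E_sym cinner_zero_right borel_singleton sets.empty_sets)
  moreover have "A u - w *\<^sub>C u = (A p - w *\<^sub>C p) + (A s - w *\<^sub>C s)"
    using A_add[OF pD(1) sD] complex_vector.scale_right_distrib[of w p s] by (simp add: s_def)
  ultimately have "(norm (A u - w *\<^sub>C u))\<^sup>2 = (norm (A p - w *\<^sub>C p))\<^sup>2 + (norm (A s - w *\<^sub>C s))\<^sup>2"
    using norm_add_orthogonal by simp
  moreover have "(norm u)\<^sup>2 = (norm p)\<^sup>2 + (norm s)\<^sup>2"
    using orth_proj_pythagoras[OF E_proj, of "{lam}" u] by (simp add: p_def s_def)
  moreover have "(k * norm s)\<^sup>2 \<le> (norm (A s - w *\<^sub>C s))\<^sup>2"
    using ls by (intro power_mono) (auto simp: k_def)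
  ultimately have "(k * norm u)\<^sup>2 \<le> (norm (A u - w *\<^sub>C u))\<^sup>2"
    by (simp add: lp power_mult_distrib distrib_left)
  then show ?thesis unfolding k_def by (rule power2_le_imp_le) simp
qed

end

section \<open>Galerkin approximation\<close>

context semibounded_op
begin

definition shifted_form :: "complex \<Rightarrow> 'h \<Rightarrow> 'h \<Rightarrow> complex" where
  "shifted_form z u v = form E u v - z * cinner u v"

lemma shifted_form_eq: "shifted_form z u v = form_inner D A E u v - (z - of_real (m - 1)) * cinner u v"
  by (simp add: shifted_form_def form_inner_def m_def algebra_simps)

lemma shifted_form_diff_left:
  "u \<in> form_dom E \<Longrightarrow> v \<in> form_dom E \<Longrightarrow> w \<in> form_dom E \<Longrightarrow>
    shifted_form z (u - v) w = shifted_form z u w - shifted_form z v w"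
  by (simp add: shifted_form_eq fi.diff_left cinner_diff_left algebra_simps)

lemma shifted_form_diff_right:
  "u \<in> form_dom E \<Longrightarrow> v \<in> form_dom E \<Longrightarrow> w \<in> form_dom E \<Longrightarrow>
    shifted_form z w (u - v) = shifted_form z w u - shifted_form z w v"
  by (simp add: shifted_form_eq fi.diff_right cinner_diff_right algebra_simps)

lemma shifted_form_bounded:
  assumes uv: "u \<in> form_dom E" "v \<in> form_dom E" and K: "cmod (z - of_real (m - 1)) \<le> K"
  shows "cmod (shifted_form z u v) \<le> (1 + K) * (na u * na v)"
proof -
  have K0: "0 \<le> K" using K norm_ge_zero order_trans by blast
  have "cmod (shifted_form z u v)
      \<le> cmod (form_inner D A E u v) + cmod (z - of_real (m - 1)) * cmod (cinner u v)"
    unfolding shifted_form_eq by (metis norm_triangle_ineq4 norm_mult)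
  also have "\<dots> \<le> na u * na v + K * (na u * na v)"
  proof (intro add_mono mult_mono na_cauchy_schwarz uv K K0 norm_ge_zero)
    have "cmod (cinner u v) \<le> norm u * norm v" by (rule cinner_cauchy_schwarz)
    also have "\<dots> \<le> na u * na v" by (intro mult_mono norm_le_na na_nonneg uv norm_ge_zero)
    finally show "cmod (cinner u v) \<le> na u * na v" .
  qed
  finally show ?thesis by (simp add: algebra_simps)
qed

text \<open>The imaginary part of the form is \<open>- Im z * (norm u)\<^sup>2\<close>, which
  controls the norm because \<open>Im z \<ge> 1 / 2\<close>. The form norm follows, since the
  shifted form differs from the form inner product by a multiple of the inner product with factor at
  most \<open>K\<close>.\<close>

lemma shifted_form_coercive:
  assumes u: "u \<in> form_dom E" and y: "1 / 2 \<le> Im z" and K: "cmod (z - of_real (m - 1)) \<le> K"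
  shows "(na u)\<^sup>2 \<le> (1 + 2 * K) * cmod (shifted_form z u u)"
proof -
  define X where "X = cmod (shifted_form z u u)"
  have K0: "0 \<le> K" using K norm_ge_zero order_trans by blast
  have "Im (shifted_form z u u) = - (Im z * (norm u)\<^sup>2)"
    using u by (simp add: shifted_form_def form_self cinner_self)
  then have "Im z * (norm u)\<^sup>2 \<le> X" using abs_Im_le_cmod[of "shifted_form z u u"] by (simp add: X_def)
  moreover have "1 / 2 * (norm u)\<^sup>2 \<le> Im z * (norm u)\<^sup>2" using y by (intro mult_right_mono) auto
  ultimately have n: "(norm u)\<^sup>2 \<le> 2 * X" by linarith
  have "form_inner D A E u u = shifted_form z u u + (z - of_real (m - 1)) * of_real ((norm u)\<^sup>2)"
    by (simp add: shifted_form_eq cinner_self)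
  then have "(na u)\<^sup>2 \<le> cmod (shifted_form z u u + (z - of_real (m - 1)) * of_real ((norm u)\<^sup>2))"
    using complex_Re_le_cmod u by (metis na_sq)
  also have "\<dots> \<le> X + cmod (z - of_real (m - 1)) * (norm u)\<^sup>2"
    unfolding X_def by (rule norm_triangle_mono) (simp_all add: norm_mult norm_power)
  also have "\<dots> \<le> X + K * (2 * X)" using K K0 n by (intro add_mono mult_mono) auto
  finally show ?thesis by (simp add: X_def algebra_simps)
qed

lemma shifted_form_R:
  "Im z \<noteq> 0 \<Longrightarrow> v \<in> form_dom E \<Longrightarrow> shifted_form z (R z h) v = cinner h v"
  using R_eq[of z h] R_in_D[of z h]
  by (metis shifted_form_def form_eq_cinner cinner_diff_left cinner_scaleC_left)

lemma na_R_le: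
  assumes y: "1 / 2 \<le> Im z" and K: "cmod (z - of_real (m - 1)) \<le> K"
  shows "na (R z h) \<le> (2 + 4 * K) * norm h"
proof -
  have K0: "0 \<le> K" using K norm_ge_zero order_trans by blast
  have y': "Im z \<noteq> 0" using y by auto
  have "1 / \<bar>Im z\<bar> \<le> 2" using y by (simp add: divide_le_eq)
  moreover have "1 / (Im z)\<^sup>2 \<le> 4"
    using power_mono[of "1/2" "Im z" 2] y y' by (simp add: divide_le_eq power2_eq_square)
  then have "cmod (z - of_real (m - 1)) * (1 / (Im z)\<^sup>2) \<le> K * 4"
    using K K0 by (intro mult_mono) auto
  ultimately have "1 / \<bar>Im z\<bar> + cmod (z - of_real (m - 1)) / (Im z)\<^sup>2 \<le> 2 + 4 * K" by simp
  then have "(na (R z h))\<^sup>2 \<le> (2 + 4 * K) * (norm h)\<^sup>2"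
    using order_trans[OF na_R[OF y', of h]] by (simp add: mult_right_mono)
  also have "\<dots> \<le> (2 + 4 * K)\<^sup>2 * (norm h)\<^sup>2"
    using K0 by (intro mult_right_mono self_le_power) auto
  finally have "(na (R z h))\<^sup>2 \<le> ((2 + 4 * K) * norm h)\<^sup>2" by (simp add: power_mult_distrib)
  then show ?thesis by (rule power2_le_imp_le) (use K0 in simp)
qed

text \<open>Turns errors relative to \<open>na q\<close> into errors relative to
  \<open>norm q\<close>. The summand 1 keeps the factor at least 1, so that its square dominates
  \<open>b - m + 1\<close>.\<close>

lemma na_spectral_subspace_le:
  assumes "E {a..b} q = q"
  shows "na q \<le> (\<bar>b - m + 1\<bar> + 1) * norm q"
proof (rule power2_le_imp_le)
  have qD: "q \<in> D" using E_Icc_in_D[of a b q] assms by simp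
  have "E {b<..} (E {a..b} q) = 0" by (rule E_disjoint) auto
  then have "(\<integral>x. x \<partial>\<mu> q) \<le> b * (norm q)\<^sup>2"
    using assms qD by (intro integral_le integrable_of_D) auto
  then have "(na q)\<^sup>2 \<le> (b - m + 1) * (norm q)\<^sup>2"
    using qD by (simp add: na_sq D_form_dom form_inner_self algebra_simps)
  also have "\<dots> \<le> (\<bar>b - m + 1\<bar> + 1)\<^sup>2 * (norm q)\<^sup>2"
  proof (rule mult_right_mono)
    have "b - m + 1 \<le> \<bar>b - m + 1\<bar> + 1" by simp
    also have "\<dots> \<le> (\<bar>b - m + 1\<bar> + 1)\<^sup>2" by (rule self_le_power) auto
    finally show "b - m + 1 \<le> (\<bar>b - m + 1\<bar> + 1)\<^sup>2" .
  qed simp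
  finally show "(na q)\<^sup>2 \<le> ((\<bar>b - m + 1\<bar> + 1) * norm q)\<^sup>2" by (simp add: power_mult_distrib)
qed simp

text \<open>Both vectors solve the same weak equation with right-hand side
  \<open>- (\<i> *\<^sub>C P u)\<close>: \<open>u\<close> against the test vectors in
  \<open>L\<close>, and \<open>g\<close> against all of the form domain.\<close>

lemma galerkin_orthogonal:
  assumes z: "Im z \<noteq> 0" and L: "L \<subseteq> form_dom E"
    and u: "u \<in> L" and v: "v \<in> L"
    and eig: "\<And>v. v \<in> L \<Longrightarrow> form E u v + \<i> * cinner (P u) v = z * cinner u v"
    and g: "g = R z (- (\<i> *\<^sub>C P u))"
  shows "shifted_form z (u - g) v = 0"
proof -
  have *: "u \<in> form_dom E" "v \<in> form_dom E" "g \<in> form_dom E"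
    using u v L D_form_dom[OF R_in_D[OF z]] by (auto simp: g)
  have "shifted_form z u v = - \<i> * cinner (P u) v"
    using eig[OF v] by (simp add: shifted_form_def algebra_simps)
  moreover have "shifted_form z g v = - \<i> * cinner (P u) v"
    unfolding g using z * by (simp add: shifted_form_R cinner_minus_left cinner_scaleC_left)
  ultimately show ?thesis using * by (simp add: shifted_form_diff_left)
qed

text \<open>Since \<open>w - u\<close> lies in \<open>L\<close>, orthogonality replaces the second
  argument \<open>u - g\<close> of the form by \<open>w - g\<close>. The factors
  \<open>1 + 2 * K\<close> and \<open>1 + K\<close> are the coercivity and the continuity
  constant.\<close>

lemma cea:
  assumes y: "1 / 2 \<le> Im z" and K: "cmod (z - of_real (m - 1)) \<le> K"
    and L: "L \<subseteq> form_dom E" "complex_vector.subspace L" and u: "u \<in> L" and w: "w \<in> L"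
    and g: "g \<in> form_dom E"
    and orth: "\<And>v. v \<in> L \<Longrightarrow> shifted_form z (u - g) v = 0"
  shows "na (u - g) \<le> (1 + 2 * K) * (1 + K) * na (w - g)"
proof -
  have K0: "0 \<le> K" using K norm_ge_zero order_trans by blast
  have d: "u - g \<in> form_dom E" "w - g \<in> form_dom E" "u - w \<in> form_dom E" "u - w \<in> L"
    using u w g L complex_vector.subspace_diff[OF L(2)] by (auto intro!: fi.V_diff)
  have "u - g = (w - g) - (w - u)" by simp
  moreover have "shifted_form z (u - g) ((w - g) - (w - u)) = shifted_form z (u - g) (w - g)"
    using d orth[of "w - u"] u w L fi.V_diff complex_vector.subspace_diff[OF L(2)]
    by (subst shifted_form_diff_right) auto
  ultimately have "shifted_form z (u - g) (u - g) = shifted_form z (u - g) (w - g)" by simp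
  then have "(na (u - g))\<^sup>2 \<le> (1 + 2 * K) * cmod (shifted_form z (u - g) (w - g))"
    using shifted_form_coercive[OF d(1) y K] by simp
  also have "\<dots> \<le> (1 + 2 * K) * ((1 + K) * (na (u - g) * na (w - g)))"
    using K0 by (intro mult_left_mono shifted_form_bounded d K) auto
  finally have "na (u - g) * na (u - g) \<le> na (u - g) * ((1 + 2 * K) * (1 + K) * na (w - g))"
    by (simp add: power2_eq_square algebra_simps)
  moreover have "0 \<le> na (u - g)" "0 \<le> na (w - g)" using na_nonneg d by auto
  ultimately show ?thesis using K0
    by (cases "na (u - g) = 0") (auto simp: mult_le_cancel_left)
qed

text \<open>\<open>C1\<close> is the constant of Cea's lemma, \<open>Cr\<close> bounds the resolvent
  into the form norm, \<open>C2\<close> and \<open>C3\<close> bound \<open>f\<close> and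
  \<open>u - g\<close>, and \<open>C4\<close> bounds the residual of \<open>q\<close>. The number
  \<open>z\<close> is fixed, but the constants see it only through \<open>K\<close> and
  \<open>Cs\<close>, which allows them to be chosen uniformly on the disc.\<close>

lemma galerkin_eigenvalue:
  fixes K Cs \<epsilon> \<epsilon>' \<eta> a b :: real and z :: complex
  defines "C1 \<equiv> (1 + 2 * K) * (1 + K)" and "Cr \<equiv> 2 + 4 * K"
  defines "C2 \<equiv> 2 * (Cs + 1) * C1 * Cr + 4 * Cs"
  defines "C3 \<equiv> C2 + C1 * Cr"
  defines "C4 \<equiv> (1 + K) * C3 * (\<bar>b - m + 1\<bar> + 1) + 1 + C2"
  assumes y: "1 / 2 \<le> Im z" and K: "cmod (z - of_real (m - 1)) \<le> K"
    and L: "L \<subseteq> form_dom E" "complex_vector.subspace L" and P: "orth_proj P"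
    and u: "u \<in> L" "norm u = 1"
    and eig: "\<And>v. v \<in> L \<Longrightarrow> form E u v + \<i> * cinner (P u) v = z * cinner u v"
    and Cs: "0 \<le> Cs" "\<And>f. f \<in> D \<Longrightarrow> E {a..b} f = 0 \<Longrightarrow>
      norm f \<le> Cs * norm (E (- {a..b}) (A f - z *\<^sub>C f + \<i> *\<^sub>C P f))"
    and \<epsilon>: "0 \<le> \<epsilon>" "\<And>q. E {a..b} q = q \<Longrightarrow> norm (q - P q) \<le> \<epsilon> * norm q"
    and \<epsilon>': "0 \<le> \<epsilon>'" "\<And>q. E {a..b} q = q \<Longrightarrow> \<exists>v\<in>L. na (q - v) \<le> \<epsilon>' * na q"
    and \<eta>: "0 \<le> \<eta>" "\<And>h. \<exists>v\<in>L. na (R z (P h) - v) \<le> \<eta> * norm h" "(Cs + 1) * C1 * \<eta> \<le> 1 / 2"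
  shows "norm (u - E {a..b} u) \<le> C2 * (\<epsilon> + \<epsilon>')"
    and "norm (A (E {a..b} u) - (z - \<i>) *\<^sub>C E {a..b} u) \<le> C4 * (\<epsilon> + \<epsilon>')\<^sup>2"
proof -
  define Q where "Q = E {a..b}"
  define q where "q = Q u"
  define f where "f = u - q"
  define g where "g = R z (- (\<i> *\<^sub>C P u))"
  define p where "p = u - g"
  define \<delta> where "\<delta> = \<epsilon> + \<epsilon>'"
  have K0: "0 \<le> K" using K norm_ge_zero order_trans by blast
  have C1: "1 \<le> C1" unfolding C1_def using K0 by (simp add: algebra_simps)
  have Cr: "0 \<le> Cr" using K0 by (simp add: Cr_def)
  have C2: "0 \<le> C2" using Cs C1 Cr by (simp add: C2_def)
  have C3: "0 \<le> C3" using C1 C2 Cr by (simp add: C3_def)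
  have z0: "Im z \<noteq> 0" using y by auto
  have Qp: "orth_proj Q" by (simp add: Q_def E_proj)
  have Q_D: "Q x \<in> D" for x unfolding Q_def by (rule E_Icc_in_D)
  have QQ: "Q (Q x) = Q x" for x using orth_proj_idem[OF Qp] .
  have Qa: "\<And>x y. Q (x + y) = Q x + Q y" "\<And>x y. Q (x - y) = Q x - Q y" "\<And>c x. Q (c *\<^sub>C x) = c *\<^sub>C Q x"
    using orth_proj_add[OF Qp] orth_proj_diff[OF Qp] orth_proj_scale[OF Qp] by auto
  have Pa: "\<And>x y. P (x + y) = P x + P y" "\<And>x y. P (x - y) = P x - P y" "\<And>c x. P (c *\<^sub>C x) = c *\<^sub>C P x"
    using orth_proj_add[OF P] orth_proj_diff[OF P] orth_proj_scale[OF P] by auto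
  have q1: "norm q \<le> 1" using orth_proj_norm_le[OF Qp, of u] u by (simp add: q_def)
  have gD: "g \<in> D" unfolding g_def by (rule R_in_D[OF z0])
  have ufd: "u \<in> form_dom E" using u L by auto
  have gfd: "g \<in> form_dom E" and pfd: "p \<in> form_dom E"
    using gD D_form_dom ufd fi.V_diff by (auto simp: p_def)
  have orth: "shifted_form z p v = 0" if "v \<in> L" for v
    unfolding p_def by (rule galerkin_orthogonal[where P = P, OF z0 L(1) u(1) that eig g_def])

  \<comment> \<open>Only two of the three parts of \<open>g\<close> are approximated from
    \<open>L\<close>. The part \<open>R z q\<close> stays in the range of \<open>Q\<close>, as the
    resolvent commutes with spectral projections, so \<open>\<epsilon>'\<close> applies to it; the
    part from \<open>q - P q\<close> is itself of size \<open>\<epsilon>\<close> and is left as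
    error.\<close>
  obtain v1 where v1: "v1 \<in> L" "na (R z (P f) - v1) \<le> \<eta> * norm f" using \<eta>(2) by blast
  have QRq: "Q (R z q) = R z q" using R_E[OF z0, of "{a..b}" q] by (simp add: Q_def q_def E_idem)
  obtain v2 where v2: "v2 \<in> L" "na (R z q - v2) \<le> \<epsilon>' * na (R z q)"
    using \<epsilon>'(2)[of "R z q"] QRq by (auto simp: Q_def)
  define w where "w = (- \<i>) *\<^sub>C (v1 + v2)"
  have wL: "w \<in> L" unfolding w_def
    using v1 v2 complex_vector.subspace_add[OF L(2)] complex_vector.subspace_scale[OF L(2)] by blast
  have "P u = P f + q - (q - P q)"
    using Pa(2)[of u q] by (simp add: f_def)
  then have "g = (- \<i>) *\<^sub>C (R z (P f) + R z q - R z (q - P q))"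
    unfolding g_def by (simp add: R_scale[OF z0, symmetric] R_add[OF z0, symmetric] R_diff[OF z0, symmetric])
  then have wg: "w - g = \<i> *\<^sub>C (((R z (P f) - v1) + (R z q - v2)) - R z (q - P q))"
    by (simp add: w_def complex_vector.scale_right_distrib complex_vector.scale_right_diff_distrib)
  have fd: "R z x \<in> form_dom E" "v \<in> L \<Longrightarrow> v \<in> form_dom E" for x v
    using D_form_dom[OF R_in_D[OF z0]] L by auto
  note fdi = fi.V_diff fi.V_add fd(1) fd(2)[OF v1(1)] fd(2)[OF v2(1)]
  have "na (w - g) = na (((R z (P f) - v1) + (R z q - v2)) - R z (q - P q))"
    unfolding wg by (subst na_scale) (auto intro!: fdi)
  also have "\<dots> \<le> na ((R z (P f) - v1) + (R z q - v2)) + na (R z (q - P q))"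
    by (intro na_diff_le fdi)
  also have "\<dots> \<le> (na (R z (P f) - v1) + na (R z q - v2)) + na (R z (q - P q))"
    by (intro add_right_mono na_triangle fdi)
  also have "\<dots> \<le> (\<eta> * norm f + \<epsilon>' * Cr) + Cr * \<epsilon>"
  proof (intro add_mono v1(2))
    have "na (R z q) \<le> Cr * norm q" unfolding Cr_def by (rule na_R_le[OF y K])
    also have "\<dots> \<le> Cr" using q1 Cr by (simp add: mult_left_le)
    finally show "na (R z q - v2) \<le> \<epsilon>' * Cr"
      using v2(2) \<epsilon>'(1) mult_left_mono order_trans by blast
    have "norm (q - P q) \<le> \<epsilon> * norm q" using \<epsilon>(2)[of q] by (simp add: q_def Q_def E_idem)
    also have "\<dots> \<le> \<epsilon>" using q1 \<epsilon>(1) by (simp add: mult_left_le)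
    finally have "Cr * norm (q - P q) \<le> Cr * \<epsilon>" using Cr by (simp add: mult_left_mono)
    then show "na (R z (q - P q)) \<le> Cr * \<epsilon>"
      using na_R_le[OF y K, of "q - P q"] unfolding Cr_def by linarith
  qed
  finally have "na (w - g) \<le> \<eta> * norm f + Cr * \<delta>" by (simp add: \<delta>_def algebra_simps)
  then have "C1 * na (w - g) \<le> C1 * (\<eta> * norm f + Cr * \<delta>)" using C1 by simp
  moreover have "na p \<le> C1 * na (w - g)"
    unfolding p_def C1_def by (rule cea[OF y K L u(1) wL gfd]) (use orth p_def in simp)
  ultimately have nap: "na p \<le> C1 * (\<eta> * norm f + Cr * \<delta>)" by linarith
  have np: "norm p \<le> na p" by (rule norm_le_na[OF pfd])

  have "norm (P u) \<le> 1" using orth_proj_norm_le[OF P, of u] u by simp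
  then have "\<bar>Im z\<bar> * norm g \<le> 1"
    using R_norm[OF z0, of "- (\<i> *\<^sub>C P u)"] by (simp add: g_def norm_scaleC)
  moreover have "1 / 2 * norm g \<le> \<bar>Im z\<bar> * norm g" using y by (intro mult_right_mono) auto
  ultimately have g2: "norm g \<le> 2" by linarith
  have geq: "A g - z *\<^sub>C g = - (\<i> *\<^sub>C P u)" unfolding g_def by (rule R_eq[OF z0])
  have pu: "P u = P g + P p" using Pa(1)[of g p] by (simp add: p_def)
  \<comment> \<open>The stability bound applies to vectors of \<open>D\<close> annihilated by
    \<open>Q\<close>, hence to this component of \<open>g\<close>. Because \<open>u = g + p\<close>,
    it differs from \<open>f\<close> only by \<open>p - Q p\<close>.\<close>
  define g' where "g' = g - Q g"
  have g'D: "g' \<in> D" using gD Q_D D_diff by (simp add: g'_def)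
  have Qg': "Q g' = 0" by (simp add: g'_def Qa QQ)
  let ?T = "\<lambda>x. A x - z *\<^sub>C x + \<i> *\<^sub>C P x"
  have Tg: "?T g = - (\<i> *\<^sub>C P p)"
    unfolding geq pu by (simp add: complex_vector.scale_right_distrib)
  \<comment> \<open>\<open>A\<close> preserves the range of \<open>Q\<close>, so \<open>Q g\<close>
    is coupled to the kernel of \<open>Q\<close> by \<open>P\<close> alone. The coupling equals
    minus the kernel component of \<open>Q g - P (Q g)\<close> and is therefore of order
    \<open>\<epsilon>\<close>.\<close>
  have TQg: "?T (Q g) - Q (?T (Q g)) = \<i> *\<^sub>C (P (Q g) - Q (P (Q g)))"
  proof -
    have "Q (A (Q g)) = A (Q g)" using A_E_range[of "{a..b}" g] gD by (simp add: Q_def)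
    then show ?thesis by (simp add: Qa QQ complex_vector.scale_right_diff_distrib)
  qed
  have "?T g' = ?T g - ?T (Q g)"
    unfolding g'_def using gD Q_D
    by (simp add: A_diff Pa complex_vector.scale_right_diff_distrib)
  then have "?T g' - Q (?T g') = (?T g - Q (?T g)) - (?T (Q g) - Q (?T (Q g)))"
    by (simp only: Qa) (simp only: diff_diff_eq2 diff_add_eq add_diff_eq diff_diff_eq add.commute add.left_commute)
  moreover have "E (- {a..b}) x = x - Q x" for x by (simp add: Q_def E_compl)
  ultimately have Tg': "E (- {a..b}) (?T g') = (- (\<i> *\<^sub>C P p) - Q (- (\<i> *\<^sub>C P p))) - \<i> *\<^sub>C (P (Q g) - Q (P (Q g)))"
    by (simp only: TQg Tg)
  have "norm (E (- {a..b}) (?T g'))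
      \<le> norm (- (\<i> *\<^sub>C P p) - Q (- (\<i> *\<^sub>C P p))) + norm (\<i> *\<^sub>C (P (Q g) - Q (P (Q g))))"
    unfolding Tg' by (rule norm_triangle_ineq4)
  also have "\<dots> \<le> norm p + 2 * \<epsilon>"
  proof (rule add_mono)
    have "norm (- (\<i> *\<^sub>C P p) - Q (- (\<i> *\<^sub>C P p))) \<le> norm (- (\<i> *\<^sub>C P p))"
      by (rule orth_proj_compl_norm_le[OF Qp])
    also have "\<dots> \<le> norm p" using orth_proj_norm_le[OF P] by (simp add: norm_scaleC)
    finally show "norm (- (\<i> *\<^sub>C P p) - Q (- (\<i> *\<^sub>C P p))) \<le> norm p" .
    have "P (Q g) - Q (P (Q g)) = - ((Q g - P (Q g)) - Q (Q g - P (Q g)))"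
      by (simp add: Qa QQ)
    then have "norm (P (Q g) - Q (P (Q g))) \<le> norm (Q g - P (Q g))"
      using orth_proj_compl_norm_le[OF Qp, of "Q g - P (Q g)"] by (simp only: norm_minus_cancel)
    also have "\<dots> \<le> \<epsilon> * norm (Q g)" using \<epsilon>(2)[of "Q g"] QQ by (simp add: Q_def)
    also have "\<dots> \<le> \<epsilon> * 2"
      using orth_proj_norm_le[OF Qp, of g] g2 \<epsilon>(1) by (intro mult_left_mono) auto
    finally show "norm (\<i> *\<^sub>C (P (Q g) - Q (P (Q g)))) \<le> 2 * \<epsilon>" by (simp add: norm_scaleC)
  qed
  finally have "Cs * norm (E (- {a..b}) (?T g')) \<le> Cs * (norm p + 2 * \<epsilon>)"
    using Cs(1) by (rule mult_left_mono)
  then have ng': "norm g' \<le> Cs * (norm p + 2 * \<epsilon>)"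
    using Cs(2)[OF g'D] Qg' by (simp add: Q_def)
  have "f = g' + (p - Q p)" by (simp add: f_def g'_def p_def q_def Qa)
  then have "norm f \<le> norm g' + norm p"
    using norm_triangle_ineq[of g' "p - Q p"] orth_proj_compl_norm_le[OF Qp, of p] by simp
  then have "norm f \<le> (Cs + 1) * na p + 2 * Cs * \<epsilon>"
    using ng' np mult_left_mono[OF np Cs(1)] by (simp add: algebra_simps)
  also have "\<dots> \<le> (Cs + 1) * (C1 * (\<eta> * norm f + Cr * \<delta>)) + 2 * Cs * \<delta>"
    using nap Cs(1) \<epsilon>(1) \<epsilon>'(1) by (intro add_mono mult_left_mono) (auto simp: \<delta>_def)
  also have "\<dots> = ((Cs + 1) * C1 * \<eta>) * norm f + ((Cs + 1) * C1 * Cr + 2 * Cs) * \<delta>"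
    by (simp add: algebra_simps)
  \<comment> \<open>Half of \<open>norm f\<close> can be moved to the left; this doubling explains
    the factors in \<open>C2\<close>.\<close>
  also have "\<dots> \<le> 1 / 2 * norm f + ((Cs + 1) * C1 * Cr + 2 * Cs) * \<delta>"
    using mult_right_mono[OF \<eta>(3), of "norm f"] by simp
  finally have nf: "norm f \<le> C2 * \<delta>" by (simp add: C2_def algebra_simps)
  then show "norm (u - E {a..b} u) \<le> C2 * (\<epsilon> + \<epsilon>')" by (simp add: f_def q_def Q_def \<delta>_def)

  have \<delta>0: "0 \<le> \<delta>" using \<epsilon> \<epsilon>' by (simp add: \<delta>_def)
  \<comment> \<open>Now that \<open>norm f\<close> is known to be of order \<open>\<delta>\<close>,
    the remaining \<open>\<eta>\<close>-term in the bound for \<open>p\<close> is absorbed as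
    well.\<close>
  have "C1 * \<eta> \<le> (Cs + 1) * (C1 * \<eta>)" using Cs(1) C1 \<eta>(1) by (simp add: distrib_right)
  then have "C1 * \<eta> \<le> 1" using \<eta>(3) by (simp add: mult.assoc)
  then have "C1 * \<eta> * norm f \<le> C2 * \<delta>"
    using nf mult_right_mono[of "C1 * \<eta>" 1 "norm f"] by simp
  then have nap': "na p \<le> C3 * \<delta>" using nap by (simp add: C3_def algebra_simps)
  have bound: "cmod (cinner (A q - (z - \<i>) *\<^sub>C q) w) \<le> C4 * \<delta>\<^sup>2 * norm w" if w: "Q w = w" for w
  proof -
    have wD: "w \<in> D" "q \<in> D" using Q_D[of w] Q_D[of u] w by (auto simp: q_def)
    have wfd: "w \<in> form_dom E" using wD D_form_dom by blast
    have QAw: "Q (A w) = A w" using A_E_commute[of "{a..b}" w] wD w by (simp add: Q_def)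
    \<comment> \<open>Tested against the range of \<open>Q\<close>, the Galerkin vector may be
      replaced by its projection \<open>q\<close>, to which \<open>A\<close> can be applied.\<close>
    have uq: "cinner u x = cinner q x" if "Q x = x" for x
      using orth_proj_sym[OF Qp, of u x] that by (simp add: q_def)
    have "shifted_form z u w = cinner q (A w) - z * cinner q w"
      using form_eq_cinner_right[OF ufd wD(1)] uq[OF QAw] uq[OF w] by (simp add: shifted_form_def)
    also have "\<dots> = cinner (A q - z *\<^sub>C q) w"
      using A_sym[OF wD(2,1)] by (simp add: cinner_diff_left cinner_scaleC_left)
    finally have e1: "cinner (A q - z *\<^sub>C q) w = shifted_form z u w" ..
    have e2: "shifted_form z u w = shifted_form z p w - \<i> * cinner (P u) w"
      using shifted_form_diff_left[OF ufd gfd wfd, of z] shifted_form_R[OF z0 wfd, of "- (\<i> *\<^sub>C P u)"]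
      by (simp add: p_def g_def cinner_minus_left cinner_scaleC_left)
    have e3: "cinner (P u) w = cinner q w - cinner (u - P u) (w - P w)"
    proof -
      have "cinner (u - P u) (w - P w) = cinner q w - cinner (P u) w"
        by (simp only: orth_proj_cinner_compl[OF P] cinner_diff_left[of u] uq[OF w])
      then show ?thesis by simp
    qed
    have "cinner (A q - (z - \<i>) *\<^sub>C q) w = cinner (A q - z *\<^sub>C q) w + \<i> * cinner q w"
      by (simp add: cinner_diff_left cinner_add_left cinner_scaleC_left algebra_simps)
    also have "\<dots> = shifted_form z p w + \<i> * cinner (u - P u) (w - P w)"
      unfolding e1 e2 e3 by (simp add: algebra_simps)
    finally have "cmod (cinner (A q - (z - \<i>) *\<^sub>C q) w)
        \<le> cmod (shifted_form z p w) + cmod (cinner (u - P u) (w - P w))"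
      using norm_triangle_ineq[of "shifted_form z p w" "\<i> * cinner (u - P u) (w - P w)"]
      by (simp add: norm_mult)
    moreover have "cmod (shifted_form z p w) \<le> (1 + K) * C3 * (\<bar>b - m + 1\<bar> + 1) * \<delta>\<^sup>2 * norm w"
    proof -
      obtain v where v: "v \<in> L" "na (w - v) \<le> \<epsilon>' * na w" using \<epsilon>'(2)[of w] w by (auto simp: Q_def)
      have "shifted_form z p w = shifted_form z p (w - v)"
        using orth[OF v(1)] shifted_form_diff_right[OF wfd fd(2)[OF v(1)] pfd] by simp
      also have "cmod \<dots> \<le> (1 + K) * (na p * na (w - v))"
        by (intro shifted_form_bounded pfd fi.V_diff wfd fd(2)[OF v(1)] K)
      also have "\<dots> \<le> (1 + K) * ((C3 * \<delta>) * (\<delta> * ((\<bar>b - m + 1\<bar> + 1) * norm w)))"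
      proof (intro mult_left_mono mult_mono nap')
        have "na (w - v) \<le> \<epsilon>' * ((\<bar>b - m + 1\<bar> + 1) * norm w)"
          using v(2) mult_left_mono[OF na_spectral_subspace_le[of a b w] \<epsilon>'(1)] w by (simp add: Q_def)
        also have "\<dots> \<le> \<delta> * ((\<bar>b - m + 1\<bar> + 1) * norm w)"
          using \<epsilon>(1) by (intro mult_right_mono) (auto simp: \<delta>_def)
        finally show "na (w - v) \<le> \<delta> * ((\<bar>b - m + 1\<bar> + 1) * norm w)" .
        show "0 \<le> na (w - v)" by (intro na_nonneg fi.V_diff wfd fd(2)[OF v(1)])
      qed (use C3 \<delta>0 K0 in auto)
      finally show ?thesis by (simp add: power2_eq_square mult_ac)
    qed
    moreover have "cmod (cinner (u - P u) (w - P w)) \<le> (1 + C2) * \<delta>\<^sup>2 * norm w"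
    proof -
      have \<epsilon>\<delta>: "\<epsilon> \<le> \<delta>" using \<epsilon>'(1) by (simp add: \<delta>_def)
      have "u - P u = (q - P q) + (f - P f)" using Pa(2)[of u q] by (simp add: f_def)
      then have "norm (u - P u) \<le> norm (q - P q) + norm (f - P f)" using norm_triangle_ineq by metis
      also have "\<dots> \<le> \<epsilon> * norm q + norm f"
        using \<epsilon>(2)[of q] orth_proj_compl_norm_le[OF P] by (intro add_mono) (simp_all add: q_def Q_def E_idem)
      also have "\<dots> \<le> \<delta> + C2 * \<delta>"
        using \<epsilon>\<delta> \<epsilon>(1) nf mult_left_le[OF q1 \<epsilon>(1)] by linarith
      finally have "norm (u - P u) \<le> (1 + C2) * \<delta>" by (simp add: algebra_simps)
      moreover have "norm (w - P w) \<le> \<delta> * norm w"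
        using \<epsilon>(2)[of w] w mult_right_mono[OF \<epsilon>\<delta>, of "norm w"] by (simp add: Q_def)
      ultimately have "norm (u - P u) * norm (w - P w) \<le> ((1 + C2) * \<delta>) * (\<delta> * norm w)"
        using C2 \<delta>0 by (intro mult_mono) auto
      then show ?thesis
        using cinner_cauchy_schwarz[of "u - P u" "w - P w"] by (simp add: power2_eq_square mult_ac)
    qed
    ultimately show ?thesis by (simp add: C4_def algebra_simps)
  qed
  define w where "w = A q - (z - \<i>) *\<^sub>C q"
  \<comment> \<open>The residual is itself an admissible test vector, and testing it against itself
    gives its norm.\<close>
  have "Q w = w"
    using A_E_commute[of "{a..b}" q] Q_D[of u] QQ by (simp add: w_def q_def Qa) (simp add: Q_def)
  then have "norm w * norm w \<le> C4 * \<delta>\<^sup>2 * norm w"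
    using bound[of w] cinner_self[of w] by (simp add: w_def[symmetric] power2_eq_square norm_mult)
  moreover have "0 \<le> C4 * \<delta>\<^sup>2" using C2 C3 K0 by (simp add: C4_def)
  ultimately have "norm w \<le> C4 * \<delta>\<^sup>2"
    by (cases "w = 0") (auto simp: mult_le_cancel_right)
  then show "norm (A (E {a..b} u) - (z - \<i>) *\<^sub>C E {a..b} u) \<le> C4 * (\<epsilon> + \<epsilon>')\<^sup>2"
    by (simp add: w_def q_def Q_def \<delta>_def)
qed

end

section \<open>Uniform approximation of resolvents on finite-dimensional spaces\<close>

text \<open>Gram-Schmidt. With unit vectors \<open>e\<close> the coefficients satisfy
  \<open>cmod (cinner x e) \<le> norm x\<close>, so that approximating finitely many images gives a
  uniform approximation on bounded sets.\<close>

lemma orthonormal_span_finite: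
  fixes B :: "'h::complex_hilbert set"
  assumes "finite B"
  shows "\<exists>C. finite C \<and> (\<forall>e\<in>C. norm e = 1) \<and>
    (\<forall>x\<in>complex_vector.span B. x = (\<Sum>e\<in>C. cinner x e *\<^sub>C e))"
proof -
  define ortho :: "'h set \<Rightarrow> bool" where "ortho C \<longleftrightarrow> finite C \<and> (\<forall>e\<in>C. norm e = 1) \<and>
    (\<forall>e\<in>C. \<forall>e'\<in>C. e \<noteq> e' \<longrightarrow> cinner e e' = 0)" for C
  have sum_delta: "(\<Sum>e'\<in>C. cinner e e' *\<^sub>C e') = e" if "ortho C" "e \<in> C" for C e
  proof -
    have "(\<Sum>e'\<in>C. cinner e e' *\<^sub>C e') = (\<Sum>e'\<in>C. if e' = e then e else 0)"
      using that by (intro sum.cong) (auto simp: ortho_def cinner_self)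
    then show ?thesis using that by (simp add: ortho_def)
  qed
  have expand: "x = (\<Sum>e\<in>C. cinner x e *\<^sub>C e)" if C: "ortho C" and x: "x \<in> complex_vector.span C" for C x
  proof -
    define V where "V = {x. x = (\<Sum>e\<in>C. cinner x e *\<^sub>C e)}"
    have "complex_vector.subspace V"
    proof (rule complex_vector.subspaceI)
      fix x y assume "x \<in> V" "y \<in> V"
      moreover have "(\<Sum>e\<in>C. cinner (x + y) e *\<^sub>C e)
          = (\<Sum>e\<in>C. cinner x e *\<^sub>C e) + (\<Sum>e\<in>C. cinner y e *\<^sub>C e)"
        by (simp add: cinner_add_left complex_vector.scale_left_distrib sum.distrib)
      ultimately show "x + y \<in> V" by (simp add: V_def)
    next
      fix c x assume "x \<in> V"
      moreover have "(\<Sum>e\<in>C. cinner (c *\<^sub>C x) e *\<^sub>C e) = c *\<^sub>C (\<Sum>e\<in>C. cinner x e *\<^sub>C e)"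
        by (simp add: cinner_scaleC_left complex_vector.scale_sum_right)
      ultimately show "c *\<^sub>C x \<in> V" by (simp add: V_def)
    qed (simp add: V_def)
    moreover have "C \<subseteq> V"
    proof
      fix e assume e: "e \<in> C"
      show "e \<in> V" using sum_delta[OF C e] by (simp add: V_def)
    qed
    ultimately show ?thesis using complex_vector.span_minimal x by (auto simp: V_def)
  qed
  have "\<exists>C. ortho C \<and> B \<subseteq> complex_vector.span C"
    using assms
  proof (induction B rule: finite_induct)
    case empty
    show ?case by (rule exI[of _ "{}"]) (simp add: ortho_def)
  next
    case (insert b B)
    then obtain C where C: "ortho C" "B \<subseteq> complex_vector.span C" by blast
    define p where "p = (\<Sum>e\<in>C. cinner b e *\<^sub>C e)"
    define d where "d = b - p"
    have pC: "p \<in> complex_vector.span C"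
      unfolding p_def
      by (intro complex_vector.span_sum complex_vector.span_scale complex_vector.span_base)
    have dC: "cinner d e = 0" if e: "e \<in> C" for e
    proof -
      have "cinner p e = (\<Sum>e'\<in>C. if e' = e then cinner b e else 0)"
        unfolding p_def cinner_sum_left cinner_scaleC_left
        using C(1) e by (intro sum.cong) (auto simp: ortho_def cinner_self)
      then show ?thesis using C(1) e by (simp add: ortho_def d_def cinner_diff_left)
    qed
    show ?case
    proof (cases "d = 0")
      case True
      then have "b \<in> complex_vector.span C" using pC by (simp add: d_def)
      then show ?thesis using C by blast
    next
      case False
      define e0 where "e0 = of_real (1 / norm d) *\<^sub>C d"
      have "norm e0 = 1" using False by (simp add: e0_def norm_scaleC norm_divide)
      have e0C: "cinner e0 e = 0" "cinner e e0 = 0" if "e \<in> C" for e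
        using dC[OF that] cinner_commute[of e e0] by (simp_all add: e0_def cinner_scaleC_left)
      have "d = of_real (norm d) *\<^sub>C e0" using False by (simp add: e0_def)
      then have "b = p + of_real (norm d) *\<^sub>C e0" by (simp add: d_def)
      moreover have "p \<in> complex_vector.span (insert e0 C)"
        using pC complex_vector.span_mono[of C "insert e0 C"] by blast
      then have "p + of_real (norm d) *\<^sub>C e0 \<in> complex_vector.span (insert e0 C)"
        by (rule complex_vector.span_add[OF _ complex_vector.span_scale[OF complex_vector.span_base]]) simp
      ultimately have "b \<in> complex_vector.span (insert e0 C)" by metis
      moreover have "B \<subseteq> complex_vector.span (insert e0 C)"
        using C(2) complex_vector.span_mono[of C "insert e0 C"] by blast
      moreover have "ortho (insert e0 C)" using C(1) e0C \<open>norm e0 = 1\<close> by (simp add: ortho_def)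
      ultimately show ?thesis by (intro exI[of _ "insert e0 C"]) simp
    qed
  qed
  then obtain C where C: "ortho C" "B \<subseteq> complex_vector.span C" by blast
  then have "complex_vector.span B \<subseteq> complex_vector.span C"
    by (metis complex_vector.span_minimal complex_vector.subspace_span)
  then show ?thesis using C(1) expand[OF C(1)] by (intro exI[of _ C]) (auto simp: ortho_def)
qed

context semibounded_op
begin

lemma R_resolvent_identity:
  assumes "Im z \<noteq> 0" "Im w \<noteq> 0"
  shows "R z h - R w h = (z - w) *\<^sub>C R z (R w h)"
proof -
  have "R z (h + (w - z) *\<^sub>C R w h) = R w h"
  proof (rule R_unique[OF assms(1) R_in_D[OF assms(2)]])
    have "A (R w h) = h + w *\<^sub>C R w h" using R_eq[OF assms(2), of h] by (simp add: diff_eq_eq)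
    then show "A (R w h) - z *\<^sub>C R w h = h + (w - z) *\<^sub>C R w h"
      by (simp add: complex_vector.scale_left_diff_distrib)
  qed
  then have "R w h = R z h + (w - z) *\<^sub>C R z (R w h)"
    by (simp add: R_add R_scale assms)
  then show ?thesis
    by (metis (no_types, lifting) add_diff_cancel_left' complex_vector.scale_minus_left
        minus_diff_eq)
qed

text \<open>Uniformity in \<open>h\<close> comes from a finite orthonormal system whose span
  contains the range of \<open>P\<close>, and uniformity in \<open>z\<close> from a finite net of
  the compact set \<open>S\<close>. Density is used only for the finitely many vectors
  \<open>R w e\<close>; the resolvent identity carries the approximation to nearby
  \<open>z\<close>.\<close>

lemma R_finite_rank_approximation:
  fixes L :: "nat \<Rightarrow> 'h set"
  assumes S: "compact S" "\<And>z. z \<in> S \<Longrightarrow> 1 / 2 \<le> Im z" "\<And>z. z \<in> S \<Longrightarrow> cmod (z - of_real (m - 1)) \<le> K"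
    and L: "\<And>k. L k \<subseteq> form_dom E" "\<And>k. complex_vector.subspace (L k)"
    and dens: "\<And>u. u \<in> form_dom E \<Longrightarrow> \<exists>w. (\<forall>n. w n \<in> L n) \<and> (\<lambda>n. na (u - w n)) \<longlonglongrightarrow> 0"
    and P: "orth_proj P" "finite_dim (range P)" and "0 < \<eta>"
  shows "\<forall>\<^sub>F k in sequentially. \<forall>z\<in>S. \<forall>h. \<exists>v\<in>L k. na (R z (P h) - v) \<le> \<eta> * norm h"
proof -
  obtain B where B: "finite B" "range P \<subseteq> complex_vector.span B"
    using P(2) by (auto simp: finite_dim_def)
  obtain C where C: "finite C" "\<And>e. e \<in> C \<Longrightarrow> norm e = 1"
      "\<And>x. x \<in> complex_vector.span B \<Longrightarrow> x = (\<Sum>e\<in>C. cinner x e *\<^sub>C e)"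
    using orthonormal_span_finite[OF B(1)] by blast
  \<comment> \<open>Each of the \<open>card C\<close> terms will contribute at most
    \<open>2 * \<theta> * norm h\<close>; the summand 1 avoids division by zero for empty
    \<open>C\<close>.\<close>
  define \<theta> where "\<theta> = \<eta> / (2 * (real (card C) + 1))"
  have \<theta>: "0 < \<theta>" using \<open>0 < \<eta>\<close> by (simp add: \<theta>_def)
  \<comment> \<open>Bounds \<open>na (R z (R w e))\<close>: the factor 2 comes from
    \<open>R w\<close> and the other one from \<open>R z\<close>. The modulus of \<open>K\<close>
    keeps \<open>M\<close> positive even for empty \<open>S\<close>.\<close>
  define M where "M = 2 * (2 + 4 * \<bar>K\<bar>)"
  have M: "0 < M" by (simp add: M_def add_pos_nonneg)
  obtain T where T: "finite T" "T \<subseteq> S" "S \<subseteq> (\<Union>x\<in>T. ball x (\<theta> / M))"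
    using seq_compact_imp_totally_bounded[OF compact_imp_seq_compact[OF S(1)]] \<theta> M
    by (meson divide_pos_pos)
  have fd: "Im z \<noteq> 0 \<Longrightarrow> R z x \<in> form_dom E" for z x by (intro D_form_dom R_in_D)
  have S0: "Im z \<noteq> 0" if "z \<in> S" for z using S(2)[OF that] by auto
  have "\<forall>\<^sub>F k in sequentially. \<exists>v\<in>L k. na (R w e - v) < \<theta>" if "w \<in> T" "e \<in> C" for w e
  proof -
    have "R w e \<in> form_dom E" using that T(2) S0 fd by blast
    then obtain v where v: "\<And>n. v n \<in> L n" "(\<lambda>n. na (R w e - v n)) \<longlonglongrightarrow> 0" using dens by blast
    show ?thesis using order_tendstoD(2)[OF v(2) \<theta>] by eventually_elim (use v(1) in blast)
  qed
  then have "\<forall>\<^sub>F k in sequentially. \<forall>w\<in>T. \<forall>e\<in>C. \<exists>v\<in>L k. na (R w e - v) < \<theta>"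
    using T(1) C(1) by (simp add: eventually_ball_finite)
  then show ?thesis
  proof eventually_elim
    case (elim k)
    show ?case
    proof (intro ballI allI)
      fix z h assume z: "z \<in> S"
      then obtain w where w: "w \<in> T" "dist w z < \<theta> / M" using T(3) by auto
      have wz: "Im z \<noteq> 0" "Im w \<noteq> 0" "w \<in> S" using z w T(2) S0 by auto
      have "\<forall>e\<in>C. \<exists>v. v \<in> L k \<and> na (R w e - v) < \<theta>" using elim w by blast
      then obtain v where v: "\<And>e. e \<in> C \<Longrightarrow> v e \<in> L k" "\<And>e. e \<in> C \<Longrightarrow> na (R w e - v e) < \<theta>"
        by metis
      have near: "na (R z e - v e) \<le> 2 * \<theta>" if e: "e \<in> C" for e
      proof -
        have "na (R z e - R w e) = cmod (z - w) * na (R z (R w e))"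
          unfolding R_resolvent_identity[OF wz(1,2)] by (rule na_scale[OF fd[OF wz(1)]])
        also have "\<dots> \<le> (\<theta> / M) * M"
        proof (rule mult_mono)
          show "cmod (z - w) \<le> \<theta> / M" using w(2) by (simp add: dist_norm norm_minus_commute)
          have "\<bar>Im w\<bar> * norm (R w e) \<le> 1" using R_norm[OF wz(2), of e] C(2)[OF e] by simp
          moreover have "1 / 2 * norm (R w e) \<le> \<bar>Im w\<bar> * norm (R w e)"
            using S(2)[OF wz(3)] by (intro mult_right_mono) auto
          ultimately have "norm (R w e) \<le> 2" by linarith
          moreover have "na (R z (R w e)) \<le> (2 + 4 * K) * norm (R w e)"
            by (rule na_R_le[OF S(2)[OF z] S(3)[OF z]])
          moreover have "(2 + 4 * K) * norm (R w e) \<le> (2 + 4 * \<bar>K\<bar>) * norm (R w e)"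
            by (intro mult_right_mono) auto
          moreover have "(2 + 4 * \<bar>K\<bar>) * norm (R w e) \<le> (2 + 4 * \<bar>K\<bar>) * 2"
            using \<open>norm (R w e) \<le> 2\<close> by (intro mult_left_mono) auto
          ultimately show "na (R z (R w e)) \<le> M" by (simp add: M_def)
        qed (use \<theta> M in \<open>auto intro!: na_nonneg fd wz\<close>)
        finally have "na (R z e - R w e) \<le> \<theta>" using M by simp
        moreover have "na ((R z e - R w e) + (R w e - v e)) \<le> na (R z e - R w e) + na (R w e - v e)"
          using v(1)[OF e] L(1) by (intro na_triangle fi.V_diff fd wz) auto
        ultimately show ?thesis using v(2)[OF e] by simp
      qed
      define x where "x = P h"
      have "x \<in> complex_vector.span B" using B(2) by (auto simp: x_def)
      then have x: "x = (\<Sum>e\<in>C. cinner x e *\<^sub>C e)" by (rule C(3))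
      have xn: "norm x \<le> norm h" unfolding x_def by (rule orth_proj_norm_le[OF P(1)])
      define v0 where "v0 = (\<Sum>e\<in>C. cinner x e *\<^sub>C v e)"
      have ve: "v e \<in> form_dom E" if "e \<in> C" for e using v(1)[OF that] L(1) by blast
      have "R z x = (\<Sum>e\<in>C. cinner x e *\<^sub>C R z e)"
        by (subst x) (simp add: R_sum R_scale wz)
      then have "R z x - v0 = (\<Sum>e\<in>C. cinner x e *\<^sub>C (R z e - v e))"
        by (simp add: v0_def complex_vector.scale_right_diff_distrib sum_subtractf)
      then have "na (R z x - v0) \<le> (\<Sum>e\<in>C. na (cinner x e *\<^sub>C (R z e - v e)))"
        using na_triangle_sum[of C "\<lambda>e. cinner x e *\<^sub>C (R z e - v e)"] C(1) ve fd[OF wz(1)]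
        by (simp add: fi.V_scale fi.V_diff)
      also have "\<dots> \<le> (\<Sum>e\<in>C. norm h * (2 * \<theta>))"
      proof (rule sum_mono)
        fix e assume e: "e \<in> C"
        have "na (cinner x e *\<^sub>C (R z e - v e)) = cmod (cinner x e) * na (R z e - v e)"
          by (intro na_scale fi.V_diff fd wz ve e)
        also have "\<dots> \<le> norm h * (2 * \<theta>)"
        proof (intro mult_mono near e)
          show "cmod (cinner x e) \<le> norm h"
            using cinner_cauchy_schwarz[of x e] C(2)[OF e] xn by simp
          show "0 \<le> na (R z e - v e)" by (intro na_nonneg fi.V_diff fd wz ve e)
        qed simp
        finally show "na (cinner x e *\<^sub>C (R z e - v e)) \<le> norm h * (2 * \<theta>)" .
      qed
      also have "\<dots> = (real (card C) * (2 * \<theta>)) * norm h" by simp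
      also have "\<dots> \<le> \<eta> * norm h"
      proof (rule mult_right_mono)
        have "real (card C) * (2 * \<theta>) \<le> (real (card C) + 1) * (2 * \<theta>)" using \<theta> by (intro mult_right_mono) auto
        also have "\<dots> = \<eta>" by (simp add: \<theta>_def field_simps)
        finally show "real (card C) * (2 * \<theta>) \<le> \<eta>" .
      qed simp
      finally have "na (R z (P h) - v0) \<le> \<eta> * norm h" by (simp add: x_def)
      moreover have "v0 \<in> L k" unfolding v0_def
        by (intro complex_vector.subspace_sum[OF L(2)] complex_vector.subspace_scale[OF L(2)] v(1))
      ultimately show "\<exists>v\<in>L k. na (R z (P h) - v) \<le> \<eta> * norm h" by blast
    qed
  qed
qed

end

section \<open>Gaps\<close>

text \<open>A real supremum needs an upper bound: the choice \<open>v = 0\<close> bounds every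
  distance by 1.\<close>

lemma gap_upper:
  assumes nrm: "\<And>x. 0 \<le> nrm (x :: 'h::complex_hilbert)" and L: "0 \<in> L" and u: "u \<in> M" "nrm u = 1"
  shows "(INF v\<in>L. nrm (u - v)) \<le> gap nrm M L"
  unfolding gap_def
proof (rule cSUP_upper)
  show "bdd_above ((\<lambda>u. INF v\<in>L. nrm (u - v)) ` {u \<in> M. nrm u = 1})"
  proof (rule bdd_aboveI2[where M = 1])
    fix x assume "x \<in> {u \<in> M. nrm u = 1}"
    then show "(INF v\<in>L. nrm (x - v)) \<le> 1"
      using cINF_lower[of "\<lambda>v. nrm (x - v)" L 0] nrm L by (simp add: bdd_belowI2[where m = 0])
  qed
qed (use u in simp)

lemma gap_norm_bound:
  fixes q :: "'h::complex_hilbert"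
  assumes Q: "orth_proj Q" and P: "orth_proj P" and q: "Q q = q"
  shows "norm (q - P q) \<le> gap norm (range Q) (range P) * norm q"
proof (cases "q = 0")
  case False
  define t where "t = complex_of_real (1 / norm q)"
  define u where "u = t *\<^sub>C q"
  have u: "u \<in> range Q" "norm u = 1"
    using False q by (auto simp: orth_proj_range_iff[OF Q] u_def orth_proj_scale[OF Q] norm_scaleC t_def norm_divide)
  have P0: "0 \<in> range P" using orth_proj_zero[OF P] by (metis rangeI)
  have "norm (u - P u) \<le> (INF v\<in>range P. norm (u - v))"
    using P0 by (intro cINF_greatest) (auto intro: orth_proj_nearest[OF P])
  also have "\<dots> \<le> gap norm (range Q) (range P)" using u P0 by (intro gap_upper) auto
  finally have "norm (t *\<^sub>C (q - P q)) \<le> gap norm (range Q) (range P)"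
    by (simp add: u_def orth_proj_scale[OF P] complex_vector.scale_right_diff_distrib)
  then show ?thesis using False by (simp add: norm_scaleC t_def norm_divide divide_le_eq)
qed (simp add: orth_proj_zero[OF P])

context semibounded_op
begin

text \<open>No nearest point in the form norm is at hand, so the infimum is only approached; hence a
  number strictly above the gap.\<close>

lemma gap_form_norm_bound:
  assumes Q: "orth_proj Q" "range Q \<subseteq> form_dom E"
    and L: "complex_vector.subspace L" "L \<subseteq> form_dom E"
    and q: "Q q = q" and \<epsilon>: "gap na (range Q) L < \<epsilon>"
  shows "\<exists>v\<in>L. na (q - v) \<le> \<epsilon> * na q"
proof -
  have L0: "0 \<in> L" using L(1) by (rule complex_vector.subspace_0)
  have qfd: "q \<in> form_dom E" using Q(2) q by (metis rangeI subsetD)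
  show ?thesis
  proof (cases "q = 0")
    case True
    have "na 0 = 0" using na_scale[OF form_dom_zero, of 0] by simp
    then show ?thesis using True L0 by (intro bexI[of _ 0]) simp_all
  next
    case False
    have naq: "0 < na q" using norm_le_na[OF qfd] False zero_less_norm_iff[of q] by linarith
    define t where "t = complex_of_real (1 / na q)"
    define u where "u = t *\<^sub>C q"
    have u: "u \<in> range Q" "na u = 1"
      using naq q qfd by (auto simp: orth_proj_range_iff[OF Q(1)] u_def orth_proj_scale[OF Q(1)]
          na_scale t_def norm_divide)
    \<comment> \<open>Nonnegativity of the form norm is available on the form domain only. Its
      modulus is nonnegative everywhere and has the same gap, because all vectors involved lie in
      that domain.\<close>
    define nrm where "nrm x = \<bar>na x\<bar>" for x
    have nrm_eq: "nrm x = na x" if "x \<in> form_dom E" for x using na_nonneg[OF that] by (simp add: nrm_def)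
    have ufd: "u \<in> form_dom E" using u Q(2) by blast
    have inf_eq: "(INF v\<in>L. nrm (x - v)) = (INF v\<in>L. na (x - v))" if "x \<in> range Q" for x
      using that L(2) Q(2) by (intro INF_cong refl nrm_eq fi.V_diff) auto
    have set_eq: "{u \<in> range Q. nrm u = 1} = {u \<in> range Q. na u = 1}" using nrm_eq Q(2) by auto
    have "gap nrm (range Q) L = gap na (range Q) L"
      unfolding gap_def set_eq by (rule SUP_cong) (auto simp: inf_eq)
    then have "(INF v\<in>L. nrm (u - v)) < \<epsilon>"
      using gap_upper[of nrm L u "range Q"] u L0 nrm_eq[OF ufd] \<epsilon> by (simp add: nrm_def)
    then obtain v where v: "v \<in> L" "nrm (u - v) < \<epsilon>"
      using L0 by (subst (asm) cINF_less_iff) (auto simp: nrm_def intro!: bdd_belowI2[where m = 0])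
    have vfd: "v \<in> form_dom E" using v L(2) by blast
    have "q - of_real (na q) *\<^sub>C v = of_real (na q) *\<^sub>C (u - v)"
      using naq by (simp add: u_def t_def complex_vector.scale_right_diff_distrib)
    then have "na (q - of_real (na q) *\<^sub>C v) = na q * na (u - v)"
      using naq na_scale[OF fi.V_diff[OF ufd vfd]] by simp
    also have "\<dots> \<le> na q * \<epsilon>"
      using v(2) nrm_eq[OF fi.V_diff[OF ufd vfd]] naq by (intro mult_left_mono) auto
    finally have "na (q - of_real (na q) *\<^sub>C v) \<le> \<epsilon> * na q" by (simp add: mult.commute)
    moreover have "of_real (na q) *\<^sub>C v \<in> L" using v complex_vector.subspace_scale[OF L(1)] by blast
    ultimately show ?thesis by blast
  qed
qed

text \<open>The nonzero vector \<open>q\<close> ensures that the supremum is not taken over the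
  empty set. If the gap were negative, half of it would be strictly larger and still negative, and
  would bound a form norm from above.\<close>

lemma gap_form_norm_nonneg:
  assumes Q: "orth_proj Q" "range Q \<subseteq> form_dom E" "q \<noteq> 0" "Q q = q"
    and L: "complex_vector.subspace L" "L \<subseteq> form_dom E"
  shows "0 \<le> gap na (range Q) L"
proof (rule ccontr)
  assume "\<not> 0 \<le> gap na (range Q) L"
  then have "gap na (range Q) L < gap na (range Q) L / 2" "gap na (range Q) L / 2 < 0" by auto
  then obtain v where v: "v \<in> L" "na (q - v) \<le> gap na (range Q) L / 2 * na q"
    using gap_form_norm_bound[OF Q(1,2) L Q(4)] by blast
  have qfd: "q \<in> form_dom E" using Q by (metis rangeI subsetD)
  have "0 < na q" using norm_le_na[OF qfd] Q(3) zero_less_norm_iff[of q] by linarith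
  then have "gap na (range Q) L / 2 * na q < 0" by (rule mult_neg_pos[OF \<open>gap na (range Q) L / 2 < 0\<close>])
  moreover have "0 \<le> na (q - v)" using v L(2) qfd by (intro na_nonneg fi.V_diff) auto
  ultimately show False using v(2) by linarith
qed

end

section \<open>The enclosing curve\<close>

text \<open>Both branches of the definition parametrise the zero set of one polynomial: it is solved
  for the imaginary part if \<open>b - a \<le> 1\<close> and for the real part otherwise. The sign
  \<open>s\<close> selects the root.\<close>

lemma Gamma01_memI:
  assumes "Re z \<in> {a..b}" "Im z \<in> {0..1}" and 0: "(Re z - a) * (b - Re z) = Im z * (1 - Im z)"
  shows "z \<in> Gamma01 a b"
proof (cases "b - a \<le> 1")
  case True
  define s :: real where "s = (if Im z \<ge> 1 / 2 then 1 else - 1)"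
  have "1 / 4 + (Re z - a) * (Re z - b) = (Im z - 1 / 2)\<^sup>2"
    using 0 by (simp add: power2_eq_square algebra_simps)
  then have "Im z = 1 / 2 + s * sqrt (1 / 4 + (Re z - a) * (Re z - b))"
    by (simp add: s_def abs_if)
  then have "z = Complex (Re z) (1 / 2 + s * sqrt (1 / 4 + (Re z - a) * (Re z - b)))"
    by (simp add: complex_eq_iff)
  moreover have "s \<in> {1, -1}" by (simp add: s_def)
  ultimately show ?thesis unfolding Gamma01_def using True assms(1) by auto
next
  case False
  define s :: real where "s = (if Re z \<ge> (a + b) / 2 then 1 else - 1)"
  have "((b - a) / 2)\<^sup>2 + Im z * (Im z - 1) = (Re z - (a + b) / 2)\<^sup>2"
    using 0 by (simp add: power2_eq_square field_simps)
  then have "Re z = (a + b) / 2 + s * sqrt (((b - a) / 2)\<^sup>2 + Im z * (Im z - 1))"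
    by (simp add: s_def abs_if)
  then have "z = Complex ((a + b) / 2 + s * sqrt (((b - a) / 2)\<^sup>2 + Im z * (Im z - 1))) (Im z)"
    by (simp add: complex_eq_iff)
  moreover have "s \<in> {1, -1}" by (simp add: s_def)
  ultimately show ?thesis unfolding Gamma01_def using False assms(2) by auto
qed

text \<open>The polynomial is positive at \<open>Re z + \<i>\<close>. If it were not positive at
  some \<open>z\<close> below, it would vanish in between, at a point that is no farther from the
  centre than \<open>z\<close> and lies on the curve.\<close>

lemma Gamma01_disjoint_positive:
  fixes a b lam r :: real
  assumes "lam \<in> {a..b}" "0 < r" "r < 1 / 2"
    and disj: "cball (complex_of_real lam + \<i>) (2 * r) \<inter> Gamma01 a b = {}"
    and z: "z \<in> cball (complex_of_real lam + \<i>) (2 * r)"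
  shows "0 < (Re z - a) * (b - Re z) - Im z * (1 - Im z)"
proof -
  have in_ball: "Complex x y \<in> cball (complex_of_real lam + \<i>) (2 * r)"
    if "(x - lam)\<^sup>2 + (y - 1)\<^sup>2 \<le> (2 * r)\<^sup>2" for x y
    using real_le_lsqrt[OF _ that] \<open>0 < r\<close>
    by (simp add: dist_norm cmod_def power2_commute[of lam] power2_commute[of 1])
  have "sqrt ((Re z - lam)\<^sup>2 + (Im z - 1)\<^sup>2) \<le> 2 * r"
    using z by (simp add: dist_norm cmod_def power2_commute[of lam] power2_commute[of 1])
  then have zz: "(Re z - lam)\<^sup>2 + (Im z - 1)\<^sup>2 \<le> (2 * r)\<^sup>2" by (rule sqrt_le_D)
  have not_G: False if "(x - lam)\<^sup>2 + (y - 1)\<^sup>2 \<le> (2 * r)\<^sup>2" "x \<in> {a..b}" "y \<in> {0..1}"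
      "(x - a) * (b - x) = y * (1 - y)" for x y
    using in_ball[OF that(1)] Gamma01_memI[of "Complex x y" a b] that disj by auto
  \<comment> \<open>The points \<open>a + \<i>\<close> and \<open>b + \<i>\<close> lie on the curve,
    so the disc cannot reach them and stays strictly between the vertical lines through
    \<open>a\<close> and \<open>b\<close>.\<close>
  have "2 * r < \<bar>c - lam\<bar>" if "c \<in> {a, b}" for c
  proof (rule ccontr)
    assume "\<not> 2 * r < \<bar>c - lam\<bar>"
    then have "(c - lam)\<^sup>2 \<le> (2 * r)\<^sup>2"
      using \<open>0 < r\<close> abs_le_square_iff[of "c - lam" "2 * r"] by simp
    then show False using not_G[of c 1] that assms(1) by auto
  qed
  then have ab: "2 * r < lam - a" "2 * r < b - lam" using assms(1) by force+
  have "(Re z - lam)\<^sup>2 \<le> (2 * r)\<^sup>2" "(Im z - 1)\<^sup>2 \<le> (2 * r)\<^sup>2"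
    using zz zero_le_power2[of "Re z - lam"] zero_le_power2[of "Im z - 1"] by linarith+
  then have "\<bar>Re z - lam\<bar> \<le> 2 * r" "\<bar>Im z - 1\<bar> \<le> 2 * r"
    using \<open>0 < r\<close> unfolding abs_le_square_iff[symmetric] by simp_all
  then have x: "a < Re z" "Re z < b" and y: "0 < Im z" using ab \<open>r < 1 / 2\<close> by linarith+
  have pos: "0 < (Re z - a) * (b - Re z)" using x by simp
  show ?thesis
  proof (cases "1 \<le> Im z")
    case True
    then have "Im z * (1 - Im z) \<le> 0" using y by (simp add: mult_nonneg_nonpos)
    then show ?thesis using pos by linarith
  next
    case False
    show ?thesis
    proof (rule ccontr)
      let ?G = "\<lambda>y. (Re z - a) * (b - Re z) - y * (1 - y)"
      assume "\<not> 0 < ?G (Im z)"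
      then have "\<exists>y. Im z \<le> y \<and> y \<le> 1 \<and> ?G y = 0"
        using False pos by (intro IVT) auto
      then obtain y' where y': "Im z \<le> y'" "y' \<le> 1" "?G y' = 0" by blast
      have "(y' - 1)\<^sup>2 \<le> (Im z - 1)\<^sup>2"
        using y' by (simp flip: abs_le_square_iff)
      then show False using not_G[of "Re z" y'] zz y' x y by auto
    qed
  qed
qed

section \<open>Eigenvalues of the approximations\<close>

lemma dim_pos_imp_nonzero:
  fixes V :: "'h::complex_hilbert set"
  assumes "0 < complex_vector.dim V"
  shows "\<exists>x\<in>V. x \<noteq> 0"
proof (rule ccontr)
  assume "\<not> ?thesis"
  then have "V \<subseteq> complex_vector.span {}" by auto
  then have "complex_vector.dim V = 0"
    by (intro complex_vector.dim_unique[of "{}"]) (simp_all add: complex_vector.independent_empty)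
  then show False using assms by simp
qed

text \<open>Finite-dimensionality matters here, because \<open>card\<close> assigns 0 to an infinite
  basis.\<close>

lemma dim_pos:
  fixes V :: "'h::complex_hilbert set"
  assumes "finite_dim V" "x \<in> V" "x \<noteq> 0"
  shows "0 < complex_vector.dim V"
proof -
  obtain C where C: "finite C" "V \<subseteq> complex_vector.span C" using assms(1) by (auto simp: finite_dim_def)
  obtain B where B: "B \<subseteq> V" "complex_vector.independent B" "V \<subseteq> complex_vector.span B"
      "card B = complex_vector.dim V"
    by (rule complex_vector.basis_exists)
  have "finite B"
    using complex_vector.independent_span_bound[OF C(1) B(2)] B(1) C(2) by blast
  moreover have "B \<noteq> {}" using B(3) assms by auto
  ultimately show ?thesis using B(4) by (metis card_gt_0_iff)
qed

text \<open>The last nonzero iterate of \<open>T - z\<close> on a generalised eigenvector is an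
  eigenvector; invariance keeps the iterates in \<open>X\<close>.\<close>

lemma alg_mult_pos_eigenvector:
  fixes X :: "'h::complex_hilbert set"
  assumes "0 < alg_mult X T z" and X: "\<And>v. v \<in> X \<Longrightarrow> T v - z *\<^sub>C v \<in> X"
  shows "\<exists>u\<in>X. u \<noteq> 0 \<and> T u = z *\<^sub>C u"
proof -
  let ?S = "\<lambda>v. T v - z *\<^sub>C v"
  obtain x where x: "x \<in> X" "x \<noteq> 0" "\<exists>p. (?S ^^ p) x = 0"
    using dim_pos_imp_nonzero[OF assms(1)[unfolded alg_mult_def]] by auto
  define p where "p = (LEAST p. (?S ^^ p) x = 0)"
  have p: "(?S ^^ p) x = 0" unfolding p_def using x(3) by (rule LeastI_ex)
  then obtain n where n: "p = Suc n" using x(2) by (cases p) auto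
  have "(?S ^^ n) x \<noteq> 0" using not_less_Least[of n "\<lambda>p. (?S ^^ p) x = 0"] n by (simp add: p_def)
  moreover have "(?S ^^ n) x \<in> X" by (induction n) (simp_all add: x X)
  moreover have "?S ((?S ^^ n) x) = 0" using p by (simp add: n)
  ultimately show ?thesis by auto
qed

lemma repeated_eigenvalues_alg_mult:
  assumes "repeated_eigenvalues X T S \<kappa> \<mu>" "j \<in> {1..\<kappa>}"
  shows "\<mu> j \<in> S" "0 < alg_mult X T (\<mu> j)"
proof -
  have "card {i \<in> {1..\<kappa>}. \<mu> i = \<mu> j} = (if \<mu> j \<in> S then alg_mult X T (\<mu> j) else 0)"
    using assms(1) by (simp add: repeated_eigenvalues_def)
  moreover have "0 < card {i \<in> {1..\<kappa>}. \<mu> i = \<mu> j}"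
    using assms(2) by (auto simp: card_gt_0_iff)
  ultimately show "\<mu> j \<in> S" "0 < alg_mult X T (\<mu> j)" by (auto split: if_splits)
qed

context semibounded_op
begin

text \<open>The part of \<open>u\<close> off \<open>{lam}\<close> again satisfies the eigenvalue
  equation but lives outside an interval around \<open>lam\<close>, which the lower bound for
  \<open>A - lam\<close> there excludes unless it is zero.\<close>

lemma isolated_eigenspace:
  assumes u: "u \<in> D" "A u = of_real lam *\<^sub>C u" and "0 < r"
    and E0: "E ({lam - r<..<lam + r} - {lam}) u = 0"
  shows "E {lam} u = u"
proof -
  define s where "s = E (- {lam}) u"
  have s: "s \<in> D" "A s = of_real lam *\<^sub>C s"
    using u by (simp_all add: s_def E_in_D A_E_commute E_scale)
  have "E {lam - r<..<lam + r} s = 0"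
    using E0 by (simp add: s_def E_Int Diff_eq)
  then have "r * norm s \<le> 0" using norm_A_lower[OF s(1) \<open>0 < r\<close>, of lam] s(2) by simp
  then have "s = 0" using \<open>0 < r\<close> by (simp add: mult_le_0_iff)
  then show ?thesis by (simp add: s_def E_compl)
qed

text \<open>Combines the second-order residual bound for \<open>q\<close> with the lower bound at
  the isolated eigenvalue. The two summands of the final constant belong to the two cases below,
  which together cover gaps of any size.\<close>

lemma galerkin_eigenvalue_dist:
  fixes K Cs \<epsilon> \<epsilon>' \<eta> a b lam r :: real and z :: complex
  defines "C1 \<equiv> (1 + 2 * K) * (1 + K)" and "Cr \<equiv> 2 + 4 * K"
  defines "C2 \<equiv> 2 * (Cs + 1) * C1 * Cr + 4 * Cs"
  defines "C3 \<equiv> C2 + C1 * Cr"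
  defines "C4 \<equiv> (1 + K) * C3 * (\<bar>b - m + 1\<bar> + 1) + 1 + C2"
  assumes r: "0 < r" "r < 1 / 2" and z: "z \<in> cball (complex_of_real lam + \<i>) r"
    and E0: "\<And>u. E ({lam - 2 * r<..<lam + 2 * r} - {lam}) u = 0"
    and K: "cmod (z - of_real (m - 1)) \<le> K"
    and L: "L \<subseteq> form_dom E" "complex_vector.subspace L" and P: "orth_proj P"
    and u: "u \<in> L" "u \<noteq> 0"
    and eig: "\<And>v. v \<in> L \<Longrightarrow> form E u v + \<i> * cinner (P u) v = z * cinner u v"
    and Cs: "0 \<le> Cs" "\<And>f. f \<in> D \<Longrightarrow> E {a..b} f = 0 \<Longrightarrow>
      norm f \<le> Cs * norm (E (- {a..b}) (A f - z *\<^sub>C f + \<i> *\<^sub>C P f))"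
    and \<epsilon>: "0 \<le> \<epsilon>" "\<And>q. E {a..b} q = q \<Longrightarrow> norm (q - P q) \<le> \<epsilon> * norm q"
    and \<epsilon>': "0 \<le> \<epsilon>'" "\<And>q. E {a..b} q = q \<Longrightarrow> \<exists>v\<in>L. na (q - v) \<le> \<epsilon>' * na q"
    and \<eta>: "0 \<le> \<eta>" "\<And>h. \<exists>v\<in>L. na (R z (P h) - v) \<le> \<eta> * norm h" "(Cs + 1) * C1 * \<eta> \<le> 1 / 2"
  shows "cmod (z - of_real lam - \<i>) \<le> (2 * C4 + 2 * C2\<^sup>2) * (\<epsilon> + \<epsilon>')\<^sup>2"
proof -
  define t where "t = complex_of_real (1 / norm u)"
  define e where "e = t *\<^sub>C u"
  have e1: "norm e = 1" using u by (simp add: e_def t_def norm_scaleC norm_divide)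
  have eL: "e \<in> L" using u complex_vector.subspace_scale[OF L(2)] by (simp add: e_def)
  have e_eig: "form E e v + \<i> * cinner (P e) v = z * cinner e v" if "v \<in> L" for v
  proof -
    have "form E e v + \<i> * cinner (P e) v = t * (form E u v + \<i> * cinner (P u) v)"
      using L(1) u that
      by (simp add: e_def form_scale_left subsetD orth_proj_scale[OF P] cinner_scaleC_left algebra_simps)
    then show ?thesis unfolding eig[OF that] by (simp add: e_def cinner_scaleC_left)
  qed
  have dz: "cmod (of_real lam - (z - \<i>)) \<le> r" using z by (simp add: dist_norm diff_diff_eq2 add.commute)
  have "\<bar>Im z - 1\<bar> \<le> r" using dz abs_Im_le_cmod[of "of_real lam - (z - \<i>)"] by simp
  then have y: "1 / 2 \<le> Im z" using r by linarith
  define q where "q = E {a..b} e"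
  define d where "d = cmod (of_real lam - (z - \<i>))"
  define \<delta> where "\<delta> = \<epsilon> + \<epsilon>'"
  note facts = y K L P eL e1 e_eig Cs \<epsilon> \<epsilon>' \<eta>[unfolded C1_def]
  have f: "norm (e - q) \<le> C2 * \<delta>"
    unfolding C2_def C1_def Cr_def q_def \<delta>_def
    by (rule galerkin_eigenvalue(1)[where P = P and L = L and u = e and z = z and K = K and Cs = Cs
          and \<epsilon> = \<epsilon> and \<epsilon>' = \<epsilon>' and \<eta> = \<eta> and a = a and b = b]) (fact facts)+
  have w: "norm (A q - (z - \<i>) *\<^sub>C q) \<le> C4 * \<delta>\<^sup>2"
    unfolding C4_def C3_def C2_def C1_def Cr_def q_def \<delta>_def
    by (rule galerkin_eigenvalue(2)[where P = P and L = L and u = e and z = z and K = K and Cs = Cs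
          and \<epsilon> = \<epsilon> and \<epsilon>' = \<epsilon>' and \<eta> = \<eta> and a = a and b = b]) (fact facts)+
  have K0: "0 \<le> K" using K norm_ge_zero order_trans by blast
  have C: "0 \<le> C1" "0 \<le> Cr" using K0 by (simp_all add: C1_def Cr_def)
  then have C2: "0 \<le> C2" using Cs(1) by (simp add: C2_def)
  have C3: "0 \<le> C3" using C C2 by (simp add: C3_def)
  have C4: "0 \<le> C4" using K0 C3 C2 by (simp add: C4_def)
  have "d \<le> (2 * C4 + 2 * C2\<^sup>2) * \<delta>\<^sup>2"
  proof (cases "C2 * \<delta> \<le> 1 / 2")
    \<comment> \<open>Here \<open>f\<close> is so small that \<open>q\<close> keeps at least half of
      the unit norm, and dividing the residual bound by \<open>norm q\<close> costs a factor
      2.\<close>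
    case True
    then have "1 / 2 \<le> norm q" using f e1 norm_triangle_ineq[of q "e - q"] by simp
    then have "d * (1 / 2) \<le> d * norm q" by (intro mult_left_mono) (auto simp: d_def)
    also have "\<dots> \<le> norm (A q - (z - \<i>) *\<^sub>C q)"
      unfolding d_def using E_Icc_in_D r(1) E0 dz by (intro isolated_lower_bound) (auto simp: q_def)
    finally have "d \<le> 2 * C4 * \<delta>\<^sup>2" using w by simp
    moreover have "0 \<le> C2\<^sup>2 * \<delta>\<^sup>2" by simp
    moreover have "(2 * C4 + 2 * C2\<^sup>2) * \<delta>\<^sup>2 = 2 * C4 * \<delta>\<^sup>2 + 2 * (C2\<^sup>2 * \<delta>\<^sup>2)"
      by (simp add: algebra_simps)
    ultimately show ?thesis by linarith
  next
    \<comment> \<open>Here \<open>2 * (C2 * \<delta>)\<^sup>2\<close> already exceeds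
      \<open>1 / 2\<close>, while \<open>d \<le> r < 1 / 2\<close>.\<close>
    case False
    then have "(1 / 2)\<^sup>2 \<le> (C2 * \<delta>)\<^sup>2" by (intro power_mono) auto
    then have "1 / 2 \<le> 2 * (C2\<^sup>2 * \<delta>\<^sup>2)" by (simp add: power2_eq_square mult_ac)
    moreover have "0 \<le> C4 * \<delta>\<^sup>2" using C4 by simp
    moreover have "d \<le> 1 / 2" using dz r by (simp add: d_def)
    ultimately show ?thesis by (simp add: algebra_simps)
  qed
  moreover have "d = cmod (z - of_real lam - \<i>)"
    unfolding d_def by (metis diff_diff_eq diff_diff_eq2 add.commute norm_minus_commute)
  ultimately show ?thesis by (simp add: \<delta>_def)
qed

end

theorem theorem5p3:
  fixes D :: "'h::complex_hilbert set" and A :: "'h \<Rightarrow> 'h"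
    and E :: "real set \<Rightarrow> 'h \<Rightarrow> 'h"
    and a b lam r :: real and \<Lambda> :: "real set" and \<kappa> N :: nat
    and P A' :: "nat \<Rightarrow> 'h \<Rightarrow> 'h"
  assumes "self_adjoint_op D A" and "semibounded_below D A" and "spectral_measure_of E D A"
    and "a < b"
    and "complex_of_real a \<in> resolvent_set D A" and "complex_of_real b \<in> resolvent_set D A"
    and "spectrum D A \<inter> complex_of_real ` {a..b} = complex_of_real ` \<Lambda>"
    and "finite \<Lambda>" and "complex_of_real ` \<Lambda> \<subseteq> discrete_spectrum D A"
    and "lam \<in> \<Lambda>"
    and "\<kappa> = complex_vector.dim (range (E {lam}))"
    and "0 < r" and "r < 1 / 2"
    and "cball (complex_of_real lam + \<i>) (2 * r) \<inter> (\<lambda>z. z + \<i>) ` spectrum D A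
           = {complex_of_real lam + \<i>}"
    and "cball (complex_of_real lam + \<i>) (2 * r) \<inter> Gamma01 a b = {}"
    and "\<And>n. orth_proj (P n)" and "\<And>n. finite_dim (range (P n))"
    and "\<And>n. range (P n) \<subseteq> form_dom E"
    and "\<And>u. u \<in> form_dom E \<Longrightarrow>
           \<exists>w. (\<forall>n. w n \<in> range (P n)) \<and> (\<lambda>n. form_norm D A E (u - w n)) \<longlonglongrightarrow> 0"
    and "\<And>n. n \<ge> N \<Longrightarrow>
           sphere (complex_of_real lam + \<i>) r \<subseteq> resolvent_set D (\<lambda>u. A u + \<i> *\<^sub>C P n u)"
    and "\<And>n. n \<ge> N \<Longrightarrow> complex_vector.dim
           (range (riesz_proj D (\<lambda>u. A u + \<i> *\<^sub>C P n u) (complex_of_real lam + \<i>) r)) = \<kappa>"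
    and "\<And>k u. u \<in> range (P k) \<Longrightarrow> A' k u \<in> range (P k)"
    and "\<And>k u v. u \<in> range (P k) \<Longrightarrow> v \<in> range (P k) \<Longrightarrow> cinner (A' k u) v = form E u v"
  shows "\<exists>c5>0. \<forall>n\<ge>N. \<forall>\<^sub>F k in sequentially. \<forall>\<mu>.
           repeated_eigenvalues (range (P k)) (\<lambda>u. A' k u + \<i> *\<^sub>C P k (P n u))
             (ball (complex_of_real lam + \<i>) r) \<kappa> \<mu> \<longrightarrow>
           (MAX j\<in>{1..\<kappa>}. cmod (\<mu> j - complex_of_real lam - \<i>))
             \<le> c5 * (gap norm (range (E {a..b})) (range (P n))
                     + gap (form_norm D A E) (range (E {a..b})) (range (P k)))\<^sup>2"
proof -
  note P = assms(16) and P_form = assms(18)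
  have "projection_valued_measure E" using assms(3) by (simp add: spectral_measure_of_def)
  moreover have lam_disc: "complex_of_real lam \<in> discrete_spectrum D A" using assms(9,10) by blast
  then have "complex_of_real lam \<in> spectrum D A"
    by (simp add: discrete_spectrum_def isolated_in_def)
  ultimately interpret semibounded_op E D A
    using assms(1-3) by unfold_locales auto
  have "complex_of_real lam \<in> complex_of_real ` {a..b}" using assms(7,10) by blast
  then have lam_ab: "lam \<in> {a..b}" by auto

  have E0: "E ({lam - 2 * r<..<lam + 2 * r} - {lam}) u = 0" for u
  proof (rule E_spectrum_zero)
    show "complex_of_real ` ({lam - 2 * r<..<lam + 2 * r} - {lam}) \<inter> spectrum D A = {}"
    proof (rule ccontr)
      assume "complex_of_real ` ({lam - 2 * r<..<lam + 2 * r} - {lam}) \<inter> spectrum D A \<noteq> {}"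
      then obtain x where "x \<in> {lam - 2 * r<..<lam + 2 * r} - {lam}"
        and spec: "complex_of_real x \<in> spectrum D A"
        by blast
      then have x: "lam - 2 * r < x" "x < lam + 2 * r" "x \<noteq> lam" by auto
      have "dist (complex_of_real lam + \<i>) (complex_of_real x + \<i>) = \<bar>lam - x\<bar>"
        by (simp add: dist_norm flip: of_real_diff)
      then have "complex_of_real x + \<i> \<in> {complex_of_real lam + \<i>}"
        unfolding assms(14)[symmetric] using x spec by auto
      then show False using x(3) by simp
    qed
  qed simp

  \<comment> \<open>This eigenvector shows that \<open>\<kappa>\<close> is positive, so that the
    maximum is over a nonempty set, and provides a nonzero vector in the range of
    \<open>E {a..b}\<close>, which makes both gaps nonnegative.\<close>
  obtain u0 where u0: "u0 \<in> D" "u0 \<noteq> 0" "A u0 = complex_of_real lam *\<^sub>C u0"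
    using lam_disc by (auto simp: discrete_spectrum_def)
  have Eu0: "E {lam} u0 = u0" using isolated_eigenspace[OF u0(1,3), of "2 * r"] assms(12) E0 by simp
  have "range (E {lam}) \<subseteq> {u \<in> D. A u = complex_of_real lam *\<^sub>C u}"
  proof (rule image_subsetI)
    fix x
    have "E {lam} (E {lam} x) = E {lam} x" by (simp add: E_idem)
    then show "E {lam} x \<in> {u \<in> D. A u = complex_of_real lam *\<^sub>C u}" using A_eigen by blast
  qed
  then have "finite_dim (range (E {lam}))"
    using lam_disc unfolding discrete_spectrum_def finite_dim_def by blast
  then have \<kappa>: "1 \<le> \<kappa>"
    using dim_pos[of "range (E {lam})" u0] u0(2) Eu0 assms(11) by (metis One_nat_def Suc_leI rangeI)
  have Qu0: "E {a..b} u0 = u0"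
    using E_Int[of "{a..b}" "{lam}" u0] Eu0 lam_ab by (simp add: insert_absorb Int_absorb1)

  let ?S = "cball (complex_of_real lam + \<i>) r"
  define G where "G z = (Re z - a) * (b - Re z) - Im z * (1 - Im z)" for z
  have S_sub: "?S \<subseteq> cball (complex_of_real lam + \<i>) (2 * r)" using assms(12) by (intro subset_cball) simp
  \<comment> \<open>Compactness turns pointwise positivity of the polynomial into a positive
    minimum, and thus gives a stability constant \<open>Cs\<close> that depends on neither
    \<open>z\<close> nor \<open>n\<close>.\<close>
  have "?S \<noteq> {}" using assms(12) by simp
  moreover have "continuous_on ?S G" unfolding G_def by (intro continuous_intros)
  ultimately obtain z0 where z0: "z0 \<in> ?S" "\<forall>z\<in>?S. G z0 \<le> G z"
    using continuous_attains_inf[OF compact_cball] by blast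
  define c1 where "c1 = min (G z0) (((b - a) / 2)\<^sup>2)"
  have "0 < G z0"
    using Gamma01_disjoint_positive[OF lam_ab assms(12,13,15)] z0(1) S_sub by (auto simp: G_def)
  then have c1: "0 < c1" using assms(4) by (simp add: c1_def)
  define Cs where "Cs = (b - a + 2) / c1"
  have Cs: "0 \<le> Cs" using c1 assms(4) by (simp add: Cs_def)
  have y: "1 / 2 \<le> Im z \<and> Im z \<le> 3 / 2" if "z \<in> ?S" for z
  proof -
    have "\<bar>Im z - 1\<bar> \<le> r"
      using that abs_Im_le_cmod[of "complex_of_real lam + \<i> - z"] by (simp add: dist_norm)
    then show ?thesis using assms(13) by linarith
  qed
  define K where "K = cmod (complex_of_real lam + \<i> - of_real (m - 1)) + r"
  have K: "cmod (z - of_real (m - 1)) \<le> K" if "z \<in> ?S" for z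
  proof -
    have "cmod (z - (complex_of_real lam + \<i>)) \<le> r" using that by (simp add: dist_norm norm_minus_commute)
    then show ?thesis
      using dist_triangle[of z "of_real (m - 1)" "complex_of_real lam + \<i>"]
      unfolding dist_norm K_def by linarith
  qed
  have K0: "0 \<le> K" using assms(12) by (simp add: K_def)

  define C1 where "C1 = (1 + 2 * K) * (1 + K)"
  define Cr where "Cr = 2 + 4 * K"
  define C2 where "C2 = 2 * (Cs + 1) * C1 * Cr + 4 * Cs"
  define C3 where "C3 = C2 + C1 * Cr"
  define C4 where "C4 = (1 + K) * C3 * (\<bar>b - m + 1\<bar> + 1) + 1 + C2"
  define c5 where "c5 = 2 * C4 + 2 * C2\<^sup>2"
  \<comment> \<open>The largest value for which the feedback of \<open>norm f\<close> has
    coefficient at most \<open>1 / 2\<close>.\<close>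
  define \<eta> where "\<eta> = 1 / (2 * ((Cs + 1) * C1))"
  have Cpos: "0 < C1" "0 < Cr" using K0 by (simp_all add: C1_def Cr_def add_pos_nonneg)
  then have C2: "0 \<le> C2" using Cs by (simp add: C2_def)
  have C3: "0 \<le> C3" using C2 Cpos by (simp add: C3_def)
  have "0 < C4" using C2 C3 K0 by (simp add: C4_def add_pos_nonneg add_nonneg_pos)
  then have c5: "0 < c5" by (simp add: c5_def add_pos_nonneg)
  have \<eta>: "0 < \<eta>" "(Cs + 1) * C1 * \<eta> \<le> 1 / 2" using Cs Cpos by (simp_all add: \<eta>_def)

  show ?thesis
  proof (rule exI[of _ c5], rule conjI[OF c5], intro allI impI)
    fix n
    \<comment> \<open>The only source of the threshold for \<open>k\<close>; it depends on
      \<open>n\<close> through the finite-dimensional range of \<open>P n\<close>.\<close>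
    have "\<forall>\<^sub>F k in sequentially. \<forall>z\<in>?S. \<forall>h. \<exists>v\<in>range (P k). na (R z (P n h) - v) \<le> \<eta> * norm h"
      by (rule R_finite_rank_approximation[OF compact_cball _ K P_form orth_proj_subspace[OF P] assms(19) P assms(17) \<eta>(1)])
        (use y in auto)
    then show "\<forall>\<^sub>F k in sequentially. \<forall>\<mu>.
           repeated_eigenvalues (range (P k)) (\<lambda>u. A' k u + \<i> *\<^sub>C P k (P n u))
             (ball (complex_of_real lam + \<i>) r) \<kappa> \<mu> \<longrightarrow>
           (MAX j\<in>{1..\<kappa>}. cmod (\<mu> j - complex_of_real lam - \<i>))
             \<le> c5 * (gap norm (range (E {a..b})) (range (P n))
                     + gap na (range (E {a..b})) (range (P k)))\<^sup>2"
    proof (eventually_elim, intro allI impI)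
      fix k \<mu>
      assume approx: "\<forall>z\<in>?S. \<forall>h. \<exists>v\<in>range (P k). na (R z (P n h) - v) \<le> \<eta> * norm h"
      assume rep: "repeated_eigenvalues (range (P k)) (\<lambda>u. A' k u + \<i> *\<^sub>C P k (P n u))
             (ball (complex_of_real lam + \<i>) r) \<kappa> \<mu>"
      let ?Q = "E {a..b}" and ?L = "range (P k)"
      define \<epsilon> where "\<epsilon> = gap norm (range ?Q) (range (P n))"
      define \<epsilon>' where "\<epsilon>' = gap na (range ?Q) ?L"
      have Q: "orth_proj ?Q" by (simp add: E_proj)
      have Q_form: "range ?Q \<subseteq> form_dom E" using E_Icc_in_D D_form_dom by blast
      have L: "complex_vector.subspace ?L" by (rule orth_proj_subspace[OF P])
      have \<epsilon>q: "norm (q - P n q) \<le> \<epsilon> * norm q" if "?Q q = q" for q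
        unfolding \<epsilon>_def by (rule gap_norm_bound[OF Q P that])
      have "0 \<le> \<epsilon> * norm u0" using \<epsilon>q[OF Qu0] norm_ge_zero order_trans by blast
      then have \<epsilon>0: "0 \<le> \<epsilon>" using u0(2) by (simp add: zero_le_mult_iff)
      have \<epsilon>'0: "0 \<le> \<epsilon>'"
        unfolding \<epsilon>'_def by (rule gap_form_norm_nonneg[OF Q Q_form u0(2) Qu0 L P_form])
      have "cmod (\<mu> j - complex_of_real lam - \<i>) \<le> c5 * (\<epsilon> + \<epsilon>')\<^sup>2" if j: "j \<in> {1..\<kappa>}" for j
      proof -
        define z where "z = \<mu> j"
        have "z \<in> ball (complex_of_real lam + \<i>) r"
          unfolding z_def by (rule repeated_eigenvalues_alg_mult(1)[OF rep j])
        then have z: "z \<in> ?S" by simp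
        have "\<exists>u\<in>?L. u \<noteq> 0 \<and> A' k u + \<i> *\<^sub>C P k (P n u) = z *\<^sub>C u"
        proof (rule alg_mult_pos_eigenvector)
          show "0 < alg_mult ?L (\<lambda>u. A' k u + \<i> *\<^sub>C P k (P n u)) z"
            unfolding z_def by (rule repeated_eigenvalues_alg_mult(2)[OF rep j])
          show "A' k v + \<i> *\<^sub>C P k (P n v) - z *\<^sub>C v \<in> ?L" if "v \<in> ?L" for v
            using that assms(22)
            by (intro complex_vector.subspace_diff[OF L] complex_vector.subspace_add[OF L]
                complex_vector.subspace_scale[OF L]) auto
        qed
        then obtain u where u: "u \<in> ?L" "u \<noteq> 0" "A' k u + \<i> *\<^sub>C P k (P n u) = z *\<^sub>C u" by blast
        have eig: "form E u v + \<i> * cinner (P n u) v = z * cinner u v" if v: "v \<in> ?L" for v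
        proof -
          have "cinner (P k (P n u)) v = cinner (P n u) v"
            using v orth_proj_sym[OF P] orth_proj_range_iff[OF P] by simp
          then have "form E u v + \<i> * cinner (P n u) v = cinner (A' k u + \<i> *\<^sub>C P k (P n u)) v"
            using assms(23)[OF u(1) v] by (simp add: cinner_add_left cinner_scaleC_left)
          then show ?thesis unfolding u(3) by (simp add: cinner_scaleC_left)
        qed
        have stab: "norm f \<le> Cs * norm (E (- {a..b}) (A f - z *\<^sub>C f + \<i> *\<^sub>C P n f))"
          if "f \<in> D" "?Q f = 0" for f
        proof -
          have "c1 * norm f \<le> (b - a + 2) * norm (E (- {a..b}) (A f - z *\<^sub>C f + \<i> *\<^sub>C P n f))"
          proof (rule compression_lower_bound[OF assms(4) P that])
            show "1 / 2 \<le> Im z" "Im z \<le> 3 / 2" using y[OF z] by auto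
            show "c1 \<le> (Re z - a) * (b - Re z) - Im z * (1 - Im z)"
              using bspec[OF z0(2) z] unfolding c1_def G_def by linarith
          qed (simp_all add: c1_def)
          then show ?thesis using c1 by (simp add: Cs_def field_simps)
        qed
        \<comment> \<open>Approximation in the form norm is available only for numbers strictly
          above the gap; the estimate is therefore proved for every such number, and
          \<open>\<epsilon>''\<close> then tends to \<open>\<epsilon>'\<close> from the
          right.\<close>
        have "cmod (z - complex_of_real lam - \<i>) \<le> c5 * (\<epsilon> + \<epsilon>'')\<^sup>2" if "\<epsilon>' < \<epsilon>''" for \<epsilon>''
        proof -
          have \<epsilon>'': "0 \<le> \<epsilon>''" "\<And>q. ?Q q = q \<Longrightarrow> \<exists>v\<in>?L. na (q - v) \<le> \<epsilon>'' * na q"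
            using \<epsilon>'0 that gap_form_norm_bound[OF Q Q_form L P_form] by (auto simp: \<epsilon>'_def)
          have ap: "\<And>h. \<exists>v\<in>?L. na (R z (P n h) - v) \<le> \<eta> * norm h" using approx z by blast
          show ?thesis
            unfolding c5_def C4_def C3_def C2_def Cr_def C1_def
            by (rule galerkin_eigenvalue_dist[where P = "P n" and L = ?L and u = u and z = z and r = r
                  and K = K and Cs = Cs and \<epsilon> = \<epsilon> and \<epsilon>' = \<epsilon>'' and \<eta> = \<eta> and a = a and b = b])
              (fact assms(12,13) z E0 K[OF z] P_form L P u(1,2) eig Cs stab \<epsilon>0 \<epsilon>q \<epsilon>''
                less_imp_le[OF \<eta>(1)] ap \<eta>(2)[unfolded C1_def])+
        qed
        then have "\<forall>\<^sub>F t in at_right \<epsilon>'. cmod (z - complex_of_real lam - \<i>) \<le> c5 * (\<epsilon> + t)\<^sup>2"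
          by (auto simp: eventually_at_right_less intro: eventually_mono[OF eventually_at_right_less])
        moreover have "((\<lambda>t. c5 * (\<epsilon> + t)\<^sup>2) \<longlongrightarrow> c5 * (\<epsilon> + \<epsilon>')\<^sup>2) (at_right \<epsilon>')"
          by (intro tendsto_intros)
        ultimately show ?thesis
          unfolding z_def[symmetric] by (intro tendsto_lowerbound[where F = "at_right \<epsilon>'"]) auto
      qed
      then show "(MAX j\<in>{1..\<kappa>}. cmod (\<mu> j - complex_of_real lam - \<i>))
             \<le> c5 * (gap norm (range ?Q) (range (P n)) + gap na (range ?Q) ?L)\<^sup>2"
        using \<kappa> by (intro Max.boundedI) (auto simp: \<epsilon>_def \<epsilon>'_def)
    qed
  qed
qed

end
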